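(* Let $S$ be a connected complex manifold. If $\mathrm{Distr}(S)$ is finite, then $\#\mathrm{Distr}(S)\le\dim S$. Moreover, the distributions are in general position: if $\mathrm{Distr}(S)=\{\mathcal{D}_1,\dots,\mathcal{D}_m\}$, then for a generic point $p\in S$ the projective classes $[\mathcal{D}_1(p)],\dots,[\mathcal{D}_m(p)]$, viewed as points of $\mathbb{P}T^*_pS$, are in general position.
   Context: A (singular) codimension one distribution $\mathcal{D}$ on a complex manifold $S$ is locally defined by holomorphic $1$-forms $\omega$ with zero set of codimension at least two, up to multiplication by nowhere vanishing holomorphic functions (no integrability is required). $\mathrm{Distr}(S)$ is the set of codimension one distributions on $S$. For a point $p$ where a local defining form $\omega$ of $\mathcal{D}$ does not vanish, $[\mathcal{D}(p)]\in\mathbb{P}T^*_pS$ denotes the conormal direction, i.e. the class of $\omega(p)$. A finite set of points $\{p_0,\dots,p_m\}\subset\mathbb{P}^d$ is in general position if no subset of $j+1$ of them, with $j\le d$, lies in a projective subspace of dimension smaller than $j$. "Generic point" means a point outside some proper closed analytic subset. *)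

theory Defs
  imports "HOL-Analysis.Analysis" "HOL-Library.Function_Algebras"
begin

section \<open>Holomorphic functions of several variables\<close>

text \<open>Holomorphic means complex differentiable: the real Frechet derivative exists at every
  point and is complex linear.\<close>

definition holomorphic_several :: "(complex ^ 'n::finite \<Rightarrow> complex) \<Rightarrow> (complex ^ 'n) set \<Rightarrow> bool" where
  "holomorphic_several f U \<longleftrightarrow>
     open U \<and>
     (\<forall>z\<in>U. \<exists>L. (f has_derivative L) (at z) \<and> (\<forall>c v. L (c *s v) = c * L v))"

definition holomorphic_several_map ::
  "(complex ^ 'n::finite \<Rightarrow> complex ^ 'm::finite) \<Rightarrow> (complex ^ 'n) set \<Rightarrow> bool" where
  "holomorphic_several_map f U \<longleftrightarrow> (\<forall>i. holomorphic_several (\<lambda>z. f z $ i) U)"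


section \<open>Complex manifolds\<close>

text \<open>A complex manifold of dimension \<open>CARD('n)\<close> is a Hausdorff second countable space (the whole
  type \<open>'a\<close>) with a holomorphic atlas. The atlas is not required to be maximal. The map of a chart
  is a total function, of which only the values on the chart domain matter.\<close>

type_synonym ('a, 'n) chart = "'a set \<times> ('a \<Rightarrow> complex ^ 'n)"

definition chart_inv :: "('a, 'n) chart \<Rightarrow> complex ^ 'n \<Rightarrow> 'a" where
  "chart_inv c = inv_into (fst c) (snd c)"

definition transition :: "('a, 'n) chart \<Rightarrow> ('a, 'n) chart \<Rightarrow> complex ^ 'n \<Rightarrow> complex ^ 'n" where
  "transition c c' = snd c' \<circ> chart_inv c"

definition is_chart :: "('a::topological_space, 'n::finite) chart \<Rightarrow> bool" where
  "is_chart c \<longleftrightarrow>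
     open (fst c) \<and> open (snd c ` fst c) \<and>
     homeomorphism (fst c) (snd c ` fst c) (snd c) (chart_inv c)"

definition complex_atlas ::
  "('a::{t2_space,second_countable_topology}, 'n::finite) chart set \<Rightarrow> bool" where
  "complex_atlas A \<longleftrightarrow>
     (\<forall>c\<in>A. is_chart c) \<and>
     (\<Union>c\<in>A. fst c) = UNIV \<and>
     (\<forall>c\<in>A. \<forall>c'\<in>A. holomorphic_several_map (transition c c') (snd c ` (fst c \<inter> fst c')))"

definition holomorphic_fun ::
  "('a::{t2_space,second_countable_topology}, 'n::finite) chart set \<Rightarrow> 'a set \<Rightarrow> ('a \<Rightarrow> complex) \<Rightarrow> bool" where
  "holomorphic_fun A W f \<longleftrightarrow>
     open W \<and> (\<forall>c\<in>A. holomorphic_several (f \<circ> chart_inv c) (snd c ` (fst c \<inter> W)))"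


section \<open>Analytic subsets and codimension\<close>

text \<open>The local condition is imposed at every point of the manifold, not just at the points of
  \<open>Z\<close>, so that analytic subsets are automatically closed.\<close>

definition analytic_subset ::
  "('a::{t2_space,second_countable_topology}, 'n::finite) chart set \<Rightarrow> 'a set \<Rightarrow> bool" where
  "analytic_subset A Z \<longleftrightarrow>
     (\<forall>p. \<exists>N F. open N \<and> p \<in> N \<and> finite F \<and> (\<forall>f\<in>F. holomorphic_fun A N f) \<and>
        Z \<inter> N = {q\<in>N. \<forall>f\<in>F. f q = 0})"

text \<open>Locally closed submanifolds of pure codimension \<open>k\<close>: around each of its points, \<open>M\<close> is the
  vanishing locus of \<open>k\<close> coordinates of some chart \<open>c\<close> compatible with the atlas.\<close>

definition submanifold_codim ::
  "('a::{t2_space,second_countable_topology}, 'n::finite) chart set \<Rightarrow> nat \<Rightarrow> 'a set \<Rightarrow> bool" where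
  "submanifold_codim A k M \<longleftrightarrow>
     (\<forall>p\<in>M. \<exists>c I. complex_atlas (insert c A) \<and> p \<in> fst c \<and> card I = k \<and>
        M \<inter> fst c = {q \<in> fst c. \<forall>i\<in>I. snd c q $ i = 0})"

text \<open>The dimension of an analytic set is the largest dimension of a complex submanifold contained
  in it, so its codimension is the least codimension of such a submanifold. The empty set has
  codimension at least \<open>k\<close> for every \<open>k\<close>.\<close>

definition codim_at_least ::
  "('a::{t2_space,second_countable_topology}, 'n::finite) chart set \<Rightarrow> nat \<Rightarrow> 'a set \<Rightarrow> bool" where
  "codim_at_least A k Z \<longleftrightarrow>
     (\<forall>j M. M \<noteq> {} \<and> M \<subseteq> Z \<and> submanifold_codim A j M \<longrightarrow> k \<le> j)"


section \<open>Cotangent spaces\<close>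

text \<open>A covector at \<open>p\<close> is the family of its coefficient vectors \<open>a\<close>, representing
  \<open>\<Sum>i. a $ i * dz\<^sub>i\<close>, in all charts around \<open>p\<close>; the coefficient vectors are related by the
  Jacobian matrices of the transition maps. The entries at charts not around \<open>p\<close> are set to zero.
  Sums and the zero covector are the pointwise ones.\<close>

type_synonym ('a, 'n) covector = "('a, 'n) chart \<Rightarrow> complex ^ 'n"

definition covector_scale :: "complex \<Rightarrow> ('a, 'n::finite) covector \<Rightarrow> ('a, 'n) covector" where
  "covector_scale k \<alpha> = (\<lambda>c. k *s \<alpha> c)"

global_interpretation covector: vector_space covector_scale
  by unfold_locales (auto simp: covector_scale_def fun_eq_iff vec_eq_iff algebra_simps)

definition cotangent_space ::
  "('a::{t2_space,second_countable_topology}, 'n::finite) chart set \<Rightarrow> 'a \<Rightarrow> ('a, 'n) covector set" where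
  "cotangent_space A p =
     {\<alpha>. (\<forall>c. c \<notin> A \<or> p \<notin> fst c \<longrightarrow> \<alpha> c = 0) \<and>
          (\<forall>c\<in>A. \<forall>c'\<in>A. p \<in> fst c \<inter> fst c' \<longrightarrow>
             \<alpha> c = \<alpha> c' v* matrix (frechet_derivative (transition c c') (at (snd c p))))}"

definition holomorphic_form ::
  "('a::{t2_space,second_countable_topology}, 'n::finite) chart set \<Rightarrow> 'a set \<Rightarrow>
   ('a \<Rightarrow> ('a, 'n) covector) \<Rightarrow> bool" where
  "holomorphic_form A W \<omega> \<longleftrightarrow>
     open W \<and> (\<forall>p\<in>W. \<omega> p \<in> cotangent_space A p) \<and>
     (\<forall>c\<in>A. holomorphic_several_map (\<lambda>z. \<omega> (chart_inv c z) c) (snd c ` (fst c \<inter> W)))"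


section \<open>Codimension one distributions\<close>

definition defining_form ::
  "('a::{t2_space,second_countable_topology}, 'n::finite) chart set \<Rightarrow> 'a set \<Rightarrow>
   ('a \<Rightarrow> ('a, 'n) covector) \<Rightarrow> bool" where
  "defining_form A W \<omega> \<longleftrightarrow> holomorphic_form A W \<omega> \<and> codim_at_least A 2 {p\<in>W. \<omega> p = 0}"

definition equal_up_to_unit ::
  "('a::{t2_space,second_countable_topology}, 'n::finite) chart set \<Rightarrow> 'a set \<Rightarrow>
   ('a \<Rightarrow> ('a, 'n) covector) \<Rightarrow> ('a \<Rightarrow> ('a, 'n) covector) \<Rightarrow> bool" where
  "equal_up_to_unit A W \<omega> \<eta> \<longleftrightarrow>
     (\<exists>g. holomorphic_fun A W g \<and> (\<forall>p\<in>W. g p \<noteq> 0 \<and> \<omega> p = covector_scale (g p) (\<eta> p)))"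

text \<open>A distribution is represented by the set of all its local defining forms: a family of local
  defining forms whose domains cover the manifold, which agree up to units on overlaps, and which
  is maximal with this property (in analogy with maximal atlases). By maximality, equality of
  distributions is equality of sets; in particular the values of a form off its domain do not
  matter.\<close>

type_synonym ('a, 'n) distribution = "('a set \<times> ('a \<Rightarrow> ('a, 'n) covector)) set"

definition is_distribution ::
  "('a::{t2_space,second_countable_topology}, 'n::finite) chart set \<Rightarrow> ('a, 'n) distribution \<Rightarrow> bool" where
  "is_distribution A D \<longleftrightarrow>
     (\<forall>(W, \<omega>)\<in>D. defining_form A W \<omega>) \<and>
     (\<Union>(W, \<omega>)\<in>D. W) = UNIV \<and>
     (\<forall>(W, \<omega>)\<in>D. \<forall>(W', \<omega>')\<in>D. equal_up_to_unit A (W \<inter> W') \<omega> \<omega>') \<and>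
     (\<forall>W \<omega>. defining_form A W \<omega> \<and> (\<forall>(W', \<omega>')\<in>D. equal_up_to_unit A (W \<inter> W') \<omega> \<omega>') \<longrightarrow> (W, \<omega>) \<in> D)"

definition Distr ::
  "('a::{t2_space,second_countable_topology}, 'n::finite) chart set \<Rightarrow> ('a, 'n) distribution set" where
  "Distr A = {D. is_distribution A D}"

definition nonsingular_at :: "('a, 'n::finite) distribution \<Rightarrow> 'a \<Rightarrow> bool" where
  "nonsingular_at D p \<longleftrightarrow> (\<exists>(W, \<omega>)\<in>D. p \<in> W \<and> \<omega> p \<noteq> 0)"

text \<open>Points of a projective space are represented by lines through the origin. The following is
  only meaningful if \<open>nonsingular_at D p\<close>; the line is then unique, because defining forms
  differ by nowhere vanishing factors.\<close>

definition conormal_direction :: "('a, 'n::finite) distribution \<Rightarrow> 'a \<Rightarrow> ('a, 'n) covector set" where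
  "conormal_direction D p =
     (THE l. \<exists>(W, \<omega>)\<in>D. p \<in> W \<and> \<omega> p \<noteq> 0 \<and> l = covector.span {\<omega> p})"


section \<open>General position\<close>

definition projectivization :: "('a, 'n::finite) covector set \<Rightarrow> ('a, 'n) covector set set" where
  "projectivization V = {covector.span {\<alpha>} |\<alpha>. \<alpha> \<in> V \<and> \<alpha> \<noteq> 0}"

text \<open>The dimension of the projectivization of \<open>V\<close>; it is \<open>- 1\<close> for the empty projective subspace.\<close>

definition projective_dim :: "('a, 'n::finite) covector set \<Rightarrow> int" where
  "projective_dim V = int (covector.dim V) - 1"

text \<open>General position of a set \<open>P\<close> of points in the projectivization of a finite-dimensional
  space \<open>E\<close>. Restricting to \<open>V \<subseteq> E\<close> is essential: \<open>covector.dim\<close> is \<open>0\<close> on infinite-dimensional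
  subspaces, which the ambient type may have.\<close>

definition general_position ::
  "('a, 'n::finite) covector set \<Rightarrow> ('a, 'n) covector set set \<Rightarrow> bool" where
  "general_position E P \<longleftrightarrow>
     finite P \<and> P \<subseteq> projectivization E \<and>
     (\<forall>j T. int j \<le> projective_dim E \<and> T \<subseteq> P \<and> card T = j + 1 \<longrightarrow>
        \<not> (\<exists>V. covector.subspace V \<and> V \<subseteq> E \<and> projective_dim V < int j \<and> T \<subseteq> projectivization V))"

end

theory Submission
  imports Defs "HOL-Complex_Analysis.Complex_Analysis" "HOL-Computational_Algebra.Fundamental_Theorem_Algebra"
    "Jordan_Normal_Form.Determinant"
begin

text \<open>Suppose that the conormal directions of some set of distributions are linearly dependent at every
point, and let \<open>E\<close> be such a set with as few elements as possible. One distribution alone is not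
dependent, and neither are two, because forms that are proportional on a dense set define the same
distribution; so \<open>E\<close> has at least three members. By minimality a member \<open>D0\<close> is, at a generic
point, a unique linear combination of the others, with nonzero coefficients. The decomposition
\<open>\<omega>0 = \<Sum>D. f D * \<omega> D\<close> is therefore canonical: its summands \<open>f D * \<omega> D\<close> do not depend on the choice
of the forms \<open>\<omega> D\<close>, and all of them are multiplied by the same factor when \<open>\<omega>0\<close> is. Hence each
member \<open>\<omega>0 + t * f D1 * \<omega> D1\<close> of the pencil with \<open>t \<in> \<complex>\<close> is, locally and up to meromorphic factors,
a holomorphic form, and these local forms fit together to a distribution. Different \<open>t\<close> give
different distributions, so there are infinitely many (lemma \<open>minimal_relation_infinite\<close>).

So if there are finitely many distributions, they are linearly independent at some point, which
bounds their number by the dimension. The set \<open>Z\<close> of points where they are dependent is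
the common zero set of minors, hence analytic, and outside \<open>Z\<close> independence gives general position.

The analytic part of the proof turns a local holomorphic form \<open>\<eta>\<close> that is nonzero on a dense set into
a local defining form: the divisorial part of its zeros has to be divided out (lemma \<open>saturation\<close>).
Classically this uses that the ring of germs of holomorphic functions is factorial. Here it is
done directly for a quotient \<open>f / g\<close> of two functions (lemma \<open>reduced_fraction\<close>). On the lines in a
suitable direction the quotient is meromorphic in a disc with finitely many poles, and the
coefficients of the monic polynomial with exactly these poles as roots are given by Cramer's rule from the
moments \<open>\<oint> t ^ k * f / g\<close>, which are holomorphic in the line. Where the Hankel determinant in
Cramer's rule vanishes, the coefficients extend by Riemann's theorem, as they are bounded.

Zero sets of codimension at least two are handled in coordinates as sets that contain the zero set of
no holomorphic function with a zero. That this is the same condition rests on the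
fact that every such zero set contains a piece of a smooth hypersurface (lemma \<open>smooth_zero\<close>).\<close>

no_notation Matrix.vec_index (infixl "$" 100)
no_notation fps_nth (infixl "$" 75)
hide_const (open) Matrix.mat Matrix.vec Determinant.det Matrix.row Matrix.col Matrix.rows Matrix.cols
hide_fact (open) Matrix.vec_eq_iff

section \<open>Holomorphic functions of several variables\<close>
abbreviation "hs \<equiv> holomorphic_several"
abbreviation "hsm \<equiv> holomorphic_several_map"

lemma hs_open: "hs f U \<Longrightarrow> open U"
  by (simp add: holomorphic_several_def)

lemma hs_deriv:
  assumes "hs f U" "z \<in> U"
  obtains L where "(f has_derivative L) (at z)" "\<And>c v. L (c *s v) = c * L v"
  using assms unfolding holomorphic_several_def by blast

lemma hs_continuous_on: "hs f U \<Longrightarrow> continuous_on U f"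
  by (meson hs_deriv continuous_at_imp_continuous_on has_derivative_continuous)

lemma hs_isCont: "hs f U \<Longrightarrow> z \<in> U \<Longrightarrow> isCont f z"
  by (meson hs_deriv has_derivative_continuous)

lemma hs_subset: "hs f U \<Longrightarrow> open V \<Longrightarrow> V \<subseteq> U \<Longrightarrow> hs f V"
  unfolding holomorphic_several_def by blast

lemma hs_local:
  assumes "\<And>z. z \<in> U \<Longrightarrow> \<exists>V. z \<in> V \<and> hs f V" "open U"
  shows "hs f U"
  using assms unfolding holomorphic_several_def by blast

lemma hs_cong:
  assumes "hs f U" "\<And>z. z \<in> U \<Longrightarrow> f z = g z"
  shows "hs g U"
  unfolding holomorphic_several_def
proof (intro conjI ballI)
  fix z assume z: "z \<in> U"
  obtain L where L: "(f has_derivative L) (at z)" "\<And>c v. L (c *s v) = c * L v"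
    using hs_deriv[OF assms(1) z] by blast
  have "(g has_derivative L) (at z)"
    by (rule has_derivative_transform_within_open[OF L(1) hs_open[OF assms(1)] z]) (use assms in auto)
  then show "\<exists>L. (g has_derivative L) (at z) \<and> (\<forall>c v. L (c *s v) = c * L v)"
    using L by blast
qed (use assms hs_open in blast)

lemma hs_const [simp, intro]: "open U \<Longrightarrow> hs (\<lambda>_. c) U"
  unfolding holomorphic_several_def
  by (auto intro!: exI[of _ "\<lambda>_. 0"])

lemma hs_coord [simp, intro]: "open U \<Longrightarrow> hs (\<lambda>z. z $ i) U"
  unfolding holomorphic_several_def
  by (auto intro!: exI[of _ "\<lambda>v. v $ i"] bounded_linear_imp_has_derivative bounded_linear_vec_nth)

lemma hs_add [intro]:
  assumes "hs f U" "hs g U" shows "hs (\<lambda>z. f z + g z) U"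
  unfolding holomorphic_several_def
proof (intro conjI ballI)
  fix z assume z: "z \<in> U"
  obtain L M where "(f has_derivative L) (at z)" "\<And>c v. L (c *s v) = c * L v"
    "(g has_derivative M) (at z)" "\<And>c v. M (c *s v) = c * M v"
    using assms z by (meson hs_deriv)
  then show "\<exists>L. ((\<lambda>z. f z + g z) has_derivative L) (at z) \<and> (\<forall>c v. L (c *s v) = c * L v)"
    by (intro exI[of _ "\<lambda>v. L v + M v"]) (auto intro!: derivative_eq_intros simp: algebra_simps)
qed (use assms hs_open in blast)

lemma hs_mult [intro]:
  assumes "hs f U" "hs g U" shows "hs (\<lambda>z. f z * g z) U"
  unfolding holomorphic_several_def
proof (intro conjI ballI)
  fix z assume z: "z \<in> U"
  obtain L M where "(f has_derivative L) (at z)" "\<And>c v. L (c *s v) = c * L v"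
    "(g has_derivative M) (at z)" "\<And>c v. M (c *s v) = c * M v"
    using assms z by (meson hs_deriv)
  then show "\<exists>L. ((\<lambda>z. f z * g z) has_derivative L) (at z) \<and> (\<forall>c v. L (c *s v) = c * L v)"
    by (intro exI[of _ "\<lambda>v. f z * M v + L v * g z"]) (auto intro!: derivative_eq_intros simp: algebra_simps)
qed (use assms hs_open in blast)

lemma hs_minus [intro]:
  assumes "hs f U" shows "hs (\<lambda>z. - f z) U"
  using hs_mult[OF hs_const[OF hs_open[OF assms], of "-1"] assms] by simp

lemma hs_diff [intro]:
  assumes "hs f U" "hs g U" shows "hs (\<lambda>z. f z - g z) U"
  using hs_add[OF assms(1) hs_minus[OF assms(2)]] by simp

lemma hs_inverse [intro]:
  assumes "hs f U" "\<And>z. z \<in> U \<Longrightarrow> f z \<noteq> 0" shows "hs (\<lambda>z. inverse (f z)) U"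
  unfolding holomorphic_several_def
proof (intro conjI ballI)
  fix z assume z: "z \<in> U"
  obtain L where "(f has_derivative L) (at z)" "\<And>c v. L (c *s v) = c * L v"
    using assms z by (meson hs_deriv)
  then show "\<exists>L. ((\<lambda>z. inverse (f z)) has_derivative L) (at z) \<and> (\<forall>c v. L (c *s v) = c * L v)"
    using assms(2)[OF z]
    by (intro exI[of _ "\<lambda>v. - (inverse (f z) * L v * inverse (f z))"])
       (auto intro!: derivative_eq_intros simp: algebra_simps)
qed (use assms hs_open in blast)

lemma hs_divide [intro]:
  assumes "hs f U" "hs g U" "\<And>z. z \<in> U \<Longrightarrow> g z \<noteq> 0" shows "hs (\<lambda>z. f z / g z) U"
  using hs_mult[OF assms(1) hs_inverse[OF assms(2,3)]] by (simp add: divide_inverse)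

lemma hs_sum [intro]:
  assumes "\<And>i. i \<in> I \<Longrightarrow> hs (f i) U" "open U" shows "hs (\<lambda>z. \<Sum>i\<in>I. f i z) U"
  using assms(1)
  by (induction I rule: infinite_finite_induct) (use assms(2) in auto)

lemma hs_prod [intro]:
  assumes "\<And>i. i \<in> I \<Longrightarrow> hs (f i) U" "open U" shows "hs (\<lambda>z. \<Prod>i\<in>I. f i z) U"
  using assms(1)
  by (induction I rule: infinite_finite_induct) (use assms(2) in auto)

lemma hs_power [intro]:
  assumes "hs f U" shows "hs (\<lambda>z. f z ^ n) U"
  by (induction n) (use assms in \<open>auto intro: hs_open\<close>)

lemma hsm_open: "hsm f U \<Longrightarrow> open U"
  by (metis holomorphic_several_map_def hs_open)

lemma vector_scalar_mult_bounded_linear: "bounded_linear (\<lambda>t::complex. t *s (v::complex^'n))"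
  unfolding bounded_linear_componentwise_iff[of "\<lambda>t. t *s v"] Basis_vec_def
  by (auto simp: inner_axis intro!: bounded_linear_inner_left_comp bounded_linear_mult_left)

lemma norm_smult: "norm (t *s (v::complex^'n)) = norm t * norm v"
  by (simp add: norm_vec_def L2_set_right_distrib norm_mult)

lemma hsm_deriv:
  fixes f :: "complex^'n \<Rightarrow> complex^'m"
  assumes "hsm f U" "z \<in> U"
  obtains L where "(f has_derivative L) (at z)" "\<And>c v. L (c *s v) = c *s L v"
proof -
  have "\<forall>i. \<exists>L. ((\<lambda>z. f z $ i) has_derivative L) (at z) \<and> (\<forall>c v. L (c *s v) = c * L v)"
    using assms by (auto simp: holomorphic_several_map_def holomorphic_several_def)
  then obtain L where L: "\<And>i. ((\<lambda>z. f z $ i) has_derivative L i) (at z)"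
    "\<And>i c v. L i (c *s v) = c * L i v" by metis
  have "(f has_derivative (\<lambda>v. \<chi> i. L i v)) (at z)"
  proof (subst has_derivative_componentwise_within, intro ballI)
    fix b :: "complex^'m" assume "b \<in> Basis"
    then obtain i u where b: "b = axis i u" "u \<in> Basis" by (auto simp: Basis_vec_def)
    have "((\<lambda>x. f x $ i \<bullet> u) has_derivative (\<lambda>v. L i v \<bullet> u)) (at z)"
      using L(1)[of i] by (rule has_derivative_inner_left)
    then show "((\<lambda>x. f x \<bullet> b) has_derivative (\<lambda>v. (\<chi> i. L i v) \<bullet> b)) (at z)"
      by (simp add: b inner_axis)
  qed
  moreover have "\<And>c v. (\<chi> i. L i (c *s v)) = c *s (\<chi> i. L i v)"
    by (simp only: L(2)) (simp only: vector_scalar_mult_def vec_lambda_beta)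
  ultimately show ?thesis using that by blast
qed

lemma hsm_continuous_on: "hsm f U \<Longrightarrow> continuous_on U f"
  by (meson hsm_deriv continuous_at_imp_continuous_on has_derivative_continuous)

lemma hs_compose:
  assumes f: "hs f V" and g: "hsm g U" and "g ` U \<subseteq> V"
  shows "hs (\<lambda>z. f (g z)) U"
  unfolding holomorphic_several_def
proof (intro conjI ballI)
  fix z assume z: "z \<in> U"
  obtain M where M: "(g has_derivative M) (at z)" "\<And>c v. M (c *s v) = c *s M v"
    using hsm_deriv[OF g z] by blast
  obtain L where L: "(f has_derivative L) (at (g z))" "\<And>c v. L (c *s v) = c * L v"
    using hs_deriv[OF f, of "g z"] assms(3) z by blast
  have "((\<lambda>z. f (g z)) has_derivative (\<lambda>v. L (M v))) (at z)"
    using has_derivative_compose[OF M(1) L(1)] .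
  then show "\<exists>L. ((\<lambda>z. f (g z)) has_derivative L) (at z) \<and> (\<forall>c v. L (c *s v) = c * L v)"
    using L M by (intro exI[of _ "\<lambda>v. L (M v)"]) auto
qed (use assms hsm_open in blast)

lemma hsm_translate: "open U \<Longrightarrow> hsm (\<lambda>z. z + v) U"
  unfolding holomorphic_several_map_def by (auto intro!: hs_add)

lemma continuous_on_smult [continuous_intros]:
  fixes f :: "'a::topological_space \<Rightarrow> complex" and g :: "'a \<Rightarrow> complex^'n"
  assumes "continuous_on S f" "continuous_on S g"
  shows "continuous_on S (\<lambda>x. f x *s g x)"
  unfolding vector_scalar_mult_def
  by (intro continuous_on_vec_lambda continuous_intros assms)

lemma hs_line_deriv:
  assumes "hs f U" "z + t *s v \<in> U"
  obtains L where "((\<lambda>t. f (z + t *s v)) has_field_derivative L v) (at t)"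
    "(f has_derivative L) (at (z + t *s v))" "\<And>c v. L (c *s v) = c * L v"
proof -
  obtain L where L: "(f has_derivative L) (at (z + t *s v))" "\<And>c v. L (c *s v) = c * L v"
    using hs_deriv[OF assms] by blast
  have "((\<lambda>t. z + t *s v) has_derivative (\<lambda>t. t *s v)) (at t)"
    by (auto intro!: derivative_eq_intros bounded_linear_imp_has_derivative vector_scalar_mult_bounded_linear)
  from has_derivative_compose[OF this L(1)]
  have "((\<lambda>t. f (z + t *s v)) has_field_derivative L v) (at t)"
    unfolding has_field_derivative_def L by (simp add: mult.commute[of _ "L v"])
  then show ?thesis using L that by blast
qed

lemma hs_line:
  assumes "hs f U" "\<And>t. t \<in> T \<Longrightarrow> z + t *s v \<in> U"
  shows "(\<lambda>t. f (z + t *s v)) holomorphic_on T"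
proof (rule holomorphic_onI)
  fix t assume "t \<in> T"
  from hs_line_deriv[OF assms(1) assms(2)[OF this]]
  show "(\<lambda>t. f (z + t *s v)) field_differentiable at t within T"
    by (metis field_differentiable_at_within field_differentiable_def)
qed

definition dirderiv :: "complex^'n \<Rightarrow> (complex^'n \<Rightarrow> complex) \<Rightarrow> complex^'n \<Rightarrow> complex" where
  "dirderiv v f z = deriv (\<lambda>t. f (z + t *s v)) 0"

lemma hs_has_derivative:
  fixes f :: "complex^'n \<Rightarrow> complex"
  assumes "hs f U" "z \<in> U"
  shows "(f has_derivative (\<lambda>h. \<Sum>i\<in>UNIV. h $ i * dirderiv (axis i 1) f z)) (at z)"
    and "dirderiv v f z = (\<Sum>i\<in>UNIV. v $ i * dirderiv (axis i 1) f z)"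
proof -
  obtain L where L: "(f has_derivative L) (at z)" "\<And>c v. L (c *s v) = c * L v"
    using hs_deriv[OF assms] by blast
  interpret L: bounded_linear L using L(1) by (rule has_derivative_bounded_linear)
  have dd: "dirderiv v f z = L v" for v
  proof -
    have "z + 0 *s v \<in> U" using assms by simp
    from hs_line_deriv[OF assms(1) this] obtain M where
      M: "((\<lambda>t. f (z + t *s v)) has_field_derivative M v) (at 0)" "(f has_derivative M) (at z)"
      by (metis (no_types, lifting) add.right_neutral vector_smult_lzero)
    have "M = L" using M(2) L(1) has_derivative_unique by blast
    then show ?thesis using M(1) by (simp add: dirderiv_def DERIV_imp_deriv)
  qed
  have eq: "L h = (\<Sum>i\<in>UNIV. h $ i * dirderiv (axis i 1) f z)" for h
  proof -
    have "L h = L (\<Sum>i\<in>UNIV. h $ i *s axis i 1)" by (simp add: basis_expansion)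
    also have "\<dots> = (\<Sum>i\<in>UNIV. h $ i * L (axis i 1))" by (simp add: L.sum L(2))
    finally show ?thesis by (simp add: dd)
  qed
  show "(f has_derivative (\<lambda>h. \<Sum>i\<in>UNIV. h $ i * dirderiv (axis i 1) f z)) (at z)"
    using L(1) unfolding eq[symmetric] .
  show "dirderiv v f z = (\<Sum>i\<in>UNIV. v $ i * dirderiv (axis i 1) f z)"
    using eq dd by metis
qed

text \<open>The factor \<open>1 / (2 * pi * \<i>)\<close> is built in, so that Cauchy's formula holds without a constant.\<close>
definition circ :: "real \<Rightarrow> (complex \<Rightarrow> complex) \<Rightarrow> complex" where
  "circ r F = contour_integral (circlepath 0 r) F / (2 * pi * \<i>)"

lemma circ_integral:
  "circ r F = integral {0..1} (\<lambda>x. F (circlepath 0 r x) * circlepath 0 r x)"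
proof -
  have "contour_integral (circlepath 0 r) F = integral {0..1} (\<lambda>x. (2 * pi * \<i>) * (F (circlepath 0 r x) * circlepath 0 r x))"
    unfolding contour_integral_integral
    by (rule integral_cong) (simp only: vector_derivative_circlepath, simp add: circlepath algebra_simps)
  also have "\<dots> = (2 * pi * \<i>) * integral {0..1} (\<lambda>x. F (circlepath 0 r x) * circlepath 0 r x)"
    by (rule integral_mult_right)
  finally show ?thesis by (simp add: circ_def)
qed

lemma circlepath_in_sphere: "0 \<le> r \<Longrightarrow> circlepath 0 r x \<in> sphere 0 r"
  by (simp add: circlepath norm_mult)

lemma continuous_on_circlepath: "continuous_on S (circlepath 0 r)"
  unfolding circlepath by (intro continuous_intros)

lemma continuous_on_circ:
  fixes F :: "'a::topological_space \<Rightarrow> complex \<Rightarrow> complex"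
  assumes "continuous_on (U \<times> sphere 0 r) (\<lambda>(z,t). F z t)" "0 \<le> r"
  shows "continuous_on U (\<lambda>z. circ r (F z))"
proof -
  have "continuous_on (U \<times> cbox 0 1) (\<lambda>(z,x). F z (circlepath 0 r x) * circlepath 0 r x)"
    unfolding split_def
    by (intro continuous_intros continuous_on_compose2[OF continuous_on_circlepath]
        continuous_on_compose2[OF assms(1), where f="\<lambda>p. (fst p, circlepath 0 r (snd p))", simplified split_def fst_conv snd_conv])
       (use circlepath_in_sphere[OF assms(2)] in \<open>auto simp del: mem_sphere\<close>)
  from integral_continuous_on_param[OF this]
  show ?thesis by (simp add: circ_integral)
qed

lemma dirderiv_circ:
  assumes "hs f U" "\<And>t. t \<in> cball 0 r \<Longrightarrow> z + t *s v \<in> U" "r > 0"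
  shows "dirderiv v f z = circ r (\<lambda>t. f (z + t *s v) / t^2)"
proof -
  have "(\<lambda>t. f (z + t *s v)) holomorphic_on cball 0 r"
    by (rule hs_line[OF assms(1,2)])
  then have "((\<lambda>t. f (z + t *s v)) has_field_derivative 1 / (2 * of_real pi * \<i>) *
     contour_integral (circlepath 0 r) (\<lambda>u. f (z + u *s v) / (u - 0)^2)) (at 0)"
    by (intro Cauchy_derivative_integral_circlepath)
       (use assms in \<open>auto intro: holomorphic_on_imp_continuous_on holomorphic_on_subset\<close>)
  then show ?thesis
    by (simp add: dirderiv_def DERIV_imp_deriv circ_def)
qed

lemma circ_Cauchy:
  assumes "continuous_on (cball 0 r) f" "f holomorphic_on ball 0 r" "norm w < r"
  shows "circ r (\<lambda>t. f t / (t - w)) = f w"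
  using Cauchy_integral_circlepath[OF assms(1,2), of w] assms(3)
  by (simp add: circ_def contour_integral_unique)

text \<open>Differentiation under the integral sign asks for a derivative that is continuous as a family of
bounded linear maps; a complex linear functional depends continuously on its coefficients.\<close>
lemma cl_blinfun_continuous:
  fixes g :: "'a::topological_space \<Rightarrow> complex"
  assumes "continuous_on S g"
  shows "continuous_on S (\<lambda>x. Blinfun (\<lambda>h::complex^'n. h $ i * g x))"
proof -
  have bl: "bounded_linear (\<lambda>h::complex^'n. h $ i * c)" for c
    by (intro bounded_linear_mult_const bounded_linear_vec_nth)
  have eq: "Blinfun (\<lambda>h::complex^'n. h $ i * c) =
     Re c *\<^sub>R Blinfun (\<lambda>h. h $ i * 1) + Im c *\<^sub>R Blinfun (\<lambda>h. h $ i * \<i>)" for c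
  proof (rule blinfun_eqI)
    fix h :: "complex^'n"
    show "blinfun_apply (Blinfun (\<lambda>h. h $ i * c)) h =
       blinfun_apply (Re c *\<^sub>R Blinfun (\<lambda>h. h $ i * 1) + Im c *\<^sub>R Blinfun (\<lambda>h. h $ i * \<i>)) h"
      using bl[of c] bl[of 1] bl[of \<i>]
      by (simp add: bounded_linear_Blinfun_apply plus_blinfun.rep_eq scaleR_blinfun.rep_eq complex_eq_iff)
  qed
  show ?thesis
    unfolding eq[of "g _"] by (intro continuous_intros assms)
qed

text \<open>By Cauchy's formula the partial derivatives of the integrand are circle integrals of its values,
hence jointly continuous. So one may differentiate under the integral sign.\<close>
lemma hs_circ:
  fixes F :: "complex^'n \<Rightarrow> complex \<Rightarrow> complex"
  assumes cont: "continuous_on (U \<times> sphere 0 r) (\<lambda>(z,t). F z t)"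
    and hol: "\<And>t. t \<in> sphere 0 r \<Longrightarrow> hs (\<lambda>z. F z t) U" and "open U" and r: "0 \<le> r"
  shows "hs (\<lambda>z. circ r (F z)) U"
  unfolding holomorphic_several_def
proof (intro conjI ballI)
  fix z0 assume z0: "z0 \<in> U"
  let ?c = "circlepath 0 r"
  have cs: "?c x \<in> sphere 0 r" for x using circlepath_in_sphere[OF r] .
  obtain e where e: "e > 0" "ball z0 (2*e) \<subseteq> U"
    using z0 \<open>open U\<close> open_contains_ball
    by (metis (no_types, opaque_lifting) field_sum_of_halves half_gt_zero mult_2)
  define \<epsilon> where "\<epsilon> = e/2"
  have \<epsilon>: "\<epsilon> > 0" using e by (simp add: \<epsilon>_def)
  let ?B = "ball z0 e"
  have inU: "z + t *s axis i 1 \<in> U" if "z \<in> ?B" "norm t \<le> \<epsilon>" for z t and i :: 'n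
  proof -
    have "norm (t *s axis i 1 :: complex^'n) = norm t"
      by (simp add: norm_smult norm_axis_1)
    then have "dist z0 (z + t *s axis i 1) < 2 * e"
      using that e norm_triangle_ineq4[of "z0 - z" "t *s axis i 1"]
      by (simp add: dist_norm \<epsilon>_def algebra_simps)
    then show ?thesis using e by auto
  qed
  have BU: "?B \<subseteq> U" using e by auto
  define F' where "F' = (\<lambda>z x. F z (?c x) * ?c x)"
  define D where "D = (\<lambda>i z x. circ \<epsilon> (\<lambda>t. F' (z + t *s axis i 1) x / t^2))"
  have hF': "hs (\<lambda>z. F' z x) U" for x
    unfolding F'_def by (intro hs_mult hol cs hs_const \<open>open U\<close>)
  have cF': "continuous_on (U \<times> UNIV) (\<lambda>(z,x). F' z x)"
    unfolding F'_def split_def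
    by (intro continuous_intros continuous_on_compose2[OF continuous_on_circlepath]
        continuous_on_compose2[OF cont, where f="\<lambda>p. (fst p, ?c (snd p))", simplified split_def fst_conv snd_conv])
       (use cs in \<open>auto simp del: mem_sphere\<close>)
  have D: "dirderiv (axis i 1) (\<lambda>z. F' z x) z = D i z x" if "z \<in> ?B" for i z x
    unfolding D_def using inU that \<epsilon> by (intro dirderiv_circ[OF hF']) auto
  have cD: "continuous_on (?B \<times> UNIV) (\<lambda>(z,x). D i z x)" for i
  proof -
    have "continuous_on ((?B \<times> UNIV) \<times> sphere 0 \<epsilon>) (\<lambda>(p,t). F' (fst p + t *s axis i 1) (snd p) / t^2)"
      unfolding split_def
      by (intro continuous_intros
        continuous_on_compose2[OF cF', where f="\<lambda>q. (fst (fst q) + snd q *s axis i 1, snd (fst q))", simplified split_def fst_conv snd_conv])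
         (use inU \<epsilon> in auto)
    from continuous_on_circ[OF this] \<epsilon> show ?thesis by (simp add: D_def split_def)
  qed
  have bl: "bounded_linear (\<lambda>h::complex^'n. h $ i * c)" for i c
    by (intro bounded_linear_mult_const bounded_linear_vec_nth)
  define fx where "fx = (\<lambda>z x. \<Sum>i\<in>UNIV. Blinfun (\<lambda>h::complex^'n. h $ i * D i z x))"
  have fx: "blinfun_apply (fx z x) h = (\<Sum>i\<in>UNIV. h $ i * D i z x)" for z x h
    unfolding fx_def by (simp add: blinfun.sum_left bounded_linear_Blinfun_apply[OF bl])
  have der: "((\<lambda>z. integral (cbox 0 1) (F' z)) has_derivative integral (cbox 0 1) (fx z0)) (at z0 within ?B)"
  proof (rule leibniz_rule)
    fix z x assume z: "z \<in> ?B"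
    have "blinfun_apply (fx z x) = (\<lambda>h. \<Sum>i\<in>UNIV. h $ i * dirderiv (axis i 1) (\<lambda>z. F' z x) z)"
      using D[OF z] by (simp add: fx fun_eq_iff)
    then show "((\<lambda>z. F' z x) has_derivative blinfun_apply (fx z x)) (at z within ?B)"
      using hs_has_derivative(1)[OF hF' subsetD[OF BU z]] by (simp add: has_derivative_at_withinI)
  next
    fix z assume "z \<in> ?B"
    then show "F' z integrable_on cbox 0 1"
      using BU by (intro integrable_continuous continuous_on_compose2[OF cF', where f="\<lambda>x. (z,x)", simplified split_def fst_conv snd_conv] continuous_intros) auto
  next
    show "continuous_on (?B \<times> cbox 0 1) (\<lambda>(z, t). fx z t)"
      unfolding fx_def split_def
      by (intro continuous_on_sum cl_blinfun_continuous)
         (use cD in \<open>auto simp: split_def intro: continuous_on_subset\<close>)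
  qed (use e in auto)
  have "((\<lambda>z. circ r (F z)) has_derivative integral (cbox 0 1) (fx z0)) (at z0)"
    using der e by (simp add: at_within_open[of z0 ?B] circ_integral F'_def)
  moreover have "integral (cbox 0 1) (fx z0) (c *s v) = c * integral (cbox 0 1) (fx z0) v" for c v
  proof -
    have "fx z0 integrable_on cbox 0 1"
      unfolding fx_def
      by (intro integrable_continuous continuous_on_sum cl_blinfun_continuous
           continuous_on_compose2[OF cD, where f="\<lambda>x. (z0,x)", simplified split_def fst_conv snd_conv] continuous_intros)
         (use e in auto)
    then have "blinfun_apply (integral (cbox 0 1) (fx z0)) h = integral (cbox 0 1) (\<lambda>x. fx z0 x h)" for h
      by (rule blinfun_apply_integral)
    moreover have "fx z0 x (c *s v) = c * fx z0 x v" for x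
      by (simp add: fx sum_distrib_left mult_ac)
    ultimately show ?thesis by (simp only: integral_mult_right)
  qed
  ultimately show "\<exists>L. ((\<lambda>z. circ r (F z)) has_derivative L) (at z0) \<and> (\<forall>c v. L (c *s v) = c * L v)"
    by blast
qed (use assms in blast)

text \<open>Near a given point the derivative is a Cauchy integral over a circle of fixed radius, to which
lemma \<open>hs_circ\<close> applies.\<close>
lemma hs_dirderiv:
  fixes f :: "complex^'n \<Rightarrow> complex"
  assumes "hs f U"
  shows "hs (dirderiv v f) U"
proof (rule hs_local)
  show "open U" using assms hs_open by blast
  fix z assume z: "z \<in> U"
  define W where "W = {q. fst q + snd q *s v \<in> U}"
  have "open W"
    unfolding W_def
    using open_vimage[OF \<open>open U\<close>, of "\<lambda>q. fst q + snd q *s v"] by (simp add: vimage_def continuous_intros)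
  moreover have "(z,0) \<in> W" using z by (simp add: W_def)
  ultimately obtain A B where AB: "open A" "open B" "z \<in> A" "0 \<in> B" "A \<times> B \<subseteq> W"
    by (metis open_prod_elim mem_Sigma_iff)
  obtain r where r: "r > 0" "cball 0 r \<subseteq> B" using AB open_contains_cball by blast
  have in_U: "y + t *s v \<in> U" if "y \<in> A" "norm t \<le> r" for y t
    using that r AB by (force simp: W_def)
  have "hs (\<lambda>z. circ r (\<lambda>t. f (z + t *s v) / t^2)) A"
  proof (rule hs_circ)
    show "continuous_on (A \<times> sphere 0 r) (\<lambda>(z, t). f (z + t *s v) / t\<^sup>2)"
      unfolding split_def
      by (intro continuous_intros continuous_on_compose2[OF hs_continuous_on[OF assms]])
         (use in_U r in auto)
    show "hs (\<lambda>z. f (z + t *s v) / t\<^sup>2) A" if "t \<in> sphere 0 r" for t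
      by (rule hs_divide[OF hs_compose[OF assms hsm_translate]])
         (use in_U r AB that in auto)
  qed (use AB r in auto)
  then have "hs (dirderiv v f) A"
    by (rule hs_cong) (use in_U r in \<open>auto intro!: dirderiv_circ[OF assms, symmetric]\<close>)
  then show "\<exists>V. z \<in> V \<and> hs (dirderiv v f) V" using AB by blast
qed

section \<open>Restriction to complex lines\<close>
lemma line_vimage_open_convex:
  fixes z v :: "complex^'n"
  shows "open U \<Longrightarrow> open {t. z + t *s v \<in> U}" and "convex U \<Longrightarrow> convex {t. z + t *s v \<in> U}"
proof -
  show "open U \<Longrightarrow> open {t. z + t *s v \<in> U}"
    using open_vimage[of U "\<lambda>t. z + t *s v"] by (simp add: vimage_def continuous_intros)
  assume "convex U"
  show "convex {t. z + t *s v \<in> U}"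
  proof (rule convexI)
    fix x y :: complex and a b :: real
    assume "x \<in> {t. z + t *s v \<in> U}" "y \<in> {t. z + t *s v \<in> U}" "0 \<le> a" "0 \<le> b" "a + b = 1"
    then have *: "z + x *s v \<in> U" "z + y *s v \<in> U" "0 \<le> a" "0 \<le> b" "a + b = 1" by auto
    have "a *\<^sub>R (z + x *s v) + b *\<^sub>R (z + y *s v) = (a + b) *\<^sub>R z + (a *\<^sub>R x + b *\<^sub>R y) *s v"
      by (rule vec_eq_iff[THEN iffD2], intro allI) (simp add: scaleR_conv_of_real[where 'a=complex] algebra_simps)
    then have "z + (a *\<^sub>R x + b *\<^sub>R y) *s v = a *\<^sub>R (z + x *s v) + b *\<^sub>R (z + y *s v)"
      using *(5) by simp
    also have "\<dots> \<in> U" using * \<open>convex U\<close> by (simp add: convexD)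
    finally show "a *\<^sub>R x + b *\<^sub>R y \<in> {t. z + t *s v \<in> U}" by simp
  qed
qed

text \<open>The restriction to the complex line through \<open>z\<close> and a point of \<open>V\<close> is a function of one variable on
a convex domain.\<close>
lemma hs_identity:
  assumes f: "hs f U" "convex U" and V: "open V" "V \<subseteq> U" "V \<noteq> {}" "\<And>z. z \<in> V \<Longrightarrow> f z = 0" and "z \<in> U"
  shows "f z = 0"
proof -
  obtain z0 where z0: "z0 \<in> V" using V by blast
  let ?T = "\<lambda>U. {t. z0 + t *s (z - z0) \<in> U}"
  have "f (z0 + 1 *s (z - z0)) = 0"
  proof (rule analytic_continuation_open[where s = "?T V" and s' = "?T U" and g = "\<lambda>_. 0" and z = 1
        and f = "\<lambda>t. f (z0 + t *s (z - z0))"])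
    show "?T V \<noteq> {}" using z0 by (auto intro!: exI[of _ 0])
    show "connected (?T U)" by (rule convex_connected[OF line_vimage_open_convex(2)[OF f(2)]])
    show "open (?T V)" by (rule line_vimage_open_convex(1)[OF V(1)])
    show "open (?T U)" by (rule line_vimage_open_convex(1)[OF hs_open[OF f(1)]])
    show "(\<lambda>t. f (z0 + t *s (z - z0))) holomorphic_on ?T U" by (rule hs_line[OF f(1)]) simp
    show "1 \<in> ?T U" using assms(7) by simp
  qed (use V in auto)
  then show ?thesis by simp
qed

text \<open>The condition is tested on all open subsets of \<open>U\<close>, so that it passes to subsets and makes sense
without a condition on \<open>U\<close>.\<close>
definition dense_in :: "('a::topological_space \<Rightarrow> bool) \<Rightarrow> 'a set \<Rightarrow> bool" where
  "dense_in P U \<longleftrightarrow> (\<forall>V. open V \<and> V \<subseteq> U \<and> V \<noteq> {} \<longrightarrow> (\<exists>z\<in>V. P z))"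

lemma dense_inD: "dense_in P U \<Longrightarrow> open V \<Longrightarrow> V \<subseteq> U \<Longrightarrow> z \<in> V \<Longrightarrow> \<exists>z\<in>V. P z"
  unfolding dense_in_def by blast

lemma dense_in_subset: "dense_in P U \<Longrightarrow> V \<subseteq> U \<Longrightarrow> dense_in P V"
  unfolding dense_in_def by blast

lemma dense_in_mono: "dense_in P U \<Longrightarrow> (\<And>z. z \<in> U \<Longrightarrow> P z \<Longrightarrow> Q z) \<Longrightarrow> dense_in Q U"
  unfolding dense_in_def by blast

lemma dense_in_conj:
  assumes "dense_in P U" "dense_in Q U" "open {z\<in>U. P z}"
  shows "dense_in (\<lambda>z. P z \<and> Q z) U"
  unfolding dense_in_def
proof (intro allI impI, elim conjE)
  fix V assume V: "open V" "V \<subseteq> U" "V \<noteq> {}"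
  then obtain z where "z \<in> V" "P z" using assms(1) unfolding dense_in_def by blast
  then have "open (V \<inter> {z\<in>U. P z})" "V \<inter> {z\<in>U. P z} \<noteq> {}" "V \<inter> {z\<in>U. P z} \<subseteq> U"
    using V assms(3) by auto
  then show "\<exists>z\<in>V. P z \<and> Q z" using assms(2) unfolding dense_in_def by blast
qed

lemma hs_dense:
  assumes "hs f U" "convex U" "z \<in> U" "f z \<noteq> 0"
  shows "dense_in (\<lambda>z. f z \<noteq> 0) U"
  unfolding dense_in_def using hs_identity[OF assms(1,2)] assms(3,4) by blast

lemma open_nonzero:
  fixes f :: "'a::topological_space \<Rightarrow> 'b::t1_space"
  assumes "continuous_on U f" "open U" shows "open {z\<in>U. f z \<noteq> a}"
proof -
  have "open (f -` (-{a}) \<inter> U)"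
    using assms by (intro continuous_on_open_vimage[THEN iffD1, rule_format]) auto
  moreover have "f -` (-{a}) \<inter> U = {z\<in>U. f z \<noteq> a}" by auto
  ultimately show ?thesis by simp
qed

lemma continuous_eq_on_dense:
  fixes f g :: "'a::topological_space \<Rightarrow> 'b::real_normed_vector"
  assumes "continuous_on U f" "continuous_on U g" "open U" "dense_in (\<lambda>z. f z = g z) U" "z \<in> U"
  shows "f z = g z"
proof (rule ccontr)
  assume "f z \<noteq> g z"
  moreover have "open {z\<in>U. f z - g z \<noteq> 0}"
    by (rule open_nonzero) (use assms in \<open>auto intro!: continuous_intros\<close>)
  ultimately show False
    using dense_inD[OF assms(4), of "{z\<in>U. f z - g z \<noteq> 0}" z] assms(5) by auto
qed

text \<open>A tube lemma for lines in direction \<open>v\<close>: it provides the cylinders on which Cauchy integrals over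
parallel circles are formed.\<close>
lemma compact_line_nbhd:
  fixes v :: "complex^'n"
  assumes "open U" "compact K" "\<And>t. t \<in> K \<Longrightarrow> z + t *s v \<in> U"
  shows "\<exists>e>0. \<forall>y\<in>ball z e. \<forall>t\<in>K. y + t *s v \<in> U"
proof -
  have "compact ((\<lambda>t. z + t *s v) ` K)"
    by (intro compact_continuous_image continuous_intros assms)
  moreover have "(\<lambda>t. z + t *s v) ` K \<subseteq> U" using assms by auto
  ultimately obtain e where e: "e > 0" "(\<Union>x\<in>(\<lambda>t. z + t *s v) ` K. ball x e) \<subseteq> U"
    using compact_subset_open_imp_ball_epsilon_subset[OF _ assms(1)] by blast
  have "y + t *s v \<in> U" if "y \<in> ball z e" "t \<in> K" for y t
  proof -
    have "y + t *s v \<in> ball (z + t *s v) e" using that by (simp add: dist_norm)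
    then show ?thesis using that e by blast
  qed
  then show ?thesis using e by blast
qed

lemma line_isolated_zero:
  assumes "hs f U" "convex U" "p \<in> U" "p + v \<in> U" "f (p + v) \<noteq> 0"
  obtains r where "r > 0" "\<And>t. norm t \<le> r \<Longrightarrow> p + t *s v \<in> U" "\<And>t. norm t \<le> r \<Longrightarrow> t \<noteq> 0 \<Longrightarrow> f (p + t *s v) \<noteq> 0"
proof -
  let ?T = "{t. p + t *s v \<in> U}"
  have T: "open ?T" "connected ?T" "0 \<in> ?T"
    using assms hs_open[OF assms(1)] by (simp_all add: convex_connected line_vimage_open_convex)
  have "\<forall>\<^sub>F t in at 0. f (p + t *s v) \<noteq> 0 \<and> t \<in> ?T"
    by (rule non_zero_neighbour_alt[where \<beta>=1]) (use T assms in \<open>auto intro: hs_line\<close>)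
  then obtain d where d: "d > 0" "\<And>t. t \<noteq> 0 \<Longrightarrow> norm t < d \<Longrightarrow> f (p + t *s v) \<noteq> 0 \<and> t \<in> ?T"
    unfolding eventually_at by auto
  show ?thesis
  proof (rule that[of "d/2"])
    fix t :: complex assume "norm t \<le> d/2"
    then show "p + t *s v \<in> U" using d T(3) by (cases "t = 0") auto
  qed (use d in auto)
qed

lemma line_isolated_zero':
  assumes "hs f U" "p \<in> U" and ex: "\<And>d. d > 0 \<Longrightarrow> \<exists>t. norm t < d \<and> f (p + t *s v) \<noteq> 0"
  obtains r where "r > 0" "\<And>t. norm t \<le> r \<Longrightarrow> p + t *s v \<in> U" "\<And>t. norm t \<le> r \<Longrightarrow> t \<noteq> 0 \<Longrightarrow> f (p + t *s v) \<noteq> 0"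
proof -
  let ?T = "{t. p + t *s v \<in> U}"
  have "open ?T" "0 \<in> ?T" using assms hs_open[OF assms(1)] by (simp_all add: line_vimage_open_convex)
  then obtain d where d: "d > 0" "ball 0 d \<subseteq> ?T" using open_contains_ball by blast
  obtain \<beta> where \<beta>: "norm \<beta> < d" "f (p + \<beta> *s v) \<noteq> 0" using ex d by blast
  have "\<forall>\<^sub>F t in at 0. f (p + t *s v) \<noteq> 0 \<and> t \<in> ball 0 d"
    by (rule non_zero_neighbour_alt[where \<beta>=\<beta>]) (use d \<beta> assms in \<open>auto intro: hs_line\<close>)
  then obtain d' where d': "d' > 0" "\<And>t. t \<noteq> 0 \<Longrightarrow> norm t < d' \<Longrightarrow> f (p + t *s v) \<noteq> 0 \<and> t \<in> ball 0 d"
    unfolding eventually_at by auto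
  show ?thesis
  proof (rule that[of "d'/2"])
    fix t :: complex assume "norm t \<le> d'/2"
    then show "p + t *s v \<in> U" using d d' assms(2) by (cases "t = 0") (auto simp: subset_iff)
  qed (use d' in auto)
qed

text \<open>On a small circle around \<open>p\<close> in direction \<open>v\<close> the function is bounded away from zero, also on nearby
parallel lines. If it had no zero inside the circle, its reciprocal would violate the maximum principle,
since at the centre the function is close to \<open>f p = 0\<close>.\<close>
lemma hs_zero_persists:
  assumes f: "hs f U" "p \<in> U" "f p = 0"
    and ex: "\<And>d. d > 0 \<Longrightarrow> \<exists>t. norm t < d \<and> f (p + t *s v) \<noteq> 0" and d: "d > 0"
  obtains e where "e > 0" "\<And>y. y \<in> ball p e \<Longrightarrow> \<exists>t. norm t < d \<and> y + t *s v \<in> U \<and> f (y + t *s v) = 0"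
proof -
  obtain r0 where r0: "r0 > 0" "\<And>t. norm t \<le> r0 \<Longrightarrow> p + t *s v \<in> U" "\<And>t. norm t \<le> r0 \<Longrightarrow> t \<noteq> 0 \<Longrightarrow> f (p + t *s v) \<noteq> 0"
    using line_isolated_zero'[OF f(1,2) ex] by blast
  define r where "r = min r0 (d/2)"
  have r: "r > 0" "r < d" "r \<le> r0" using r0 d by (auto simp: r_def)
  have cont: "continuous_on U f" by (rule hs_continuous_on[OF f(1)])
  have "continuous_on (sphere 0 r) (\<lambda>t. norm (f (p + t *s v)))"
    by (intro continuous_intros continuous_on_compose2[OF cont]) (use r r0 in auto)
  moreover have "sphere (0::complex) r \<noteq> {}" using r by simp
  ultimately obtain t0 where t0: "t0 \<in> sphere 0 r" "\<And>t. t \<in> sphere 0 r \<Longrightarrow> norm (f (p + t0 *s v)) \<le> norm (f (p + t *s v))"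
    using continuous_attains_inf[OF compact_sphere, of 0 r "\<lambda>t. norm (f (p + t *s v))"] by blast
  define \<mu> where "\<mu> = norm (f (p + t0 *s v)) / 2"
  have \<mu>: "\<mu> > 0" using r0(3)[of t0] t0 r by (auto simp: \<mu>_def)
  have ge: "norm (f (p + t *s v)) > \<mu>" if "t \<in> sphere 0 r" for t
    using t0(2)[OF that] \<mu> unfolding \<mu>_def by linarith
  let ?W = "{z\<in>U. norm (f z) \<in> {\<mu><..}}"
  have W: "open ?W"
  proof -
    have "open (U \<inter> (\<lambda>z. norm (f z)) -` {\<mu><..})"
      by (intro continuous_open_preimage continuous_intros cont hs_open[OF f(1)] open_greaterThan)
    moreover have "U \<inter> (\<lambda>z. norm (f z)) -` {\<mu><..} = ?W" by auto
    ultimately show ?thesis by simp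
  qed
  have onW: "p + t *s v \<in> ?W" if "t \<in> sphere 0 r" for t
    using ge[OF that] r r0(2)[of t] that by simp
  obtain e1 where e1: "e1 > 0" "\<And>y t. y \<in> ball p e1 \<Longrightarrow> t \<in> sphere 0 r \<Longrightarrow> y + t *s v \<in> ?W"
    using compact_line_nbhd[OF W compact_sphere onW] by blast
  have onc: "p + t *s v \<in> U" if "t \<in> cball 0 r" for t
    using r r0(2)[of t] that by simp
  obtain e2 where e2: "e2 > 0" "\<And>y t. y \<in> ball p e2 \<Longrightarrow> t \<in> cball 0 r \<Longrightarrow> y + t *s v \<in> U"
    using compact_line_nbhd[OF hs_open[OF f(1)] compact_cball onc] by blast
  have "isCont f p" using hs_isCont f by blast
  then obtain e3 where e3: "e3 > 0" "\<And>y. y \<in> ball p e3 \<Longrightarrow> norm (f y) < \<mu>"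
    using \<mu> f(3) unfolding continuous_at_eps_delta by (auto simp: dist_commute)
  show ?thesis
  proof (rule that[of "min e1 (min e2 e3)"])
    fix y assume y: "y \<in> ball p (min e1 (min e2 e3))"
    show "\<exists>t. norm t < d \<and> y + t *s v \<in> U \<and> f (y + t *s v) = 0"
    proof (rule ccontr)
      assume "\<not> ?thesis"
      then have nz: "f (y + t *s v) \<noteq> 0" if "t \<in> cball 0 r" for t
        using that e2(2)[of y t] y r by auto
      have hol: "(\<lambda>t. inverse (f (y + t *s v))) holomorphic_on cball 0 r"
        by (intro holomorphic_intros hs_line[OF f(1)]) (use nz e2 y in auto)
      have "norm (inverse (f (y + 0 *s v))) \<le> inverse \<mu>"
      proof (rule maximum_modulus_frontier[where S="cball 0 r" and f="\<lambda>t. inverse (f (y + t *s v))"])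
        fix t :: complex assume "t \<in> frontier (cball 0 r)"
        then have "t \<in> sphere 0 r" using r by simp
        then have "\<mu> < norm (f (y + t *s v))" using e1(2)[of y t] y by auto
        then show "norm (inverse (f (y + t *s v))) \<le> inverse \<mu>"
          using \<mu> by (simp add: norm_inverse le_imp_inverse_le)
      qed (use hol r in \<open>auto intro: holomorphic_on_subset holomorphic_on_imp_continuous_on\<close>)
      then have "inverse (norm (f y)) \<le> inverse \<mu>" by (simp add: norm_inverse)
      moreover have "norm (f y) > 0" "norm (f y) < \<mu>" using nz[of 0] r e3(2)[of y] y by auto
      ultimately show False using \<mu> by (simp add: inverse_le_iff_le)
    qed
  qed (use e1 e2 e3 in auto)
qed

section \<open>Riemann's extension theorem\<close>
lemma bounded_extend_finite:
  assumes "finite K" "open S" "f holomorphic_on (S - K)" "\<And>z. z \<in> S - K \<Longrightarrow> norm (f z) \<le> C"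
  shows "\<exists>g. g holomorphic_on S \<and> (\<forall>z\<in>S - K. g z = f z)"
  using assms
proof (induction K arbitrary: f C rule: finite_induct)
  case (insert \<xi> K)
  show ?case
  proof (cases "\<xi> \<in> S")
    case False
    then have "S - insert \<xi> K = S - K" by auto
    then show ?thesis using insert.IH[of f C] insert.prems by auto
  next
    case True
    let ?S = "S - K"
    have "open ?S" using insert.prems insert.hyps by (simp add: finite_imp_closed open_Diff)
    have \<xi>: "\<xi> \<in> interior ?S" using True insert.hyps \<open>open ?S\<close> by (simp add: interior_open)
    have eq: "S - insert \<xi> K = ?S - {\<xi>}" by auto
    have "\<forall>\<^sub>F z in at \<xi>. z \<in> ?S - {\<xi>}"
      using \<xi> \<open>open ?S\<close> eventually_at_in_open[of ?S \<xi>] by (simp add: interior_open)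
    then have "\<forall>\<^sub>F z in at \<xi>. norm (f z) \<le> C"
      by eventually_elim (use insert.prems eq in auto)
    then obtain g where g: "g holomorphic_on ?S" "\<forall>z\<in>?S - {\<xi>}. g z = f z"
      using holomorphic_on_extend_bounded[of f ?S \<xi>] \<xi> insert.prems(2) eq by auto
    have "norm (g z) \<le> max C (norm (g \<xi>))" if "z \<in> ?S" for z
      using g(2) insert.prems(3) that eq by (cases "z = \<xi>") (auto simp: le_max_iff_disj)
    then obtain k where "k holomorphic_on S" "\<forall>z\<in>S - K. k z = g z"
      using insert.IH[OF insert.prems(1) g(1)] by blast
    then show ?thesis using g eq by (intro exI[of _ k]) auto
  qed
qed auto

lemma circ_cong: "0 \<le> r \<Longrightarrow> (\<And>t. t \<in> sphere 0 r \<Longrightarrow> f t = g t) \<Longrightarrow> circ r f = circ r g"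
  unfolding circ_def by (intro arg_cong[where f="\<lambda>x. x / _"] contour_integral_cong) auto

lemma circ_Cauchy_ball:
  assumes "f holomorphic_on ball 0 R" "norm w < r" "r < R"
  shows "circ r (\<lambda>t. f t / (t - w)) = f w"
proof (rule circ_Cauchy)
  show "continuous_on (cball 0 r) f"
    by (rule holomorphic_on_imp_continuous_on[OF holomorphic_on_subset[OF assms(1)]]) (use assms in auto)
  show "f holomorphic_on ball 0 r"
    by (rule holomorphic_on_subset[OF assms(1)]) (use assms in auto)
qed (use assms in auto)

text \<open>Choose a line through \<open>p\<close> on which \<open>h\<close> is not identically zero and in it a small circle that
avoids the zeros of \<open>h\<close>. The extension is the Cauchy integral of \<open>f\<close> over the parallel circles. Off
the zeros of \<open>h\<close> it agrees with \<open>f\<close>, by the one-variable theorem on removable singularities.\<close>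
lemma riemann_extension_local:
  fixes h f :: "complex^'n \<Rightarrow> complex"
  assumes h: "hs h U" and dense: "dense_in (\<lambda>z. h z \<noteq> 0) U"
    and f: "hs f {z\<in>U. h z \<noteq> 0}" and C: "\<And>z. z \<in> U \<Longrightarrow> h z \<noteq> 0 \<Longrightarrow> norm (f z) \<le> C"
    and p: "p \<in> U"
  obtains e g where "e > 0" "ball p e \<subseteq> U" "hs g (ball p e)" "\<And>z. z \<in> ball p e \<Longrightarrow> h z \<noteq> 0 \<Longrightarrow> g z = f z"
proof -
  obtain e0 where e0: "e0 > 0" "ball p e0 \<subseteq> U" using p hs_open[OF h] open_contains_ball by blast
  let ?B = "ball p e0"
  have hB: "hs h ?B" using hs_subset[OF h] e0 by auto
  obtain z1 where z1: "z1 \<in> ?B" "h z1 \<noteq> 0"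
    using dense_inD[OF dense, of ?B p] e0 by auto
  define v where "v = z1 - p"
  obtain r where r: "r > 0" "\<And>t. norm t \<le> r \<Longrightarrow> p + t *s v \<in> ?B" "\<And>t. norm t \<le> r \<Longrightarrow> t \<noteq> 0 \<Longrightarrow> h (p + t *s v) \<noteq> 0"
    using line_isolated_zero[OF hB, of p v] e0 z1 by (auto simp: v_def)
  let ?W = "{z\<in>?B. h z \<noteq> 0}"
  have W: "open ?W" by (rule open_nonzero[OF hs_continuous_on[OF hB]]) auto
  have onW: "p + t *s v \<in> ?W" if "t \<in> sphere 0 (r/2)" for t
    using r(2,3)[of t] r(1) that by auto
  obtain e1 where e1: "e1 > 0" "\<And>y t. y \<in> ball p e1 \<Longrightarrow> t \<in> sphere 0 (r/2) \<Longrightarrow> y + t *s v \<in> ?W"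
    using compact_line_nbhd[OF W compact_sphere onW] by blast
  have onc: "p + t *s v \<in> ?B" if "t \<in> cball 0 r" for t
    using r(2)[of t] that by simp
  obtain e2 where e2: "e2 > 0" "\<And>y t. y \<in> ball p e2 \<Longrightarrow> t \<in> cball 0 r \<Longrightarrow> y + t *s v \<in> ?B"
    using compact_line_nbhd[OF open_ball compact_cball onc] by blast
  define e where "e = min e0 (min e1 e2)"
  have e: "e > 0" "ball p e \<subseteq> ?B" "ball p e \<subseteq> ball p e1" "ball p e \<subseteq> ball p e2" using e0 e1 e2 by (auto simp: e_def)
  have fW: "hs f ?W" by (rule hs_subset[OF f W]) (use e0 in blast)
  have inW0: "y + t *s v \<in> ?W" if "y \<in> ball p e" "t \<in> sphere 0 (r/2)" for y t
    using e1(2) e(3) that by blast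
  have nz0: "t \<noteq> 0" if "t \<in> sphere (0::complex) (r/2)" for t using that r by auto
  define g where "g = (\<lambda>z. circ (r/2) (\<lambda>t. f (z + t *s v) / t))"
  have "hs g (ball p e)"
    unfolding g_def
  proof (rule hs_circ)
    show "continuous_on (ball p e \<times> sphere 0 (r/2)) (\<lambda>(z, t). f (z + t *s v) / t)"
      unfolding split_def
      by (intro continuous_intros continuous_on_compose2[OF hs_continuous_on[OF fW]])
         (use inW0 nz0 in \<open>fastforce simp del: mem_ball mem_sphere\<close>)+
    show "hs (\<lambda>z. f (z + t *s v) / t) (ball p e)" if "t \<in> sphere 0 (r/2)" for t
      by (rule hs_divide[OF hs_compose[OF fW hsm_translate]])
         (use inW0 nz0 that in \<open>auto simp del: mem_ball mem_sphere\<close>)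
  qed (use r in auto)
  moreover have "g z = f z" if z: "z \<in> ball p e" "h z \<noteq> 0" for z
  proof -
    let ?O = "{t. z + t *s v \<in> ?B}"
    have O: "open ?O" "connected ?O" "cball 0 r \<subseteq> ?O"
      using e2 z e by (auto intro!: line_vimage_open_convex convex_connected simp del: mem_ball)
    define K where "K = {t \<in> cball 0 r. h (z + t *s v) = 0}"
    have "finite K"
    proof (cases "(\<lambda>t. h (z + t *s v)) constant_on ?O")
      case True
      then have "K = {}" using O(3) z r unfolding constant_on_def K_def
        by (auto simp del: mem_ball) (metis (mono_tags, lifting) add.right_neutral centre_in_cball less_imp_le mem_Collect_eq mem_cball_0 subset_iff vector_smult_lzero)
      then show ?thesis by simp
    next
      case False
      then show ?thesis unfolding K_def
        by (intro holomorphic_compact_finite_zeros[OF hs_line[OF hB]]) (use O in \<open>auto simp del: mem_ball\<close>)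
    qed
    have inW: "z + t *s v \<in> ?W" if "t \<in> ball 0 r - K" for t
    proof -
      have "t \<in> ?O" using that O(3) by (meson DiffD1 ball_subset_cball subsetD)
      then show ?thesis using that by (simp add: K_def)
    qed
    have "\<exists>k. k holomorphic_on ball 0 r \<and> (\<forall>t\<in>ball 0 r - K. k t = f (z + t *s v))"
    proof (rule bounded_extend_finite[where C=C])
      show "(\<lambda>t. f (z + t *s v)) holomorphic_on ball 0 r - K"
        by (rule hs_line[OF fW]) (use inW in blast)
      show "norm (f (z + t *s v)) \<le> C" if "t \<in> ball 0 r - K" for t
        using inW[OF that] C e0 by blast
    qed (use \<open>finite K\<close> in auto)
    then obtain k where k: "k holomorphic_on ball 0 r" "\<And>t. t \<in> ball 0 r - K \<Longrightarrow> k t = f (z + t *s v)"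
      by blast
    have "g z = circ (r/2) (\<lambda>t. k t / (t - 0))"
      unfolding g_def
    proof (rule circ_cong)
      fix t assume t: "t \<in> sphere (0::complex) (r/2)"
      then have "t \<in> ball 0 r" using r by auto
      moreover have "t \<notin> K" using e1(2)[of z t] t z e by (auto simp: K_def)
      ultimately show "f (z + t *s v) / t = k t / (t - 0)" using k(2)[of t] by simp
    qed (use r in auto)
    also have "\<dots> = k 0"
      by (rule circ_Cauchy_ball[OF k(1)]) (use r in auto)
    also have "\<dots> = f z" using k(2)[of 0] z r by (auto simp: K_def)
    finally show ?thesis .
  qed
  ultimately show ?thesis using that[of e g] e e0 by blast
qed

lemma riemann_extension:
  fixes h f :: "complex^'n \<Rightarrow> complex"
  assumes h: "hs h U" and dense: "dense_in (\<lambda>z. h z \<noteq> 0) U"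
    and f: "hs f {z\<in>U. h z \<noteq> 0}" and C: "\<And>z. z \<in> U \<Longrightarrow> h z \<noteq> 0 \<Longrightarrow> norm (f z) \<le> C"
  obtains g where "hs g U" "\<And>z. z \<in> U \<Longrightarrow> h z \<noteq> 0 \<Longrightarrow> g z = f z"
proof -
  have "\<forall>p\<in>U. \<exists>e g. e > 0 \<and> ball p e \<subseteq> U \<and> hs g (ball p e) \<and> (\<forall>z\<in>ball p e. h z \<noteq> 0 \<longrightarrow> g z = f z)"
    using riemann_extension_local[OF h dense f C] by metis
  then obtain e g where eg: "\<And>p. p \<in> U \<Longrightarrow> e p > 0" "\<And>p. p \<in> U \<Longrightarrow> ball p (e p) \<subseteq> U"
    "\<And>p. p \<in> U \<Longrightarrow> hs (g p) (ball p (e p))"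
    "\<And>p z. p \<in> U \<Longrightarrow> z \<in> ball p (e p) \<Longrightarrow> h z \<noteq> 0 \<Longrightarrow> g p z = f z" by metis
  have agree: "g p y = g y y" if "p \<in> U" "y \<in> ball p (e p)" for p y
  proof -
    have y: "y \<in> U" using eg that by blast
    let ?V = "ball p (e p) \<inter> ball y (e y)"
    show ?thesis
    proof (rule continuous_eq_on_dense[where U="?V" and f="g p" and g="g y" and z=y])
      show "dense_in (\<lambda>z. g p z = g y z) ?V"
        by (rule dense_in_mono[OF dense_in_subset[OF dense]]) (use eg y that in auto)
    qed (use eg(1)[OF y] eg(3)[OF y] eg(3)[OF that(1)] that in \<open>auto intro!: continuous_on_subset[OF hs_continuous_on]\<close>)
  qed
  show ?thesis
  proof (rule that[of "\<lambda>y. g y y"])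
    show "hs (\<lambda>y. g y y) U"
    proof (rule hs_local)
      fix p assume p: "p \<in> U"
      have "hs (\<lambda>y. g y y) (ball p (e p))"
        by (rule hs_cong[OF eg(3)[OF p]]) (use agree p in blast)
      then show "\<exists>V. p \<in> V \<and> hs (\<lambda>y. g y y) V" using eg(1)[OF p] by (auto intro!: exI[of _ "ball p (e p)"])
    qed (rule hs_open[OF h])
  qed (use eg in auto)
qed

section \<open>Determinants of variable size\<close>

text \<open>The size of the Hankel determinants below is the degree of a polynomial, so it must be a number
and not a type.\<close>
definition ndet :: "nat \<Rightarrow> (nat \<Rightarrow> nat \<Rightarrow> complex) \<Rightarrow> complex" where
  "ndet n M = Determinant.det (Matrix.mat n n (\<lambda>(i,j). M i j))"

lemma ndet_expand:
  "ndet n M = (\<Sum>p\<in>{p. p permutes {0..<n}}. signof p * (\<Prod>i=0..<n. M i (p i)))"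
  unfolding ndet_def det_def'[OF mat_carrier]
proof (rule sum.cong[OF refl])
  fix p assume "p \<in> {p. p permutes {0..<n}}"
  then have "p i < n" if "i < n" for i
    using permutes_in_image[of p "{0..<n}" i] that by auto
  then show "signof p * (\<Prod>i=0..<n. Matrix.mat n n (\<lambda>(i,j). M i j) $$ (i, p i)) = signof p * (\<Prod>i=0..<n. M i (p i))"
    by simp
qed

lemma mat_mult_index:
  "i < n \<Longrightarrow> Matrix.vec_index (mult_mat_vec (Matrix.mat n n (\<lambda>(i,j). M i j)) (Matrix.vec n c)) i = (\<Sum>j<n. M i j * c j)"
  by (simp add: scalar_prod_def lessThan_atLeast0)

lemma ndet_eq_0_iff:
  "ndet n M = 0 \<longleftrightarrow> (\<exists>c. (\<exists>j<n. c j \<noteq> 0) \<and> (\<forall>i<n. (\<Sum>j<n. M i j * c j) = 0))"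
proof -
  let ?A = "Matrix.mat n n (\<lambda>(i,j). M i j)"
  have "ndet n M = 0 \<longleftrightarrow> (\<exists>v. v \<in> carrier_vec n \<and> v \<noteq> 0\<^sub>v n \<and> mult_mat_vec ?A v = 0\<^sub>v n)"
    unfolding ndet_def by (rule det_0_iff_vec_prod_zero) simp
  also have "\<dots> \<longleftrightarrow> (\<exists>c. (\<exists>j<n. c j \<noteq> 0) \<and> (\<forall>i<n. (\<Sum>j<n. M i j * c j) = 0))"
  proof safe
    fix v :: "complex Matrix.vec" assume v: "v \<in> carrier_vec n" "v \<noteq> 0\<^sub>v n" "mult_mat_vec ?A v = 0\<^sub>v n"
    let ?c = "Matrix.vec_index v"
    have "v = Matrix.vec n ?c" using v by auto
    then have "(\<Sum>j<n. M i j * ?c j) = 0" if "i < n" for i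
      using v(3) mat_mult_index[OF that, of M ?c] that by simp
    moreover have "\<exists>j<n. ?c j \<noteq> 0" using v by auto
    ultimately show "\<exists>c. (\<exists>j<n. c j \<noteq> 0) \<and> (\<forall>i<n. (\<Sum>j<n. M i j * c j) = 0)" by blast
  next
    fix c :: "nat \<Rightarrow> complex" and j assume c: "\<forall>i<n. (\<Sum>j<n. M i j * c j) = 0" "j < n" "c j \<noteq> 0"
    let ?v = "Matrix.vec n c"
    have "mult_mat_vec ?A ?v = 0\<^sub>v n"
      using c(1) mat_mult_index[of _ n M c] by (intro eq_vecI) auto
    moreover have "?v \<noteq> 0\<^sub>v n" using c by (metis index_vec index_zero_vec(1))
    ultimately show "\<exists>v. v \<in> carrier_vec n \<and> v \<noteq> 0\<^sub>v n \<and> mult_mat_vec ?A v = 0\<^sub>v n" by (intro exI[of _ ?v]) auto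
  qed
  finally show ?thesis .
qed

lemma ndet_cramer:
  assumes "\<And>i. i < n \<Longrightarrow> (\<Sum>j<n. M i j * c j) = y i" "k < n"
  shows "c k * ndet n M = ndet n (\<lambda>i j. if j = k then y i else M i j)"
proof -
  let ?A = "Matrix.mat n n (\<lambda>(i,j). M i j)" and ?v = "Matrix.vec n c"
  have "mult_mat_vec ?A ?v = Matrix.vec n y"
    using mat_mult_index[of _ n M c] assms(1) by (intro eq_vecI) auto
  moreover have "replace_col ?A (Matrix.vec n y) k = Matrix.mat n n (\<lambda>(i,j). if j = k then y i else M i j)"
    unfolding replace_col_def by (intro eq_matI) auto
  ultimately show ?thesis
    using cramer_lemma_mat[of ?A n ?v k] assms(2) by (simp add: ndet_def)
qed

lemma hs_ndet:
  assumes "\<And>i j. hs (\<lambda>z. M z i j) U" "open U"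
  shows "hs (\<lambda>z. ndet n (M z)) U"
  unfolding ndet_expand by (intro hs_sum hs_mult hs_prod hs_const assms)

section \<open>The denominator of a meromorphic function in a disc\<close>
lemma poly_ideal_principal:
  fixes P :: "complex poly \<Rightarrow> bool"
  assumes diff: "\<And>x y. P x \<Longrightarrow> P y \<Longrightarrow> P (x - y)" and mult: "\<And>x y. P x \<Longrightarrow> P (x * y)"
    and ex: "P q0" "q0 \<noteq> 0"
  obtains b where "P b" "lead_coeff b = 1" "\<And>q. P q \<Longrightarrow> b dvd q"
proof -
  obtain b0 where b0: "P b0 \<and> b0 \<noteq> 0" "\<And>q. P q \<and> q \<noteq> 0 \<Longrightarrow> degree b0 \<le> degree q"
    using ex_has_least_nat[of "\<lambda>q. P q \<and> q \<noteq> 0" q0 degree] ex by blast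
  define b where "b = Polynomial.smult (inverse (lead_coeff b0)) b0"
  have b: "P b" "lead_coeff b = 1" "degree b = degree b0"
    using b0(1) mult[of b0 "[:inverse (lead_coeff b0):]"] by (auto simp: b_def)
  have "b dvd q" if "P q" for q
  proof (rule ccontr)
    assume "\<not> b dvd q"
    then have nz: "q mod b \<noteq> 0" by (simp add: mod_eq_0_iff_dvd)
    have "q mod b = q - b * (q div b)" by (metis minus_mult_div_eq_mod)
    then have "P (q mod b)" using diff[OF that mult[OF b(1)]] by simp
    moreover have "degree (q mod b) < degree b"
      using degree_mod_less'[of b q] nz b by fastforce
    ultimately show False using b0(2)[of "q mod b"] nz b by simp
  qed
  then show ?thesis using that b by blast
qed

lemma holomorphic_divide_linear:
  assumes "a holomorphic_on S" "open S" "t0 \<in> S" "a t0 = 0"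
  obtains a' where "a' holomorphic_on S" "\<And>t. t \<in> S \<Longrightarrow> a t = (t - t0) * a' t"
proof -
  let ?a = "\<lambda>t. if t = t0 then deriv a t0 else a t / (t - t0)"
  have "?a holomorphic_on S"
    by (rule pole_theorem_open_0[OF assms(1,2), of t0]) (use assms in auto)
  then show ?thesis using that[of ?a] assms by auto
qed

lemma circ_add:
  assumes "continuous_on (sphere 0 r) f" "continuous_on (sphere 0 r) g" "0 \<le> r"
  shows "circ r (\<lambda>t. f t + g t) = circ r f + circ r g"
  using assms
  by (simp add: circ_def contour_integral_add contour_integrable_continuous_circlepath add_divide_distrib)

lemma circ_sum:
  assumes "\<And>i. i \<in> I \<Longrightarrow> continuous_on (sphere 0 r) (f i)" "0 \<le> r"
  shows "circ r (\<lambda>t. \<Sum>i\<in>I. f i t) = (\<Sum>i\<in>I. circ r (f i))"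
  using assms(1)
proof (induction I rule: infinite_finite_induct)
  case (insert i I)
  then show ?case
    by (simp add: circ_add[OF _ continuous_on_sum assms(2)])
qed (simp_all add: circ_def)

lemma circ_cmult:
  assumes "continuous_on (sphere 0 r) f" "0 \<le> r"
  shows "circ r (\<lambda>t. c * f t) = c * circ r f"
  using assms
  by (simp add: circ_def contour_integral_lmul contour_integrable_continuous_circlepath)

lemma circ_eq_0:
  assumes "f holomorphic_on ball 0 R" "0 < r" "r < R"
  shows "circ r f = 0"
proof -
  have "circ r (\<lambda>t. (t * f t) / (t - 0)) = 0 * f 0"
    by (rule circ_Cauchy_ball[where R=R]) (use assms in \<open>auto intro!: holomorphic_intros\<close>)
  moreover have "circ r (\<lambda>t. (t * f t) / (t - 0)) = circ r f"
    by (rule circ_cong) (use assms in auto)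
  ultimately show ?thesis by simp
qed

text \<open>The quotient \<open>F / G\<close> is meromorphic in the disc of radius \<open>R\<close>, with all poles in the disc of radius \<open>r\<close>.
The polynomials \<open>q\<close> for which \<open>q * F / G\<close> has no poles form an ideal; \<open>mden\<close> singles out its monic
generator. Following Kronecker, the generator is recovered from the moments \<open>mom k\<close>, which, unlike the
poles themselves, depend holomorphically on \<open>F\<close> and \<open>G\<close>.\<close>
locale quotient_1d =
  fixes r R :: real and F G :: "complex \<Rightarrow> complex"
  assumes r: "0 < r" "r < R" and F: "F holomorphic_on ball 0 R" and G: "G holomorphic_on ball 0 R"
    and G_nz: "\<And>t. r \<le> norm t \<Longrightarrow> norm t < R \<Longrightarrow> G t \<noteq> 0"
begin

definition den :: "complex poly \<Rightarrow> bool" where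
  "den q \<longleftrightarrow> (\<exists>a. a holomorphic_on ball 0 R \<and> (\<forall>t\<in>ball 0 R. poly q t * F t = a t * G t))"

definition mom :: "nat \<Rightarrow> complex" where "mom k = circ r (\<lambda>t. t ^ k * (F t / G t))"

lemma den_mult: "den x \<Longrightarrow> den (x * y)"
proof -
  assume "den x"
  then obtain a where "a holomorphic_on ball 0 R" "\<forall>t\<in>ball 0 R. poly x t * F t = a t * G t"
    unfolding den_def by blast
  then show ?thesis unfolding den_def
    by (intro exI[of _ "\<lambda>t. a t * poly y t"]) (auto intro!: holomorphic_intros simp: mult_ac)
qed

lemma den_diff: "den x \<Longrightarrow> den y \<Longrightarrow> den (x - y)"
proof -
  assume "den x" "den y"
  then obtain a b where "a holomorphic_on ball 0 R" "\<forall>t\<in>ball 0 R. poly x t * F t = a t * G t"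
     "b holomorphic_on ball 0 R" "\<forall>t\<in>ball 0 R. poly y t * F t = b t * G t"
    unfolding den_def by blast
  then show ?thesis unfolding den_def
    by (intro exI[of _ "\<lambda>t. a t - b t"]) (auto intro!: holomorphic_intros simp: algebra_simps)
qed

lemma cont_quot: "continuous_on (sphere 0 r) (\<lambda>t. F t / G t)"
  by (intro continuous_on_divide continuous_on_subset[OF holomorphic_on_imp_continuous_on[OF F]]
      continuous_on_subset[OF holomorphic_on_imp_continuous_on[OF G]]) (use r G_nz in auto)

lemma circ_poly_mult_quot:
  assumes "degree q \<le> n" "degree p \<le> m"
  shows "circ r (\<lambda>t. poly (q * p) t * (F t / G t)) = (\<Sum>i\<le>m. coeff p i * (\<Sum>j\<le>n. coeff q j * mom (i + j)))"
proof -
  have "circ r (\<lambda>t. poly (q * p) t * (F t / G t)) = circ r (\<lambda>t. \<Sum>i\<le>m. \<Sum>j\<le>n. (coeff p i * coeff q j) * (t ^ (i+j) * (F t / G t)))"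
  proof (rule circ_cong)
    fix t
    have "poly q t = (\<Sum>j\<le>n. coeff q j * t ^ j)" "poly p t = (\<Sum>j\<le>m. coeff p j * t ^ j)"
      unfolding poly_altdef by (rule sum.mono_neutral_left; use assms in \<open>auto simp: coeff_eq_0\<close>)+
    then have "poly (q * p) t * (F t / G t) = (\<Sum>i\<le>m. coeff p i * t ^ i) * (\<Sum>j\<le>n. coeff q j * t ^ j) * (F t / G t)"
      by (simp only: poly_mult mult.commute)
    also have "\<dots> = (\<Sum>i\<le>m. \<Sum>j\<le>n. (coeff p i * t ^ i) * (coeff q j * t ^ j) * (F t / G t))"
      by (subst sum_product) (simp only: sum_distrib_right)
    also have "\<dots> = (\<Sum>i\<le>m. \<Sum>j\<le>n. (coeff p i * coeff q j) * (t ^ (i+j) * (F t / G t)))"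
      by (intro sum.cong refl) (simp add: power_add)
    finally show "poly (q * p) t * (F t / G t) = (\<Sum>i\<le>m. \<Sum>j\<le>n. (coeff p i * coeff q j) * (t ^ (i+j) * (F t / G t)))" .
  qed (use r in auto)
  also have "\<dots> = (\<Sum>i\<le>m. circ r (\<lambda>t. \<Sum>j\<le>n. (coeff p i * coeff q j) * (t ^ (i+j) * (F t / G t))))"
    by (rule circ_sum) (use r in \<open>auto intro!: continuous_intros cont_quot simp del: times_divide_eq_right\<close>)
  also have "\<dots> = (\<Sum>i\<le>m. \<Sum>j\<le>n. circ r (\<lambda>t. (coeff p i * coeff q j) * (t ^ (i+j) * (F t / G t))))"
    by (rule sum.cong[OF refl], rule circ_sum) (use r in \<open>auto intro!: continuous_intros cont_quot simp del: times_divide_eq_right\<close>)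
  also have "\<dots> = (\<Sum>i\<le>m. \<Sum>j\<le>n. (coeff p i * coeff q j) * mom (i+j))"
    unfolding mom_def by (intro sum.cong refl circ_cmult) (use r in \<open>auto intro!: continuous_intros cont_quot simp del: times_divide_eq_right\<close>)
  finally show ?thesis by (simp add: sum_distrib_left mult.assoc)
qed

lemma circ_den:
  assumes "den q" shows "circ r (\<lambda>t. poly q t * (F t / G t)) = 0"
proof -
  obtain a where a: "a holomorphic_on ball 0 R" "\<forall>t\<in>ball 0 R. poly q t * F t = a t * G t"
    using assms unfolding den_def by blast
  have "circ r (\<lambda>t. poly q t * (F t / G t)) = circ r a"
    by (rule circ_cong) (use a r G_nz in \<open>auto simp: field_simps\<close>)
  then show ?thesis using circ_eq_0[OF a(1) r] by simp
qed

definition mden :: "complex poly \<Rightarrow> bool" where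
  "mden b \<longleftrightarrow> den b \<and> lead_coeff b = 1 \<and> (\<forall>q. den q \<longrightarrow> b dvd q)"

lemma ex_mden: "den q \<Longrightarrow> q \<noteq> 0 \<Longrightarrow> \<exists>b. mden b"
proof -
  assume q: "den q" "q \<noteq> 0"
  obtain b where "den b" "lead_coeff b = 1" "\<And>q. den q \<Longrightarrow> b dvd q"
    by (rule poly_ideal_principal[of den q]) (use q den_diff den_mult in auto)
  then show ?thesis unfolding mden_def by blast
qed

text \<open>At a common root \<open>t0\<close> both \<open>b\<close> and \<open>a\<close> could be divided by \<open>t - t0\<close>, which contradicts that \<open>b\<close>
generates the ideal of denominators. The same argument excludes roots of \<open>b\<close> outside the disc, where
\<open>t - t0\<close> is invertible.\<close>
lemma mden_no_common_root:
  assumes b: "mden b" and a: "a holomorphic_on ball 0 R" "\<And>t. t \<in> ball 0 R \<Longrightarrow> poly b t * F t = a t * G t"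
    and t0: "poly b t0 = 0"
  shows "norm t0 < r" "a t0 \<noteq> 0" "G t0 = 0"
proof -
  obtain b' where b': "b = [:-t0,1:] * b'" using t0 by (auto simp: poly_eq_0_iff_dvd)
  have nb: "b \<noteq> 0" using b by (auto simp: mden_def)
  have "\<not> b dvd b'"
  proof
    assume "b dvd b'"
    moreover have "b' \<noteq> 0" using nb b' by auto
    ultimately have "degree b \<le> degree b'" by (simp add: dvd_imp_degree_le)
    then show False using b' \<open>b' \<noteq> 0\<close> by (simp add: degree_mult_eq del: mult_pCons_left)
  qed
  then have nden: "\<not> den b'" using b by (auto simp: mden_def)
  have fac: "(t - t0) * (poly b' t * F t) = a t * G t" if "t \<in> ball 0 R" for t
    using a(2)[OF that] unfolding b' by (simp add: algebra_simps)
  have bad: "a' holomorphic_on ball 0 R \<Longrightarrow> (\<And>t. t \<in> ball 0 R \<Longrightarrow> a t = (t - t0) * a' t) \<Longrightarrow> False" for a'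
  proof -
    assume a': "a' holomorphic_on ball 0 R" "\<And>t. t \<in> ball 0 R \<Longrightarrow> a t = (t - t0) * a' t"
    have "poly b' t * F t = a' t * G t" if "t \<in> ball 0 R" for t
    proof (rule continuous_eq_on_dense[where U="ball 0 R" and f="\<lambda>t. poly b' t * F t" and g="\<lambda>t. a' t * G t"])
      show "dense_in (\<lambda>t. poly b' t * F t = a' t * G t) (ball 0 R)"
        unfolding dense_in_def
      proof (intro allI impI, elim conjE)
        fix V :: "complex set" assume V: "open V" "V \<subseteq> ball 0 R" "V \<noteq> {}"
        then have "\<not> finite V" using finite_imp_not_open by blast
        then obtain t where "t \<in> V" "t \<noteq> t0" by (metis finite.simps insertCI subsetI finite_subset insert_iff)
        then show "\<exists>t\<in>V. poly b' t * F t = a' t * G t"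
          using fac[of t] a'(2)[of t] V by (intro bexI[of _ t]) auto
      qed
    qed (use that a'(1) F G in \<open>auto intro!: holomorphic_on_imp_continuous_on holomorphic_intros\<close>)
    then have "den b'" unfolding den_def using a'(1) by blast
    then show False using nden by blast
  qed
  have t0R: "t0 \<in> ball 0 R"
  proof (rule ccontr)
    assume n: "t0 \<notin> ball 0 R"
    then have ne: "t \<noteq> t0" if "t \<in> ball 0 R" for t using that by blast
    show False
      by (rule bad[of "\<lambda>t. a t / (t - t0)"]) (use ne in \<open>auto intro!: holomorphic_intros a(1)\<close>)
  qed
  show "a t0 \<noteq> 0"
    using holomorphic_divide_linear[OF a(1) open_ball t0R] bad by metis
  then show "G t0 = 0" using a(2)[OF t0R] t0 by auto
  then show "norm t0 < r" using G_nz[of t0] t0R by fastforce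
qed

text \<open>The pairing of \<open>q\<close> and \<open>p\<close> by \<open>\<oint> q * p * F / G\<close> is well defined modulo \<open>b\<close>, and this lemma says that it is
nondegenerate there. Let \<open>b'\<close> generate the polynomials \<open>p\<close> with \<open>b dvd q * p\<close>, and let \<open>t0\<close> be a root of
\<open>b'\<close>. For \<open>p = b' / (t - t0)\<close> the integrand has a single pole, which is simple and lies at \<open>t0\<close>.\<close>
lemma mden_pairing_nondegenerate:
  assumes b: "mden b" and q: "q \<noteq> 0" "degree q < degree b"
  obtains p where "degree p < degree b" "circ r (\<lambda>t. poly (q * p) t * (F t / G t)) \<noteq> 0"
proof -
  obtain a where a: "a holomorphic_on ball 0 R" "\<And>t. t \<in> ball 0 R \<Longrightarrow> poly b t * F t = a t * G t"
    using b unfolding mden_def den_def by blast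
  have nb: "b \<noteq> 0" using b by (auto simp: mden_def)
  obtain b' where b': "b dvd q * b'" "lead_coeff b' = 1" "\<And>p. b dvd q * p \<Longrightarrow> b' dvd p"
    by (rule poly_ideal_principal[of "\<lambda>p. b dvd q * p" b])
       (use nb in \<open>auto simp: right_diff_distrib mult.assoc[symmetric] intro: dvd_diff\<close>)
  have nb': "b' \<noteq> 0" using b' by auto
  have "degree b' \<noteq> 0"
  proof
    assume "degree b' = 0"
    then have "b' = 1" using b'(2) by (metis degree_eq_zeroE lead_coeff_pCons(2) one_pCons pCons_eq_0_iff)
    then have "b dvd q" using b' by simp
    then show False using q by (simp add: dvd_imp_degree_le leD)
  qed
  then obtain t0 where t0: "poly b' t0 = 0"
    using Fundamental_Theorem_Algebra.fundamental_theorem_of_algebra[of b'] by (auto simp: constant_degree)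
  then obtain p where p: "b' = [:-t0,1:] * p" by (auto simp: poly_eq_0_iff_dvd)
  have np: "p \<noteq> 0" using p nb' by auto
  have dp: "degree b' = Suc (degree p)" using p np by (simp add: degree_mult_eq del: mult_pCons_left)
  have "b' dvd b" by (rule b'(3)) simp
  then have db: "degree b' \<le> degree b" "poly b t0 = 0" using nb t0
    by (auto simp: dvd_imp_degree_le elim: dvdE)
  have ndvd: "\<not> b dvd q * p"
  proof
    assume "b dvd q * p"
    then have "degree b' \<le> degree p" using b'(3)[of p] np by (simp add: dvd_imp_degree_le)
    then show False using dp by simp
  qed
  obtain s where s: "q * b' = b * s" using b'(1) by (auto elim: dvdE)
  have s0: "poly s t0 \<noteq> 0"
  proof
    assume "poly s t0 = 0"
    then obtain s' where "s = [:-t0,1:] * s'" by (auto simp: poly_eq_0_iff_dvd)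
    then have "[:-t0,1:] * (q * p) = [:-t0,1:] * (b * s')" using s p by (metis mult.left_commute)
    then have "q * p = b * s'" by (metis mult_left_cancel pCons_eq_0_iff zero_neq_one)
    then show False using ndvd by simp
  qed
  note nc = mden_no_common_root[OF b a db(2)]
  have "circ r (\<lambda>t. poly (q * p) t * (F t / G t)) = circ r (\<lambda>t. (poly s t * a t) / (t - t0))"
  proof (rule circ_cong)
    fix t assume t: "t \<in> sphere (0::complex) r"
    then have tR: "t \<in> ball 0 R" "t \<noteq> t0" "G t \<noteq> 0" using r nc(1) G_nz by auto
    have "(t - t0) * poly (q * p) t * F t = poly (q * b') t * F t" unfolding p by (simp add: algebra_simps)
    also have "\<dots> = poly s t * (poly b t * F t)" unfolding s by simp
    also have "\<dots> = poly s t * (a t * G t)" using a(2)[OF tR(1)] by simp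
    finally show "poly (q * p) t * (F t / G t) = (poly s t * a t) / (t - t0)"
      using tR by (simp add: field_simps)
  qed (use r in auto)
  also have "\<dots> = poly s t0 * a t0"
    by (rule circ_Cauchy_ball[where R=R]) (use r nc a in \<open>auto intro!: holomorphic_intros\<close>)
  finally have "circ r (\<lambda>t. poly (q * p) t * (F t / G t)) \<noteq> 0" using s0 nc by simp
  then show ?thesis using that[of p] dp db by simp
qed

text \<open>A kernel vector of the Hankel matrix would be the coefficient vector of a polynomial that pairs to zero
with all polynomials of degree less than \<open>degree b\<close>.\<close>
lemma hankel_nonzero:
  assumes b: "mden b"
  shows "ndet (degree b) (\<lambda>i j. mom (i + j)) \<noteq> 0"
proof
  assume "ndet (degree b) (\<lambda>i j. mom (i + j)) = 0"
  then obtain c where c: "\<exists>j<degree b. c j \<noteq> 0" "\<forall>i<degree b. (\<Sum>j<degree b. mom (i+j) * c j) = 0"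
    unfolding ndet_eq_0_iff by blast
  define d where "d = degree b - 1"
  have d: "degree b = Suc d" using c(1) by (auto simp: d_def)
  define q where "q = (\<Sum>j\<le>d. monom (c j) j)"
  have cq: "coeff q j = c j" if "j \<le> d" for j
    using that by (simp add: q_def coeff_sum)
  have "degree q \<le> d" unfolding q_def
    by (intro degree_sum_le) (auto intro: order_trans[OF degree_monom_le])
  have "q \<noteq> 0" using c(1) cq d by (metis coeff_0 less_Suc_eq_le)
  moreover have "degree q < degree b" using \<open>degree q \<le> d\<close> d by simp
  ultimately obtain p where p: "degree p < degree b" "circ r (\<lambda>t. poly (q * p) t * (F t / G t)) \<noteq> 0"
    using mden_pairing_nondegenerate[OF b] by blast
  have "circ r (\<lambda>t. poly (q * p) t * (F t / G t)) = (\<Sum>i\<le>d. coeff p i * (\<Sum>j\<le>d. coeff q j * mom (i + j)))"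
    by (rule circ_poly_mult_quot) (use p d \<open>degree q \<le> d\<close> in auto)
  also have "\<dots> = 0"
  proof (intro sum.neutral ballI)
    fix i assume "i \<in> {..d}"
    then have "(\<Sum>j\<le>d. mom (i+j) * c j) = 0" using c(2) d by (simp add: lessThan_Suc_atMost)
    then show "coeff p i * (\<Sum>j\<le>d. coeff q j * mom (i + j)) = 0" using cq by (simp add: mult.commute)
  qed
  finally show False using p by simp
qed

lemma mden_recurrence:
  assumes b: "mden b" and "degree b \<le> n"
  shows "(\<Sum>j\<le>n. mom (i+j) * coeff b j) = 0"
proof -
  have "circ r (\<lambda>t. poly (b * monom 1 i) t * (F t / G t)) = (\<Sum>k\<le>i. coeff (monom 1 i) k * (\<Sum>j\<le>n. coeff b j * mom (k + j)))"
    by (rule circ_poly_mult_quot) (use assms in \<open>auto intro: degree_monom_le\<close>)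
  also have "\<dots> = (\<Sum>k\<le>i. if k = i then (\<Sum>j\<le>n. coeff b j * mom (k + j)) else 0)"
    by (intro sum.cong) auto
  also have "\<dots> = (\<Sum>j\<le>n. coeff b j * mom (i + j))" by simp
  finally have "(\<Sum>j\<le>n. coeff b j * mom (i + j)) = 0"
    using circ_den[OF den_mult, of b "monom 1 i"] b by (simp add: mden_def)
  then show ?thesis by (simp add: mult.commute)
qed

text \<open>The coefficients of \<open>b\<close> itself are a kernel vector. Together with the preceding lemma this shows that
the degree of the denominator is the largest size of a nonvanishing Hankel determinant.\<close>
lemma hankel_zero:
  assumes b: "mden b" and n: "degree b < n"
  shows "ndet n (\<lambda>i j. mom (i + j)) = 0"
  unfolding ndet_eq_0_iff
proof (intro exI[of _ "coeff b"] conjI allI impI)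
  show "\<exists>j<n. coeff b j \<noteq> 0" using n b by (auto simp: mden_def)
  obtain m where "n = Suc m" using n by (cases n) auto
  then show "(\<Sum>j<n. mom (i+j) * coeff b j) = 0" for i
    using mden_recurrence[OF b, of m i] n by (simp add: lessThan_Suc_atMost)
qed

lemma mden_coeff:
  assumes b: "mden b" and k: "k < degree b"
  shows "coeff b k * ndet (degree b) (\<lambda>i j. mom (i + j)) =
    ndet (degree b) (\<lambda>i j. if j = k then - mom (i + degree b) else mom (i + j))"
proof (rule ndet_cramer[OF _ k])
  fix i
  have "(\<Sum>j\<le>degree b. mom (i+j) * coeff b j) = 0" by (rule mden_recurrence[OF b]) simp
  then have "(\<Sum>j<degree b. mom (i+j) * coeff b j) + mom (i + degree b) = 0"
    using b by (simp add: mden_def lessThan_Suc_atMost[symmetric])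
  then show "(\<Sum>j<degree b. mom (i+j) * coeff b j) = - mom (i + degree b)"
    by (simp add: eq_neg_iff_add_eq_0)
qed

end

lemma coeff_bound_of_roots:
  fixes p :: "complex poly"
  assumes "lead_coeff p = 1" "\<And>t. poly p t = 0 \<Longrightarrow> norm t \<le> r" "0 \<le> r"
  shows "norm (coeff p k) \<le> (1 + r) ^ degree p"
  using assms(1,2)
proof (induction "degree p" arbitrary: p k)
  case 0
  then have "p = 1" by (metis degree_eq_zeroE lead_coeff_pCons(2) one_pCons pCons_eq_0_iff)
  then show ?case using assms(3) by simp
next
  case (Suc n)
  then obtain t0 where t0: "poly p t0 = 0"
    using Fundamental_Theorem_Algebra.fundamental_theorem_of_algebra[of p] by (auto simp: constant_degree)
  then obtain q where q: "p = [:-t0,1:] * q" by (auto simp: poly_eq_0_iff_dvd)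
  have nq: "q \<noteq> 0" using q Suc by auto
  have dq: "degree q = n" using q nq Suc(2) by (simp add: degree_mult_eq del: mult_pCons_left)
  have lq: "lead_coeff q = 1" using Suc.prems(1) unfolding q lead_coeff_mult by simp
  have bd: "norm (coeff q k) \<le> (1 + r) ^ n" for k
    using Suc.hyps(1)[OF dq[symmetric] lq, of k] Suc.prems(2) q dq by simp
  have t0r: "norm t0 \<le> r" using Suc.prems t0 by blast
  have "coeff p k = (if k = 0 then 0 else coeff q (k - 1)) - t0 * coeff q k"
    unfolding q by (cases k) (auto simp: coeff_pCons)
  then have "norm (coeff p k) \<le> norm (if k = 0 then 0 else coeff q (k - 1)) + norm (t0 * coeff q k)"
    using norm_triangle_ineq4 by metis
  also have "\<dots> \<le> (1 + r) ^ n + r * (1 + r) ^ n"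
    using bd[of "k-1"] bd[of k] t0r assms(3) by (intro add_mono) (auto simp: norm_mult intro!: mult_mono)
  also have "\<dots> = (1 + r) ^ degree p" using Suc(2)[symmetric] by (simp add: algebra_simps)
  finally show ?case .
qed

text \<open>A bound of Jensen type for the number of zeros that depends only on bounds of \<open>G\<close> on two circles.
Dividing \<open>G\<close> by \<open>t - x\<close> with \<open>norm x < r\<close> divides it by at most \<open>2 * r\<close> on the circle of radius \<open>r\<close> and
by at least \<open>4 * r\<close> on the circle of radius \<open>5 * r\<close>. By the maximum principle, \<open>n\<close> such divisions are
possible only if \<open>2 ^ n \<le> M / \<mu>\<close>.\<close>
lemma zero_divisor_bound:
  assumes r: "0 < r" and G: "G holomorphic_on ball 0 (8*r)"
    and G_nz: "\<And>t. r \<le> norm t \<Longrightarrow> norm t < 8*r \<Longrightarrow> G t \<noteq> 0"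
    and \<mu>: "\<mu> > 0" "\<And>t. t \<in> sphere 0 r \<Longrightarrow> \<mu> \<le> norm (G t)" and M: "\<And>t. t \<in> sphere 0 (5*r) \<Longrightarrow> norm (G t) \<le> M"
    and N: "M / \<mu> < 2 ^ N"
  obtains b u where "b \<noteq> 0" "degree b \<le> N" "u holomorphic_on ball 0 (8*r)"
    "\<And>t. t \<in> ball 0 (8*r) \<Longrightarrow> G t = poly b t * u t" "\<And>t. t \<in> ball 0 (8*r) \<Longrightarrow> u t \<noteq> 0"
proof -
  let ?S = "ball (0::complex) (8*r)"
  define ok where "ok = (\<lambda>xs u. set xs \<subseteq> ball 0 r \<and> u holomorphic_on ?S \<and> (\<forall>t\<in>?S. G t = (\<Prod>x\<leftarrow>xs. t - x) * u t))"
  have up: "norm (\<Prod>x\<leftarrow>xs. t - x) \<le> (2*r) ^ length xs" if "set xs \<subseteq> ball 0 r" "norm t = r" for xs and t :: complex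
    using that(1)
  proof (induction xs)
    case (Cons x xs)
    have "norm (t - x) \<le> 2 * r" using norm_triangle_ineq4[of t x] that(2) Cons.prems by simp
    then show ?case using Cons r by (auto simp: norm_mult intro!: mult_mono)
  qed simp
  have lo: "norm (\<Prod>x\<leftarrow>xs. t - x) \<ge> (4*r) ^ length xs" if "set xs \<subseteq> ball 0 r" "norm t = 5*r" for xs and t :: complex
    using that(1)
  proof (induction xs)
    case (Cons x xs)
    have "norm (t - x) \<ge> 4 * r" using norm_triangle_ineq2[of t x] that(2) Cons.prems by simp
    then show ?case using Cons r by (auto simp: norm_mult intro!: mult_mono)
  qed simp
  have len: "length xs \<le> N" if "ok xs u" for xs u
  proof -
    let ?n = "length xs"
    have xs: "set xs \<subseteq> ball 0 r" and u: "u holomorphic_on ?S" and eq: "\<And>t. t \<in> ?S \<Longrightarrow> G t = (\<Prod>x\<leftarrow>xs. t - x) * u t"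
      using that by (auto simp: ok_def)
    have "norm (u t) \<le> M / (4*r)^?n" if "norm t = r" for t
    proof (rule maximum_modulus_frontier[where S="cball 0 (5*r)" and f=u and \<xi>=t])
      fix s :: complex assume "s \<in> frontier (cball 0 (5*r))"
      then have s: "s \<in> sphere 0 (5*r)" using r by simp
      then have "norm (u s) * (4*r)^?n \<le> norm (u s) * norm (\<Prod>x\<leftarrow>xs. s - x)"
        using lo[OF xs, of s] by (intro mult_left_mono) auto
      also have "\<dots> = norm (G s)" using eq[of s] s r by (simp add: norm_mult mult.commute)
      also have "\<dots> \<le> M" using M s by blast
      finally show "norm (u s) \<le> M / (4*r)^?n" using r by (simp add: field_simps)
    next
      show "u holomorphic_on interior (cball 0 (5*r))" "continuous_on (closure (cball 0 (5*r))) u"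
        using r by (auto intro!: holomorphic_on_imp_continuous_on holomorphic_on_subset[OF u])
    qed (use that r in auto)
    moreover have tr: "norm (complex_of_real r) = r" using r by simp
    ultimately have ur: "norm (u r) \<le> M / (4*r)^?n" by blast
    have "\<mu> \<le> norm (G r)" using \<mu>(2)[of "complex_of_real r"] r by simp
    also have "\<dots> = norm (\<Prod>x\<leftarrow>xs. r - x) * norm (u r)" using eq[of "complex_of_real r"] r by (simp add: norm_mult)
    also have "\<dots> \<le> (2*r)^?n * (M / (4*r)^?n)"
      by (intro mult_mono up[OF xs tr] ur) (use r in auto)
    also have "\<dots> = M / 2^?n"
    proof -
      have "(4*r)^?n = (2*(2*r))^?n" by simp
      also have "\<dots> = 2^?n * (2*r)^?n" by (rule power_mult_distrib)
      finally have "(4*r)^?n = 2^?n * (2*r)^?n" .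
      then show ?thesis using r by simp
    qed
    finally have "\<mu> * 2^?n \<le> M" by (simp add: field_simps)
    then have "2^?n \<le> M / \<mu>" using \<mu> by (simp add: field_simps)
    then have "(2::real)^?n < 2^N" using N by (rule le_less_trans)
    then show ?thesis by simp
  qed
  have "ok [] G" using G by (simp add: ok_def)
  then have "\<exists>xs u. ok xs u" by blast
  then have ex: "\<exists>n. \<exists>xs u. ok xs u \<and> length xs = n" by blast
  obtain n where n: "\<exists>xs u. ok xs u \<and> length xs = n" "\<And>m. (\<exists>xs u. ok xs u \<and> length xs = m) \<Longrightarrow> m \<le> n"
    using ex len Nat.ex_has_greatest_nat[of "\<lambda>n. \<exists>xs u. ok xs u \<and> length xs = n" _ N] by metis
  then obtain xs u where xsu: "ok xs u" "length xs = n" by blast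
  have nz: "u t \<noteq> 0" if t: "t \<in> ?S" for t
  proof
    assume ut: "u t = 0"
    then have "G t = 0" using xsu t by (auto simp: ok_def)
    then have tr: "norm t < r" using G_nz[of t] t by fastforce
    obtain u' where u': "u' holomorphic_on ?S" "\<And>s. s \<in> ?S \<Longrightarrow> u s = (s - t) * u' s"
      using holomorphic_divide_linear[of u ?S t] xsu t ut by (auto simp: ok_def)
    have "ok (t # xs) u'" using xsu u' tr by (auto simp: ok_def)
    then show False using n(2)[of "Suc n"] xsu by force
  qed
  define b where "b = (\<Prod>x\<leftarrow>xs. [:-x,1:])"
  have pb: "poly b t = (\<Prod>x\<leftarrow>xs. t - x)" for t
    unfolding b_def by (induction xs) (auto simp: algebra_simps)
  have "degree b \<le> length xs" unfolding b_def
    by (induction xs) (auto intro!: order_trans[OF degree_mult_le] simp del: mult_pCons_left)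
  moreover have "b \<noteq> 0" unfolding b_def by (auto simp: prod_list_zero_iff)
  ultimately show ?thesis using that[of b u] xsu len[OF xsu(1)] nz by (auto simp: pb ok_def)
qed

section \<open>Reduced fractions\<close>

text \<open>This is the form of codimension at least two that suits functions: \<open>Z\<close> contains no zero set of a
single holomorphic function, singular or not. The choice \<open>\<phi> = 0\<close> shows that \<open>Z\<close> has no interior.\<close>
definition no_hypersurface :: "(complex^'n) set \<Rightarrow> bool" where
  "no_hypersurface Z \<longleftrightarrow> (\<forall>O' \<phi> q. hs \<phi> O' \<and> q \<in> O' \<and> \<phi> q = 0 \<longrightarrow> \<not> {z\<in>O'. \<phi> z = 0} \<subseteq> Z)"

lemma no_hypersurfaceD:
  "no_hypersurface Z \<Longrightarrow> hs \<phi> U \<Longrightarrow> q \<in> U \<Longrightarrow> \<phi> q = 0 \<Longrightarrow> \<exists>z\<in>U. \<phi> z = 0 \<and> z \<notin> Z"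
  unfolding no_hypersurface_def by blast

lemma no_hypersurface_subset: "no_hypersurface Z \<Longrightarrow> Z' \<subseteq> Z \<Longrightarrow> no_hypersurface Z'"
  unfolding no_hypersurface_def by blast

lemma no_hypersurface_dense:
  fixes U :: "(complex^'n) set"
  assumes "no_hypersurface Z" shows "dense_in (\<lambda>z. z \<notin> Z) U"
  unfolding dense_in_def
proof (intro allI impI, elim conjE)
  fix V :: "(complex^'n) set" assume V: "open V" "V \<noteq> {}"
  then show "\<exists>z\<in>V. z \<notin> Z"
    using no_hypersurfaceD[OF assms hs_const[OF V(1)], of _ 0] by blast
qed

text \<open>The normalization \<open>v $ k = 1\<close> makes \<open>z $ k - p $ k\<close> a coordinate along the lines in direction \<open>v\<close>.\<close>
lemma good_direction:
  fixes p :: "complex^'n"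
  assumes g: "hs g V" "p \<in> V" "dense_in (\<lambda>z. g z \<noteq> 0) V"
  obtains k v r where "v $ k = 1" "r > 0" "\<And>t. norm t \<le> r \<Longrightarrow> p + t *s v \<in> V"
    "\<And>t. norm t \<le> r \<Longrightarrow> t \<noteq> 0 \<Longrightarrow> g (p + t *s v) \<noteq> 0"
proof -
  obtain e where e: "e > 0" "ball p e \<subseteq> V" using hs_open[OF g(1)] g(2) open_contains_ball by blast
  have "open (ball p e - {p})" by (simp add: open_Diff)
  moreover have "ball p e - {p} \<noteq> {}"
  proof
    assume "ball p e - {p} = {}"
    then have "finite (ball p e)" by (metis Diff_eq_empty_iff finite.emptyI finite.insertI finite_subset)
    then show False using e finite_imp_not_open[of "ball p e"] by auto
  qed
  moreover have "ball p e - {p} \<subseteq> V" using e by blast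
  ultimately have "\<exists>z\<in>ball p e - {p}. g z \<noteq> 0" using g(3) unfolding dense_in_def by blast
  then obtain z1 where z1: "z1 \<in> ball p e" "z1 \<noteq> p" "g z1 \<noteq> 0" by blast
  define v0 where "v0 = z1 - p"
  have "v0 \<noteq> 0" using z1 by (simp add: v0_def)
  then obtain k where k: "v0 $ k \<noteq> 0" by (auto simp: vec_eq_iff)
  define v where "v = (1 / v0 $ k) *s v0"
  have v: "v $ k = 1" "v0 = (v0 $ k) *s v" using k by (auto simp: v_def vec_eq_iff)
  have *: "p \<in> ball p e" "p + v0 \<in> ball p e" "g (p + v0) \<noteq> 0" using e z1 by (auto simp: v0_def)
  obtain r0 where r0: "r0 > 0" "\<And>t. norm t \<le> r0 \<Longrightarrow> t \<noteq> 0 \<Longrightarrow> g (p + t *s v0) \<noteq> 0"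
    by (rule line_isolated_zero[OF hs_subset[OF g(1) open_ball e(2)] convex_ball *]) (rule that, assumption+)
  have ex: "\<exists>t. norm t < d \<and> g (p + t *s v) \<noteq> 0" if d: "d > 0" for d
  proof -
    define s where "s = min r0 (d / (2 * norm (v0 $ k)))"
    have s: "0 < s" "s \<le> r0" "s * norm (v0 $ k) < d"
    proof -
      show "0 < s" "s \<le> r0" using r0 d k by (auto simp: s_def)
      have "s * norm (v0 $ k) \<le> d / (2 * norm (v0 $ k)) * norm (v0 $ k)"
        by (intro mult_right_mono) (auto simp: s_def)
      also have "\<dots> < d" using k d by simp
      finally show "s * norm (v0 $ k) < d" .
    qed
    have "g (p + of_real s *s v0) \<noteq> 0" using r0(2)[of "of_real s"] s by simp
    moreover have "of_real s *s v0 = (of_real s * v0 $ k) *s v"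
      using v(2) by (metis vector_smult_assoc)
    ultimately show ?thesis using s by (intro exI[of _ "of_real s * v0 $ k"]) (auto simp: norm_mult)
  qed
  show ?thesis
    by (rule line_isolated_zero'[OF g(1,2) ex], assumption) (rule that[OF v(1)], assumption+)
qed

text \<open>Every quotient \<open>f / g\<close> can locally be written in lowest terms. On the line through \<open>z\<close> in a direction
\<open>v\<close> in which \<open>g\<close> has an isolated zero at \<open>p\<close>, let \<open>b z\<close> be the monic polynomial whose roots are
the poles of \<open>f / g\<close> in a fixed disc. For generic \<open>z\<close> its degree has the maximal value \<open>d\<close>, namely where the Hankel determinant \<open>h\<close>
does not vanish, and its coefficients are quotients of holomorphic functions by \<open>h\<close>. They are bounded,
since the roots are, so they extend holomorphically. The denominator at \<open>z\<close> is the value of the polynomial at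
\<open>z\<close> itself. A hypersurface in the common zero set of numerator and denominator either meets all lines
near one of its points, among them generic ones, where the two polynomials have no common root, or it
contains a piece of a line, on which the monic polynomial would vanish.\<close>
lemma reduced_fraction:
  fixes f g :: "complex^'n \<Rightarrow> complex"
  assumes f: "hs f V" and g: "hs g V" "p \<in> V" "dense_in (\<lambda>z. g z \<noteq> 0) V"
  obtains a b U where "p \<in> U" "U \<subseteq> V" "hs a U" "hs b U" "\<And>z. z \<in> U \<Longrightarrow> a z * g z = b z * f z"
    "no_hypersurface {z\<in>U. a z = 0 \<and> b z = 0}"
proof -
  obtain k v r0 where v: "v $ k = 1" and r0: "r0 > 0" "\<And>t. norm t \<le> r0 \<Longrightarrow> p + t *s v \<in> V"
    "\<And>t. norm t \<le> r0 \<Longrightarrow> t \<noteq> 0 \<Longrightarrow> g (p + t *s v) \<noteq> 0"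
    using good_direction[OF g] by metis
  \<comment> \<open>the zero count compares circles of radius \<open>r\<close> and \<open>5 * r\<close> inside a disc of radius \<open>8 * r\<close>\<close>
  define r where "r = r0 / 8"
  have r: "r > 0" "8 * r = r0" using r0 by (auto simp: r_def)
  let ?K = "{t::complex. r \<le> norm t \<and> norm t \<le> r0}"
  have "?K = cball 0 r0 - ball 0 r" by (auto simp: not_less)
  then have K: "compact ?K" by (simp add: compact_diff)
  have Kne: "?K \<noteq> {}" using r by (auto intro!: exI[of _ "of_real r"])
  have contg: "continuous_on V g" by (rule hs_continuous_on[OF g(1)])
  have cK: "continuous_on ?K (\<lambda>t. norm (g (p + t *s v)))"
    by (intro continuous_intros continuous_on_compose2[OF contg]) (use r0 in auto)
  obtain t1 where t1: "t1 \<in> ?K" "\<And>t. t \<in> ?K \<Longrightarrow> norm (g (p + t1 *s v)) \<le> norm (g (p + t *s v))"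
    using continuous_attains_inf[OF K Kne cK] by blast
  obtain t2 where t2: "t2 \<in> ?K" "\<And>t. t \<in> ?K \<Longrightarrow> norm (g (p + t *s v)) \<le> norm (g (p + t2 *s v))"
    using continuous_attains_sup[OF K Kne cK] by blast
  define \<mu> where "\<mu> = norm (g (p + t1 *s v)) / 2"
  define M where "M = norm (g (p + t2 *s v)) + 1"
  have "t1 \<noteq> 0" using t1 r by auto
  then have g1: "norm (g (p + t1 *s v)) > 0" using r0(3)[of t1] t1 by auto
  then have \<mu>: "\<mu> > 0" by (simp add: \<mu>_def)
  let ?W = "{z\<in>V. norm (g z) \<in> {\<mu><..<M}}"
  have W: "open ?W"
  proof -
    have "open (V \<inter> (\<lambda>z. norm (g z)) -` {\<mu><..<M})"
      by (intro continuous_open_preimage continuous_intros contg hs_open[OF g(1)] open_greaterThanLessThan)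
    moreover have "V \<inter> (\<lambda>z. norm (g z)) -` {\<mu><..<M} = ?W" by auto
    ultimately show ?thesis by simp
  qed
  have onW: "p + t *s v \<in> ?W" if "t \<in> ?K" for t
  proof -
    have "\<mu> < norm (g (p + t *s v))" using t1(2)[OF that] g1 unfolding \<mu>_def by linarith
    moreover have "norm (g (p + t *s v)) < M" using t2(2)[OF that] unfolding M_def by linarith
    ultimately show ?thesis using r0(2) that by simp
  qed
  have onV: "p + t *s v \<in> V" if "t \<in> cball 0 r0" for t using r0 that by simp
  obtain e1 where e1: "e1 > 0" "\<And>y t. y \<in> ball p e1 \<Longrightarrow> t \<in> ?K \<Longrightarrow> y + t *s v \<in> ?W"
    using compact_line_nbhd[OF W K onW] by blast
  obtain e2 where e2: "e2 > 0" "\<And>y t. y \<in> ball p e2 \<Longrightarrow> t \<in> cball 0 r0 \<Longrightarrow> y + t *s v \<in> V"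
    using compact_line_nbhd[OF hs_open[OF g(1)] compact_cball onV] by blast
  define e where "e = min e1 e2"
  have e: "e > 0" "ball p e \<subseteq> ball p e1" "ball p e \<subseteq> ball p e2" using e1 e2 by (auto simp: e_def)
  \<comment> \<open>\<open>\<sigma> z\<close> is the base point of the line of \<open>z\<close>, and \<open>l z\<close> the coordinate of \<open>z\<close> on this line\<close>
  define l where "l = (\<lambda>z::complex^'n. z $ k - p $ k)"
  define \<sigma> where "\<sigma> = (\<lambda>z. z - l z *s v)"
  have \<sigma>: "\<sigma> (\<sigma> z) = \<sigma> z" "\<sigma> (z + t *s v) = \<sigma> z" "l (z + t *s v) = l z + t" "\<sigma> z + l z *s v = z" "\<sigma> p = p" "l p = 0" for z t
    using v by (auto simp: \<sigma>_def l_def vec_eq_iff algebra_simps)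
  \<comment> \<open>everything that depends only on the line of \<open>z\<close> is defined on the full cylinder \<open>\<Omega>\<close>\<close>
  define \<Omega> where "\<Omega> = {z. \<sigma> z \<in> ball p e}"
  have hl: "hs l S" if "open S" for S unfolding l_def using that by (intro hs_diff hs_coord hs_const)
  have hsm\<sigma>: "hsm \<sigma> S" if "open S" for S
    unfolding \<sigma>_def holomorphic_several_map_def using that by (auto intro!: hs_diff hs_mult hl)
  have cont\<sigma>: "continuous_on S \<sigma>" for S
    by (rule continuous_on_subset[OF hsm_continuous_on[OF hsm\<sigma>[OF open_UNIV]]]) auto
  have contl: "continuous_on S l" for S
    by (rule continuous_on_subset[OF hs_continuous_on[OF hl[OF open_UNIV]]]) auto
  have \<Omega>o: "open \<Omega>" using open_vimage[OF open_ball cont\<sigma>] unfolding \<Omega>_def vimage_def .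
  have \<Omega>c: "convex \<Omega>"
  proof (rule convexI)
    fix x y and a b :: real assume *: "x \<in> \<Omega>" "y \<in> \<Omega>" "0 \<le> a" "0 \<le> b" "a + b = 1"
    have "p $ k = a *\<^sub>R p $ k + b *\<^sub>R p $ k" using *(5) by (metis scaleR_left.add scaleR_one)
    then have "l (a *\<^sub>R x + b *\<^sub>R y) = a *\<^sub>R l x + b *\<^sub>R l y"
      by (simp add: l_def algebra_simps)
    then have "\<sigma> (a *\<^sub>R x + b *\<^sub>R y) = a *\<^sub>R \<sigma> x + b *\<^sub>R \<sigma> y"
      by (auto simp: \<sigma>_def vec_eq_iff algebra_simps scaleR_conv_of_real[where 'a=complex])
    then show "a *\<^sub>R x + b *\<^sub>R y \<in> \<Omega>"
      using * convexD[OF convex_ball, of "\<sigma> x" p e "\<sigma> y" a b] by (simp add: \<Omega>_def)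
  qed
  have p\<Omega>: "p \<in> \<Omega>" using e \<sigma> by (simp add: \<Omega>_def)
  define F where "F = (\<lambda>z t. f (\<sigma> z + t *s v))"
  define G where "G = (\<lambda>z t. g (\<sigma> z + t *s v))"
  have inV: "\<sigma> z + t *s v \<in> V" if "z \<in> \<Omega>" "norm t \<le> r0" for z t
    using e2(2)[of "\<sigma> z" t] that e by (auto simp: \<Omega>_def)
  have inW: "\<sigma> z + t *s v \<in> ?W" if "z \<in> \<Omega>" "r \<le> norm t" "norm t \<le> r0" for z t
    using e1(2)[of "\<sigma> z" t] that e unfolding \<Omega>_def by blast
  have Gnz: "G z t \<noteq> 0" if "z \<in> \<Omega>" "r \<le> norm t" "norm t \<le> r0" for z t
    using inW[OF that] \<mu> by (auto simp: G_def)
  have q1: "quotient_1d r (8*r) (F z) (G z)" if z: "z \<in> \<Omega>" for z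
  proof
    show "F z holomorphic_on ball 0 (8*r)" unfolding F_def
      by (rule hs_line[OF f]) (use inV[OF z] r in auto)
    show "G z holomorphic_on ball 0 (8*r)" unfolding G_def
      by (rule hs_line[OF g(1)]) (use inV[OF z] r in auto)
  qed (use r Gnz[OF z] in auto)
  define m where "m = (\<lambda>z i. circ r (\<lambda>t. t ^ i * (F z t / G z t)))"
  have m\<sigma>: "m z' i = m z i" if "\<sigma> z' = \<sigma> z" for z z' i
    using that by (simp add: m_def F_def G_def)
  have mom: "quotient_1d.mom r (F z) (G z) = m z" if "z \<in> \<Omega>" for z
    using quotient_1d.mom_def[OF q1[OF that]] by (simp add: m_def fun_eq_iff)
  have hF: "hs (\<lambda>z. F z t) \<Omega>" "hs (\<lambda>z. G z t) \<Omega>" if "norm t \<le> r0" for t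
    unfolding F_def G_def
    by (rule hs_compose[OF f] hs_compose[OF g(1)],
       (insert \<Omega>o inV that, auto simp: holomorphic_several_map_def intro!: hs_add hs_mult hsm\<sigma>[unfolded holomorphic_several_map_def, rule_format] )[1], use inV that in blast)+
  have cF: "continuous_on (\<Omega> \<times> sphere 0 r) (\<lambda>(z,t). F z t)" "continuous_on (\<Omega> \<times> sphere 0 r) (\<lambda>(z,t). G z t)"
    unfolding F_def G_def split_def
    by (intro continuous_on_compose2[OF hs_continuous_on[OF f]] continuous_on_compose2[OF contg]
        continuous_intros continuous_on_compose2[OF cont\<sigma>]; use inV r in force)+
  have hm: "hs (\<lambda>z. m z i) \<Omega>" for i
    unfolding m_def
  proof (rule hs_circ)
    show "continuous_on (\<Omega> \<times> sphere 0 r) (\<lambda>(z, t). t ^ i * (F z t / G z t))"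
      using cF unfolding split_def by (intro continuous_intros) (use Gnz r in auto)
    show "hs (\<lambda>z. t ^ i * (F z t / G z t)) \<Omega>" if "t \<in> sphere 0 r" for t
      using that r Gnz by (intro hs_mult hs_divide hF hs_const \<Omega>o) auto
  qed (use \<Omega>o r in auto)
  obtain N where N: "M / \<mu> < 2 ^ N" using real_arch_pow[of 2 "M / \<mu>"] by auto
  have exb: "\<exists>b. quotient_1d.mden (8*r) (F z) (G z) b \<and> degree b \<le> N" if z: "z \<in> \<Omega>" for z
  proof -
    interpret Q: quotient_1d r "8*r" "F z" "G z" by (rule q1[OF z])
    have lower: "\<mu> \<le> norm (G z t)" if "t \<in> sphere 0 r" for t
      using inW[OF z, of t] that r by (auto simp: G_def)
    have upper: "norm (G z t) \<le> M" if "t \<in> sphere 0 (5*r)" for t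
      using inW[OF z, of t] that r by (auto simp: G_def)
    obtain b u where b: "b \<noteq> 0" "degree b \<le> N" "u holomorphic_on ball 0 (8*r)"
      "\<And>t. t \<in> ball 0 (8*r) \<Longrightarrow> G z t = poly b t * u t" "\<And>t. t \<in> ball 0 (8*r) \<Longrightarrow> u t \<noteq> 0"
      by (rule zero_divisor_bound[OF r(1) Q.G Q.G_nz \<mu> lower upper N]) auto
    have "Q.den b" unfolding Q.den_def
      by (intro exI[of _ "\<lambda>t. F z t / u t"]) (use b in \<open>auto intro!: holomorphic_intros Q.F\<close>)
    then obtain b' where b': "Q.mden b'" using Q.ex_mden b by blast
    then have "b' dvd b" using \<open>Q.den b\<close> by (simp add: Q.mden_def)
    then have "degree b' \<le> N" using b by (meson dvd_imp_degree_le order_trans)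
    then show ?thesis using b' by blast
  qed
  then obtain b where b: "\<And>z. z \<in> \<Omega> \<Longrightarrow> quotient_1d.mden (8*r) (F z) (G z) (b z)" "\<And>z. z \<in> \<Omega> \<Longrightarrow> degree (b z) \<le> N"
    by metis
  obtain d where d: "\<exists>z\<in>\<Omega>. degree (b z) = d" "\<And>z. z \<in> \<Omega> \<Longrightarrow> degree (b z) \<le> d"
    using Nat.ex_has_greatest_nat[of "\<lambda>d. \<exists>z\<in>\<Omega>. degree (b z) = d" "degree (b p)" N] b(2) p\<Omega> by metis
  define h where "h = (\<lambda>z. ndet d (\<lambda>i j. m z (i + j)))"
  define c where "c = (\<lambda>k z. ndet d (\<lambda>i j. if j = k then - m z (i + d) else m z (i + j)) / h z)"
  have h\<sigma>: "h z' = h z" "c k z' = c k z" if "\<sigma> z' = \<sigma> z" for z z' k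
    using m\<sigma>[OF that] by (simp_all add: h_def c_def cong: if_cong)
  have hh: "hs h \<Omega>" unfolding h_def by (rule hs_ndet[OF hm \<Omega>o])
  have dense: "dense_in (\<lambda>z. h z \<noteq> 0) \<Omega>"
  proof -
    obtain z where z: "z \<in> \<Omega>" "degree (b z) = d" using d by blast
    have "h z \<noteq> 0"
      using quotient_1d.hankel_nonzero[OF q1[OF z(1)] b(1)[OF z(1)]] z mom by (simp add: h_def)
    then show ?thesis using hs_dense[OF hh \<Omega>c z(1)] by blast
  qed
  have deg: "degree (b z) = d" if "z \<in> \<Omega>" "h z \<noteq> 0" for z
  proof (rule ccontr)
    assume "degree (b z) \<noteq> d"
    then have "degree (b z) < d" using d(2)[OF that(1)] by simp
    then show False
      using quotient_1d.hankel_zero[OF q1[OF that(1)] b(1)[OF that(1)], of d] that mom by (simp add: h_def)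
  qed
  have ceq: "coeff (b z) k = c k z" if "z \<in> \<Omega>" "h z \<noteq> 0" "k < d" for z k
    using quotient_1d.mden_coeff[OF q1[OF that(1)] b(1)[OF that(1)], of k] that mom deg[OF that(1,2)]
    by (simp add: h_def c_def field_simps cong: if_cong)
  have croot: "norm t < r" if "z \<in> \<Omega>" "poly (b z) t = 0" for z t
  proof -
    interpret Q: quotient_1d r "8*r" "F z" "G z" by (rule q1[OF that(1)])
    show ?thesis using Q.mden_no_common_root(1)[OF b(1)[OF that(1)] _ _ that(2)] b(1)[OF that(1)]
      unfolding Q.mden_def Q.den_def by blast
  qed
  have monic: "lead_coeff (b z) = 1" if "z \<in> \<Omega>" for z
    using quotient_1d.mden_def[OF q1[OF that]] b(1)[OF that] by blast
  have "\<exists>\<beta>. hs \<beta> \<Omega> \<and> (\<forall>z\<in>\<Omega>. h z \<noteq> 0 \<longrightarrow> \<beta> z = c k z)" if "k < d" for k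
  proof -
    have sub: "open {z \<in> \<Omega>. h z \<noteq> 0}" by (rule open_nonzero[OF hs_continuous_on[OF hh] \<Omega>o])
    have "hs (c k) {z \<in> \<Omega>. h z \<noteq> 0}"
      unfolding c_def
    proof (rule hs_divide)
      have "hs (\<lambda>z. if j = k then - m z (i + d) else m z (i + j)) \<Omega>" for i j
        by (cases "j = k") (auto intro: hm)
      then show "hs (\<lambda>z. ndet d (\<lambda>i j. if j = k then - m z (i + d) else m z (i + j))) {z \<in> \<Omega>. h z \<noteq> 0}"
        by (intro hs_subset[OF hs_ndet[OF _ \<Omega>o] sub]) auto
      show "hs h {z \<in> \<Omega>. h z \<noteq> 0}" by (rule hs_subset[OF hh sub]) auto
    qed auto
    note hc = this
    have bnd: "norm (c k z) \<le> (1 + r) ^ d" if z: "z \<in> \<Omega>" "h z \<noteq> 0" for z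
    proof -
      have "norm (coeff (b z) k) \<le> (1 + r) ^ degree (b z)"
        by (rule coeff_bound_of_roots[OF monic[OF z(1)]]) (use croot[OF z(1)] r in \<open>auto intro: less_imp_le\<close>)
      then show ?thesis using ceq[OF z \<open>k < d\<close>] deg[OF z] by simp
    qed
    show ?thesis by (rule riemann_extension[OF hh dense hc bnd]) blast+
  qed
  then obtain \<beta> where \<beta>: "\<And>k. k < d \<Longrightarrow> hs (\<beta> k) \<Omega>" "\<And>k z. k < d \<Longrightarrow> z \<in> \<Omega> \<Longrightarrow> h z \<noteq> 0 \<Longrightarrow> \<beta> k z = c k z" by metis
  have \<sigma>\<Omega>: "\<sigma> z \<in> \<Omega>" if "z \<in> \<Omega>" for z using that by (simp add: \<Omega>_def \<sigma>)
  \<comment> \<open>evaluating the extensions at \<open>\<sigma> z\<close> keeps the polynomial constant along lines\<close>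
  define B where "B = (\<lambda>z t. (\<Sum>k<d. \<beta> k (\<sigma> z) * t ^ k) + t ^ d)"
  have Bpoly: "B z t = poly (b z) t" if z: "z \<in> \<Omega>" "h z \<noteq> 0" for z t
  proof -
    have "poly (b z) t = (\<Sum>k\<le>d. coeff (b z) k * t ^ k)" unfolding poly_altdef deg[OF z] ..
    also have "\<dots> = (\<Sum>k<d. coeff (b z) k * t ^ k) + t ^ d"
      using monic[OF z(1)] deg[OF z] by (simp add: lessThan_Suc_atMost[symmetric])
    also have "(\<Sum>k<d. coeff (b z) k * t ^ k) = (\<Sum>k<d. \<beta> k (\<sigma> z) * t ^ k)"
    proof (rule sum.cong[OF refl])
      fix k assume "k \<in> {..<d}"
      then show "coeff (b z) k * t ^ k = \<beta> k (\<sigma> z) * t ^ k"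
        using \<beta>(2)[of k "\<sigma> z"] ceq[OF z, of k] h\<sigma>[of "\<sigma> z" z] \<sigma>\<Omega>[OF z(1)] z \<sigma>(1) by simp
    qed
    finally show ?thesis by (simp add: B_def)
  qed
  have h\<beta>: "hs (\<lambda>z. \<beta> k (\<sigma> z)) \<Omega>" if "k < d" for k
    by (rule hs_compose[OF \<beta>(1)[OF that] hsm\<sigma>[OF \<Omega>o]]) (use \<sigma>\<Omega> in auto)
  define U where "U = {z\<in>\<Omega>. norm (l z) < r}"
  have Uo: "open U"
  proof -
    have "open (\<Omega> \<inter> l -` ball 0 r)"
      by (intro open_Int \<Omega>o open_vimage open_ball contl)
    moreover have "\<Omega> \<inter> l -` ball 0 r = U" by (auto simp: U_def)
    ultimately show ?thesis by simp
  qed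
  have pU: "p \<in> U" using p\<Omega> r \<sigma> by (simp add: U_def)
  have UV: "U \<subseteq> V"
  proof
    fix z assume "z \<in> U"
    then have "\<sigma> z + l z *s v \<in> V" using r by (intro inV) (auto simp: U_def)
    then show "z \<in> V" by (simp add: \<sigma>)
  qed
  have U\<Omega>: "U \<subseteq> \<Omega>" by (auto simp: U_def)
  define bb where "bb = (\<lambda>z. B z (l z))"
  \<comment> \<open>the numerator, by Cauchy's formula in the disc\<close>
  define aa where "aa = (\<lambda>z. circ r (\<lambda>t. (B z t * F z t / G z t) / (t - l z)))"
  have hbb: "hs bb U"
    unfolding bb_def B_def
    by (intro hs_add hs_sum hs_mult hs_power hl Uo hs_subset[OF h\<beta> Uo U\<Omega>]) auto
  have haa: "hs aa U"
    unfolding aa_def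
  proof (rule hs_circ)
    have lz: "t - l z \<noteq> 0" if "z \<in> U" "t \<in> sphere 0 r" for z t using that by (auto simp: U_def)
    have Usub: "U \<times> sphere 0 r \<subseteq> \<Omega> \<times> sphere 0 r" using U\<Omega> by auto
    have cB: "continuous_on (U \<times> sphere 0 r) (\<lambda>(z,t). B z t)"
    proof -
      have "continuous_on (U \<times> sphere 0 r) (\<lambda>x. \<beta> k (\<sigma> (fst x)))" if "k < d" for k
        by (rule continuous_on_compose2[OF hs_continuous_on[OF h\<beta>[OF that]]]) (use U\<Omega> in \<open>auto intro: continuous_intros\<close>)
      then show ?thesis unfolding B_def split_def by (intro continuous_intros) auto
    qed
    show "continuous_on (U \<times> sphere 0 r) (\<lambda>(z, t). B z t * F z t / G z t / (t - l z))"
      using cB continuous_on_subset[OF cF(1) Usub] continuous_on_subset[OF cF(2) Usub]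
      unfolding split_def
      by (intro continuous_intros continuous_on_compose2[OF contl]) (use Gnz r lz U\<Omega> in auto)
    show "hs (\<lambda>z. B z t * F z t / G z t / (t - l z)) U" if t: "t \<in> sphere 0 r" for t
      unfolding B_def
      by (intro hs_divide hs_mult hs_add hs_sum hs_diff hl hs_const Uo hs_subset[OF h\<beta> Uo U\<Omega>]
          hs_subset[OF hF(1) Uo U\<Omega>] hs_subset[OF hF(2) Uo U\<Omega>]) (use Gnz U\<Omega> r t lz in auto)
  qed (use r Uo in auto)
  have local: "\<exists>a. a holomorphic_on ball 0 (8*r) \<and> (\<forall>t\<in>ball 0 (8*r). poly (b z) t * F z t = a t * G z t) \<and> aa z = a (l z)"
    if z: "z \<in> U" "h z \<noteq> 0" for z
  proof -
    have z\<Omega>: "z \<in> \<Omega>" using z U\<Omega> by blast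
    interpret Q: quotient_1d r "8*r" "F z" "G z" by (rule q1[OF z\<Omega>])
    obtain a where a: "a holomorphic_on ball 0 (8*r)" "\<forall>t\<in>ball 0 (8*r). poly (b z) t * F z t = a t * G z t"
      using b(1)[OF z\<Omega>] unfolding Q.mden_def Q.den_def by blast
    have "aa z = circ r (\<lambda>t. a t / (t - l z))"
      unfolding aa_def
    proof (rule circ_cong)
      fix t assume t: "t \<in> sphere (0::complex) r"
      then have "t \<in> ball 0 (8*r)" "G z t \<noteq> 0" using r Q.G_nz[of t] by auto
      then have "B z t * F z t / G z t = a t" using a(2) Bpoly[OF z\<Omega> z(2)] by simp
      then show "B z t * F z t / G z t / (t - l z) = a t / (t - l z)" by simp
    qed (use r in auto)
    also have "\<dots> = a (l z)" by (rule circ_Cauchy_ball[OF a(1)]) (use z r in \<open>auto simp: U_def\<close>)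
    finally show ?thesis using a by blast
  qed
  have FG: "F z (l z) = f z" "G z (l z) = g z" for z by (simp_all add: F_def G_def \<sigma>)
  have rel: "aa z * g z = bb z * f z" if "z \<in> U" for z
  proof (rule continuous_eq_on_dense[where U=U and f="\<lambda>z. aa z * g z" and g="\<lambda>z. bb z * f z"])
    show "dense_in (\<lambda>z. aa z * g z = bb z * f z) U"
    proof (rule dense_in_mono[OF dense_in_subset[OF dense U\<Omega>]])
      fix z assume z: "z \<in> U" "h z \<noteq> 0"
      obtain a where a: "\<forall>t\<in>ball 0 (8*r). poly (b z) t * F z t = a t * G z t" "aa z = a (l z)"
        using local[OF z] by blast
      have "l z \<in> ball 0 (8*r)" using z r by (auto simp: U_def)
      then have "poly (b z) (l z) * F z (l z) = a (l z) * G z (l z)" using a(1) by blast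
      moreover have "bb z = poly (b z) (l z)" using Bpoly[of z "l z"] z U\<Omega> by (auto simp: bb_def)
      ultimately show "aa z * g z = bb z * f z" using a(2) FG by simp
    qed
  qed (use that Uo hbb haa in \<open>auto intro!: hs_continuous_on hs_mult hs_subset[OF f Uo UV] hs_subset[OF g(1) Uo UV]\<close>)
  have "no_hypersurface {z\<in>U. aa z = 0 \<and> bb z = 0}"
    unfolding no_hypersurface_def
  proof (intro allI impI notI, elim conjE)
    fix O' \<phi> q assume \<phi>: "hs \<phi> O'" "q \<in> O'" "\<phi> q = 0" and sub: "{z\<in>O'. \<phi> z = 0} \<subseteq> {z\<in>U. aa z = 0 \<and> bb z = 0}"
    have q: "q \<in> U" using \<phi> sub by blast
    show False
    proof (cases "\<forall>d>0. \<exists>t. norm t < d \<and> \<phi> (q + t *s v) \<noteq> 0")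
      case True
      then have ex: "\<exists>t. norm t < d \<and> \<phi> (q + t *s v) \<noteq> 0" if "d > 0" for d using that by blast
      obtain e where e: "e > 0" "\<And>y. y \<in> ball q e \<Longrightarrow> \<exists>t. norm t < 1 \<and> y + t *s v \<in> O' \<and> \<phi> (y + t *s v) = 0"
        by (rule hs_zero_persists[OF \<phi> ex, of 1], assumption, simp) (rule that, assumption+)
      have "q \<in> ball q e \<inter> \<Omega>" using e q U\<Omega> by auto
      \<comment> \<open>a generic line near \<open>q\<close>; it still meets the zero set of \<open>\<phi>\<close>\<close>
      then obtain y where y: "y \<in> ball q e \<inter> \<Omega>" "h y \<noteq> 0"
        using dense_inD[OF dense, of "ball q e \<inter> \<Omega>" q] \<Omega>o by blast
      then obtain t where t: "y + t *s v \<in> O'" "\<phi> (y + t *s v) = 0" using e(2) by blast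
      define y' where "y' = y + t *s v"
      have y': "y' \<in> U" "aa y' = 0" "bb y' = 0" using t sub by (auto simp: y'_def)
      have hy': "h y' \<noteq> 0" using h\<sigma>(1)[of y' y] \<sigma>(2) y by (simp add: y'_def)
      have y'\<Omega>: "y' \<in> \<Omega>" using y' U\<Omega> by blast
      interpret Q: quotient_1d r "8*r" "F y'" "G y'" by (rule q1[OF y'\<Omega>])
      obtain a where a: "a holomorphic_on ball 0 (8*r)" "\<forall>t\<in>ball 0 (8*r). poly (b y') t * F y' t = a t * G y' t" "aa y' = a (l y')"
        using local[OF y'(1) hy'] by blast
      have "poly (b y') (l y') = 0" using Bpoly[OF y'\<Omega> hy', of "l y'"] y' by (simp add: bb_def)
      then show False using Q.mden_no_common_root(2)[OF b(1)[OF y'\<Omega>] a(1)] a y' by auto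
    next
      case False
      then obtain d1 where d1: "d1 > 0" "\<And>t. norm t < d1 \<Longrightarrow> \<phi> (q + t *s v) = 0" by blast
      have "open {t. q + t *s v \<in> O'}" "0 \<in> {t. q + t *s v \<in> O'}"
        using \<phi> hs_open by (auto intro!: line_vimage_open_convex(1))
      then obtain d2 where d2: "d2 > 0" "ball 0 d2 \<subseteq> {t. q + t *s v \<in> O'}" using open_contains_ball by blast
      define P where "P = (\<Sum>k<d. monom (\<beta> k (\<sigma> q)) k) + monom 1 d"
      have "coeff P d = 1" by (simp add: P_def coeff_sum)
      then have "P \<noteq> 0" by auto
      have PB: "poly P t = B q t" for t by (simp add: P_def B_def poly_monom poly_sum)
      have "poly P (l q + t) = 0" if "t \<in> ball 0 (min d1 d2)" for t
      proof -
        have "q + t *s v \<in> {z\<in>O'. \<phi> z = 0}" using that d1 d2 by auto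
        then have "bb (q + t *s v) = 0" using sub by blast
        then show ?thesis using \<sigma>(2,3)[of q t] by (simp add: PB bb_def B_def)
      qed
      then have "(\<lambda>t. l q + t) ` ball 0 (min d1 d2) \<subseteq> {t. poly P t = 0}" by blast
      then have "finite ((\<lambda>t. l q + t) ` ball 0 (min d1 d2))"
        using poly_roots_finite[OF \<open>P \<noteq> 0\<close>] finite_subset by blast
      then have "finite (ball (0::complex) (min d1 d2))" by (rule finite_imageD) auto
      then show False using finite_imp_not_open[of "ball (0::complex) (min d1 d2)"] d1 d2 by auto
    qed
  qed
  then show ?thesis using that[OF pU UV haa hbb rel] by blast
qed

lemma no_hypersurface_empty [simp]: "no_hypersurface {}"
  by (auto simp: no_hypersurface_def)

lemma hs_open_nonzero: "hs f U \<Longrightarrow> open {z\<in>U. f z \<noteq> 0}"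
  by (rule open_nonzero[OF hs_continuous_on hs_open])

text \<open>The components are treated one after the other. If \<open>a\<close> is reduced
and proportional to the components treated so far, write \<open>\<eta> k / \<eta> i0 = f / g\<close> and
\<open>a i0 / g = A / B\<close> in lowest terms; then \<open>(B * a i, A * f)\<close> is reduced and proportional to the enlarged vector.\<close>
lemma reduced_tuple:
  fixes \<eta> :: "'i \<Rightarrow> complex^'n \<Rightarrow> complex"
  assumes "finite K" "i0 \<notin> K" and \<eta>: "\<And>i. i \<in> insert i0 K \<Longrightarrow> hs (\<eta> i) V"
    and p: "p \<in> V" and dense: "dense_in (\<lambda>z. \<eta> i0 z \<noteq> 0) V"
  shows "\<exists>U a. p \<in> U \<and> U \<subseteq> V \<and> (\<forall>i\<in>insert i0 K. hs (a i) U) \<and>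
     (\<forall>z\<in>U. \<forall>i\<in>insert i0 K. a i z * \<eta> i0 z = a i0 z * \<eta> i z) \<and>
     no_hypersurface {z\<in>U. \<forall>i\<in>insert i0 K. a i z = 0}"
  using assms(1-3)
proof (induction K rule: finite_induct)
  case empty
  have "open V" using empty(2)[of i0] hs_open by blast
  then show ?case using p by (intro exI[of _ V] exI[of _ "\<lambda>_ _. 1"]) auto
next
  case (insert k K)
  let ?K = "insert i0 K"
  have "i0 \<notin> K" "\<And>i. i \<in> ?K \<Longrightarrow> hs (\<eta> i) V" using insert.prems by auto
  from insert.IH[OF this] obtain U a where U: "p \<in> U" "U \<subseteq> V" "\<And>i. i \<in> ?K \<Longrightarrow> hs (a i) U"
    "\<And>z i. z \<in> U \<Longrightarrow> i \<in> ?K \<Longrightarrow> a i z * \<eta> i0 z = a i0 z * \<eta> i z"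
    "no_hypersurface {z\<in>U. \<forall>i\<in>?K. a i z = 0}"
    by blast
  have k: "k \<noteq> i0" using insert by auto
  have \<eta>0: "hs (\<eta> i0) V" and \<eta>k: "hs (\<eta> k) V" using insert.prems by auto
  obtain f g U1 where U1: "p \<in> U1" "U1 \<subseteq> V" "hs f U1" "hs g U1" "\<And>z. z \<in> U1 \<Longrightarrow> f z * \<eta> i0 z = g z * \<eta> k z"
    "no_hypersurface {z\<in>U1. f z = 0 \<and> g z = 0}"
    by (rule reduced_fraction[OF \<eta>k \<eta>0 p dense]) (rule that, assumption+)
  define U2 where "U2 = U \<inter> U1"
  have U2: "open U2" "p \<in> U2" "U2 \<subseteq> U" "U2 \<subseteq> U1" "U2 \<subseteq> V"
    using U U1 hs_open[OF U1(3)] hs_open[OF U(3)[of i0]] by (auto simp: U2_def)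
  have gdense: "dense_in (\<lambda>z. g z \<noteq> 0) U2"
  proof (rule dense_in_mono)
    show "dense_in (\<lambda>z. \<eta> i0 z \<noteq> 0 \<and> z \<notin> {z\<in>U1. f z = 0 \<and> g z = 0}) U2"
      by (rule dense_in_conj[OF dense_in_subset[OF dense U2(5)] no_hypersurface_dense[OF U1(6)]
         hs_open_nonzero[OF hs_subset[OF \<eta>0 U2(1,5)]]])
    fix z assume z: "z \<in> U2" "\<eta> i0 z \<noteq> 0 \<and> z \<notin> {z\<in>U1. f z = 0 \<and> g z = 0}"
    then show "g z \<noteq> 0" using U1(5)[of z] U2 by auto
  qed
  obtain A B U3 where U3: "p \<in> U3" "U3 \<subseteq> U2" "hs A U3" "hs B U3" "\<And>z. z \<in> U3 \<Longrightarrow> A z * g z = B z * a i0 z"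
    "no_hypersurface {z\<in>U3. A z = 0 \<and> B z = 0}"
    by (rule reduced_fraction[OF hs_subset[OF U(3)[of i0] U2(1,3)] hs_subset[OF U1(4) U2(1,4)] U2(2) gdense]) (simp, rule that, assumption+)
  have U3o: "open U3" using hs_open U3 by blast
  have U3U: "U3 \<subseteq> U" "U3 \<subseteq> U1" "U3 \<subseteq> V" using U3 U2 by auto
  define a' where "a' = (\<lambda>i. if i = k then (\<lambda>z. A z * f z) else (\<lambda>z. B z * a i z))"
  have a'k: "a' k = (\<lambda>z. A z * f z)" and a'i: "\<And>i. i \<in> ?K \<Longrightarrow> a' i = (\<lambda>z. B z * a i z)"
    using k insert.hyps by (auto simp: a'_def)
  have "hs (a' i) U3" if "i \<in> insert k ?K" for i
    using that U3 hs_subset[OF U1(3) U3o U3U(2)] hs_subset[OF U(3) U3o U3U(1)]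
    by (auto simp: a'_def)
  moreover have "a' i z * \<eta> i0 z = a' i0 z * \<eta> i z" if "z \<in> U3" "i \<in> insert k ?K" for z i
  proof (cases "i = k")
    case True
    have "A z * f z * \<eta> i0 z = A z * (g z * \<eta> k z)" using U1(5)[of z] that U3U by auto
    also have "\<dots> = B z * a i0 z * \<eta> k z" using U3(5)[OF that(1)] by (simp add: mult.assoc[symmetric])
    finally show ?thesis using True k by (simp add: a'_def)
  next
    case False
    then show ?thesis using U(4)[of z i] that U3U k a'i[of i] a'i[of i0] by auto
  qed
  moreover have "no_hypersurface {z\<in>U3. \<forall>i\<in>insert k ?K. a' i z = 0}"
    unfolding no_hypersurface_def
  proof (intro allI impI notI, elim conjE)
    fix O' \<phi> q assume \<phi>: "hs \<phi> O'" "q \<in> O'" "\<phi> q = 0" and sub: "{z\<in>O'. \<phi> z = 0} \<subseteq> {z\<in>U3. \<forall>i\<in>insert k ?K. a' i z = 0}"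
    have z: "z \<in> U3" "A z * f z = 0" "\<And>i. i \<in> ?K \<Longrightarrow> B z * a i z = 0" if "z \<in> O'" "\<phi> z = 0" for z
    proof -
      have "z \<in> {z\<in>U3. \<forall>i\<in>insert k ?K. a' i z = 0}" using that sub by blast
      then show "z \<in> U3" "A z * f z = 0" "\<And>i. i \<in> ?K \<Longrightarrow> B z * a i z = 0"
        using a'k a'i by (auto dest: bspec)
    qed
    have B0: "B y = 0" if y: "y \<in> O'" "\<phi> y = 0" for y
    proof (rule ccontr)
      assume "B y \<noteq> 0"
      let ?O = "O' \<inter> {z\<in>U3. B z \<noteq> 0}"
      have "open ?O" "y \<in> ?O" using \<phi> hs_open hs_open_nonzero[OF U3(4)] z(1)[OF y] y \<open>B y \<noteq> 0\<close> by auto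
      then obtain x where "x \<in> ?O" "\<phi> x = 0" "x \<notin> {z\<in>U. \<forall>i\<in>?K. a i z = 0}"
        using no_hypersurfaceD[OF U(5) hs_subset[OF \<phi>(1)], of ?O y] y by auto
      then show False using z(3)[of x] U3U by auto
    qed
    have A0: "A y = 0" if y: "y \<in> O'" "\<phi> y = 0" for y
    proof (rule ccontr)
      assume "A y \<noteq> 0"
      let ?O = "O' \<inter> {z\<in>U3. A z \<noteq> 0}"
      have "open ?O" "y \<in> ?O" using \<phi> hs_open hs_open_nonzero[OF U3(3)] z(1)[OF y] y \<open>A y \<noteq> 0\<close> by auto
      then obtain x where x: "x \<in> ?O" "\<phi> x = 0" "x \<notin> {z\<in>U1. f z = 0 \<and> g z = 0}"
        using no_hypersurfaceD[OF U1(6) hs_subset[OF \<phi>(1)], of ?O y] y by auto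
      moreover have "f x = 0" using z(2)[of x] x by auto
      moreover have "g x = 0" using U3(5)[of x] B0[of x] x by auto
      ultimately show False using U3U by auto
    qed
    obtain x where "x \<in> O'" "\<phi> x = 0" "x \<notin> {z\<in>U3. A z = 0 \<and> B z = 0}"
      using no_hypersurfaceD[OF U3(6) \<phi>] by blast
    then show False using A0 B0 z(1) by blast
  qed
  moreover have "insert i0 (insert k K) = insert k ?K" by auto
  ultimately show ?case using U3 U3U by (intro exI[of _ U3] exI[of _ a']) simp
qed

section \<open>Smooth points of zero sets\<close>

text \<open>The map that replaces the coordinate \<open>z $ k\<close> by \<open>\<psi> z\<close>. Where \<open>\<psi>\<close> has a nonzero derivative in
direction \<open>k\<close> it is a local coordinate system in which the zero set of \<open>\<psi>\<close> is a coordinate hyperplane.\<close>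
definition straighten :: "(complex^'n \<Rightarrow> complex) \<Rightarrow> 'n \<Rightarrow> complex^'n \<Rightarrow> complex^'n" where
  "straighten \<psi> k z = z + (\<psi> z - z $ k) *s axis k 1"

lemma straighten_k [simp]: "straighten \<psi> k z $ k = \<psi> z"
  by (simp add: straighten_def)

lemma hsm_straighten: "hs \<psi> U \<Longrightarrow> hsm (straighten \<psi> k) U"
  unfolding straighten_def holomorphic_several_map_def
  by (auto intro!: hs_add hs_mult hs_diff dest: hs_open)

lemma straighten_inverse:
  fixes \<psi> :: "complex^'n \<Rightarrow> complex"
  assumes \<psi>: "hs \<psi> U" "z0 \<in> U" and nz: "dirderiv (axis k 1) \<psi> z0 \<noteq> 0"
  obtains U' V g where "open U'" "U' \<subseteq> U" "z0 \<in> U'" "open V" "homeomorphism U' V (straighten \<psi> k) g"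
    "hsm g V"
proof -
  let ?T = "straighten \<psi> k"
  define D where "D = (\<lambda>z. \<Sum>i\<in>UNIV. Blinfun (\<lambda>h::complex^'n. h $ i * dirderiv (axis i 1) \<psi> z))"
  have bl: "bounded_linear (\<lambda>h::complex^'n. h $ i * c)" for i c
    by (intro bounded_linear_mult_const bounded_linear_vec_nth)
  have D: "blinfun_apply (D z) h = (\<Sum>i\<in>UNIV. h $ i * dirderiv (axis i 1) \<psi> z)" for z h
    unfolding D_def by (simp add: blinfun.sum_left bounded_linear_Blinfun_apply[OF bl])
  have Dv: "dirderiv v \<psi> z = blinfun_apply (D z) v" if "z \<in> U" for z v
    unfolding D by (rule hs_has_derivative(2)[OF \<psi>(1) that])
  have Dder: "(\<psi> has_derivative blinfun_apply (D z)) (at z)" if "z \<in> U" for z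
  proof -
    have "blinfun_apply (D z) = (\<lambda>h. \<Sum>i\<in>UNIV. h $ i * dirderiv (axis i 1) \<psi> z)" by (rule ext) (rule D)
    then show ?thesis using hs_has_derivative(1)[OF \<psi>(1) that] by (simp only:)
  qed
  have Dlin: "blinfun_apply (D z) (c *s v) = c * blinfun_apply (D z) v" for z c v
    by (simp add: D sum_distrib_left mult_ac)
  have Dcont: "continuous_on U D"
    unfolding D_def by (intro continuous_on_sum cl_blinfun_continuous hs_continuous_on[OF hs_dirderiv[OF \<psi>(1)]])
  define E where "E = Blinfun (\<lambda>c::complex. c *s (axis k 1 :: complex^'n))"
  have E: "blinfun_apply E c = c *s axis k 1" for c
    unfolding E_def by (simp add: bounded_linear_Blinfun_apply vector_scalar_mult_bounded_linear)
  define P where "P = Blinfun (\<lambda>h::complex^'n. h $ k)"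
  have P: "blinfun_apply P h = h $ k" for h
    unfolding P_def by (simp add: bounded_linear_Blinfun_apply bounded_linear_vec_nth)
  define T' where "T' = (\<lambda>z. id_blinfun + (E o\<^sub>L (D z - P)))"
  have T': "blinfun_apply (T' z) h = h + (blinfun_apply (D z) h - h $ k) *s axis k 1" for z h
    by (simp add: T'_def blinfun.add_left blinfun.diff_left E P)
  have T'lin: "blinfun_apply (T' z) (c *s v) = c *s blinfun_apply (T' z) v" for z c v
    by (simp add: T' Dlin vec_eq_iff algebra_simps)
  have T'cont: "continuous_on U T'"
    unfolding T'_def by (intro continuous_intros Dcont)
  have Tder: "(?T has_derivative blinfun_apply (T' z)) (at z)" if "z \<in> U" for z
  proof -
    have "((\<lambda>z. \<psi> z - z $ k) has_derivative (\<lambda>h. blinfun_apply (D z) h - h $ k)) (at z)"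
      by (intro has_derivative_diff Dder[OF that] bounded_linear_imp_has_derivative bounded_linear_vec_nth)
    from has_derivative_add[OF has_derivative_ident bounded_linear.has_derivative[OF blinfun.bounded_linear_right[of E] this]]
    have "(?T has_derivative (\<lambda>h. h + blinfun_apply E (blinfun_apply (D z) h - h $ k))) (at z)"
      unfolding straighten_def E .
    moreover have "blinfun_apply (T' z) = (\<lambda>h. h + blinfun_apply E (blinfun_apply (D z) h - h $ k))"
      by (rule ext) (simp only: T' E)
    ultimately show ?thesis by (simp only:)
  qed
  define d where "d = dirderiv (axis k 1) \<psi> z0"
  have bl0: "bounded_linear (\<lambda>h. (h $ k - blinfun_apply (D z0) h) / d)"
    by (rule bounded_linear_compose[OF bounded_linear_divide bounded_linear_sub[OF bounded_linear_vec_nth blinfun.bounded_linear_right]])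
  define invf where "invf = Blinfun (\<lambda>h. h + ((h $ k - blinfun_apply (D z0) h) / d) *s axis k 1)"
  have invf: "blinfun_apply invf h = h + ((h $ k - blinfun_apply (D z0) h) / d) *s axis k 1" for h
    unfolding invf_def by (subst bounded_linear_Blinfun_apply) (intro bounded_linear_add bounded_linear_ident bounded_linear_compose[OF vector_scalar_mult_bounded_linear] bl0, rule refl)
  have Dk: "blinfun_apply (D z0) (axis k 1) = d" using Dv[OF \<psi>(2)] by (simp add: d_def)
  have inveq: "invf o\<^sub>L T' z0 = id_blinfun"
  proof (rule blinfun_eqI)
    fix h
    let ?h = "blinfun_apply (T' z0) h"
    have "blinfun_apply (D z0) ?h = blinfun_apply (D z0) h + (blinfun_apply (D z0) h - h $ k) * d"
      by (simp only: T' blinfun.add_right Dlin Dk)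
    moreover have "?h $ k = blinfun_apply (D z0) h" by (simp add: T')
    ultimately have "(?h $ k - blinfun_apply (D z0) ?h) / d = h $ k - blinfun_apply (D z0) h"
      using nz by (simp add: d_def field_simps)
    then show "blinfun_apply (invf o\<^sub>L T' z0) h = blinfun_apply id_blinfun h"
      by (simp only: blinfun_apply_blinfun_compose invf[of ?h]) (simp add: T' vec_eq_iff algebra_simps)
  qed
  obtain U' V g g' where g: "open U'" "U' \<subseteq> U" "z0 \<in> U'" "open V" "?T z0 \<in> V" "homeomorphism U' V ?T g"
    "\<And>y. y \<in> V \<Longrightarrow> (g has_derivative (g' y)) (at y)"
    "\<And>y. y \<in> V \<Longrightarrow> g' y = inv_into UNIV (blinfun_apply (T' (g y)))"
    "\<And>y. y \<in> V \<Longrightarrow> bij (blinfun_apply (T' (g y)))"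
    by (rule inverse_function_theorem[OF hs_open[OF \<psi>(1)] Tder T'cont \<psi>(2) inveq], assumption) (rule that, assumption+)
  have "hsm g V"
    unfolding holomorphic_several_map_def holomorphic_several_def
  proof (intro allI conjI ballI)
    fix i y assume y: "y \<in> V"
    have lin: "g' y (c *s v) = c *s g' y v" for c v
    proof -
      have "blinfun_apply (T' (g y)) (c *s g' y v) = c *s blinfun_apply (T' (g y)) (g' y v)" by (rule T'lin)
      also have "\<dots> = c *s v" using g(8,9)[OF y] by (simp add: bij_is_surj surj_f_inv_f)
      finally show ?thesis using g(8,9)[OF y] by (metis bij_is_inj inv_f_f)
    qed
    have "((\<lambda>y. g y $ i) has_derivative (\<lambda>v. g' y v $ i)) (at y)"
      by (rule bounded_linear.has_derivative[OF bounded_linear_vec_nth g(7)[OF y]])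
    then show "\<exists>L. ((\<lambda>z. g z $ i) has_derivative L) (at y) \<and> (\<forall>c v. L (c *s v) = c * L v)"
      using lin by (intro exI[of _ "\<lambda>v. g' y v $ i"]) simp
  qed (rule g(4))
  then show ?thesis using that g by blast
qed

lemma higher_dirderiv:
  assumes "hs \<phi> U" "z + t *s v \<in> U"
  shows "(deriv ^^ n) (\<lambda>t. \<phi> (z + t *s v)) t = (dirderiv v ^^ n) \<phi> (z + t *s v)"
  using assms(2)
proof (induction n arbitrary: t)
  case (Suc n)
  have h: "hs ((dirderiv v ^^ n) \<phi>) U" by (induction n) (auto intro: assms(1) hs_dirderiv)
  have "\<forall>\<^sub>F s in nhds t. s \<in> {s. z + s *s v \<in> U}"
    by (rule eventually_nhds_in_open) (use Suc.prems hs_open[OF assms(1)] line_vimage_open_convex(1) in auto)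
  then have "\<forall>\<^sub>F s in nhds t. (deriv ^^ n) (\<lambda>t. \<phi> (z + t *s v)) s = (dirderiv v ^^ n) \<phi> (z + s *s v)"
    by eventually_elim (use Suc.IH in auto)
  then have "deriv ((deriv ^^ n) (\<lambda>t. \<phi> (z + t *s v))) t = deriv (\<lambda>s. (dirderiv v ^^ n) \<phi> (z + s *s v)) t"
    by (rule deriv_cong_ev) simp
  also have "\<dots> = dirderiv v ((dirderiv v ^^ n) \<phi>) (z + t *s v)"
  proof -
    let ?f = "(dirderiv v ^^ n) \<phi>"
    obtain L where L: "((\<lambda>s. ?f (z + s *s v)) has_field_derivative L v) (at t)" "(?f has_derivative L) (at (z + t *s v))"
      by (rule hs_line_deriv[OF h Suc.prems]) (rule that, assumption+)
    have "(z + t *s v) + 0 *s v \<in> U" using Suc.prems by simp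
    then obtain L' where
      L': "((\<lambda>s. ?f ((z + t *s v) + s *s v)) has_field_derivative L' v) (at 0)" "(?f has_derivative L') (at ((z + t *s v) + 0 *s v))"
      by (rule hs_line_deriv[OF h]) (rule that, assumption+)
    then have "(?f has_derivative L') (at (z + t *s v))" by simp
    then have "L = L'" using L has_derivative_unique by blast
    then show ?thesis using L L' by (simp add: dirderiv_def DERIV_imp_deriv)
  qed
  finally show ?case by simp
qed simp

text \<open>Among all zeros of \<open>\<phi>\<close> let \<open>z0\<close> be one of minimal multiplicity \<open>m\<close> in direction \<open>v\<close>, and let \<open>\<psi>\<close> be the
derivative of \<open>\<phi>\<close> of order \<open>m - 1\<close> in direction \<open>v\<close>. By minimality \<open>\<psi>\<close> vanishes at all zeros of \<open>\<phi>\<close>, and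
its derivative at \<open>z0\<close> is not zero. Near \<open>z0\<close>, each line in direction \<open>v\<close> contains a zero of \<open>\<phi>\<close> by
persistence of zeros, and at most one zero of \<open>\<psi>\<close>; so the two zero sets agree.\<close>
lemma smooth_zero:
  fixes \<phi> :: "complex^'n \<Rightarrow> complex"
  assumes \<phi>: "hs \<phi> U" "q \<in> U" "\<phi> q = 0" and nz: "dense_in (\<lambda>z. \<phi> z \<noteq> 0) U"
  obtains \<psi> k W z0 where "hs \<psi> W" "z0 \<in> W" "W \<subseteq> U" "\<psi> z0 = 0" "dirderiv (axis k 1) \<psi> z0 \<noteq> 0"
    "\<And>z. z \<in> W \<Longrightarrow> \<psi> z = 0 \<Longrightarrow> \<phi> z = 0"
proof -
  have Uo: "open U" using \<phi> hs_open by blast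
  obtain k0 v r where "v $ k0 = 1" and r: "r > 0" "\<And>t. norm t \<le> r \<Longrightarrow> q + t *s v \<in> U"
    "\<And>t. norm t \<le> r \<Longrightarrow> t \<noteq> 0 \<Longrightarrow> \<phi> (q + t *s v) \<noteq> 0"
    by (rule good_direction[OF \<phi>(1,2) nz]) (rule that, assumption+)
  define \<Phi> where "\<Phi> = (\<lambda>n. (dirderiv v ^^ n) \<phi>)"
  have h\<Phi>: "hs (\<Phi> n) U" for n unfolding \<Phi>_def by (induction n) (auto intro: \<phi>(1) hs_dirderiv)
  have "\<exists>n. \<Phi> n q \<noteq> 0"
  proof (rule ccontr)
    assume "\<not> ?thesis"
    then have "(deriv ^^ n) (\<lambda>t. \<phi> (q + t *s v)) 0 = 0" for n
      using higher_dirderiv[OF \<phi>(1), of q 0 v n] \<phi>(2) by (simp add: \<Phi>_def)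
    moreover have "(\<lambda>t. \<phi> (q + t *s v)) holomorphic_on ball 0 r"
      by (rule hs_line[OF \<phi>(1)]) (use r in auto)
    moreover have "of_real (r/2) \<in> ball (0::complex) r" using r by simp
    ultimately have "\<phi> (q + of_real (r/2) *s v) = 0"
      using holomorphic_fun_eq_0_on_connected[of "\<lambda>t. \<phi> (q + t *s v)" "ball 0 r" 0 "of_real (r/2)"] r by auto
    then show False using r(3)[of "of_real (r/2)"] r(1) by simp
  qed
  then have ex: "\<exists>m. \<exists>z\<in>U. \<phi> z = 0 \<and> \<Phi> m z \<noteq> 0" using \<phi> by blast
  define m where "m = (LEAST m. \<exists>z\<in>U. \<phi> z = 0 \<and> \<Phi> m z \<noteq> 0)"
  obtain z0 where z0: "z0 \<in> U" "\<phi> z0 = 0" "\<Phi> m z0 \<noteq> 0" using LeastI_ex[OF ex] unfolding m_def by blast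
  have "m \<noteq> 0" using z0 by (auto simp: \<Phi>_def intro: ccontr)
  then obtain m' where m': "m = Suc m'" by (cases m) auto
  define \<psi> where "\<psi> = \<Phi> m'"
  have zz: "\<psi> z = 0" if "z \<in> U" "\<phi> z = 0" for z
    using not_less_Least[of m' "\<lambda>m. \<exists>z\<in>U. \<phi> z = 0 \<and> \<Phi> m z \<noteq> 0"] that m' unfolding m_def[symmetric] \<psi>_def by auto
  have h\<psi>: "hs \<psi> U" unfolding \<psi>_def by (rule h\<Phi>)
  define c where "c = dirderiv v \<psi> z0"
  have c: "c \<noteq> 0" using z0(3) by (simp add: c_def \<psi>_def m' \<Phi>_def)
  have "\<exists>k. dirderiv (axis k 1) \<psi> z0 \<noteq> 0"
  proof (rule ccontr)
    assume "\<not> ?thesis"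
    then have "c = 0" unfolding c_def hs_has_derivative(2)[OF h\<psi> z0(1), of v] by simp
    then show False using c by simp
  qed
  then obtain k where k: "dirderiv (axis k 1) \<psi> z0 \<noteq> 0" by blast
  have cont: "isCont (dirderiv v \<psi>) z0" by (rule hs_isCont[OF hs_dirderiv[OF h\<psi>] z0(1)])
  have "norm c / 2 > 0" using c by simp
  then obtain \<rho>1 where \<rho>1: "\<rho>1 > 0" "\<And>y. dist y z0 < \<rho>1 \<Longrightarrow> dist (dirderiv v \<psi> y) c < norm c / 2"
    using cont unfolding continuous_at_eps_delta c_def by blast
  obtain \<rho>2 where \<rho>2: "\<rho>2 > 0" "ball z0 \<rho>2 \<subseteq> U" using Uo z0 open_contains_ball by blast
  \<comment> \<open>on this ball the derivative of \<open>\<psi>\<close> along \<open>v\<close> stays so close to \<open>c\<close> that \<open>\<psi>\<close> is injective on lines\<close>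
  define \<rho> where "\<rho> = min \<rho>1 \<rho>2"
  have \<rho>: "\<rho> > 0" "ball z0 \<rho> \<subseteq> U" "\<And>y. y \<in> ball z0 \<rho> \<Longrightarrow> norm (dirderiv v \<psi> y - c) \<le> norm c / 2"
    using \<rho>1 \<rho>2 by (auto simp: \<rho>_def dist_norm norm_minus_commute intro: less_imp_le)
  have uniq: "t = 0" if y: "y \<in> ball z0 \<rho>" "y + t *s v \<in> ball z0 \<rho>" "\<psi> y = 0" "\<psi> (y + t *s v) = 0" for y t
  proof -
    let ?S = "{s. y + s *s v \<in> ball z0 \<rho>}"
    have "norm ((\<psi> (y + t *s v) - c * t) - (\<psi> (y + 0 *s v) - c * 0)) \<le> norm c / 2 * norm (t - 0)"
    proof (rule field_differentiable_bound[where S = ?S and f="\<lambda>s. \<psi> (y + s *s v) - c * s" and f'="\<lambda>s. dirderiv v \<psi> (y + s *s v) - c"])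
      show "convex ?S" by (rule line_vimage_open_convex(2)) simp
      fix s assume s: "s \<in> ?S"
      then have sU: "y + s *s v \<in> U" using \<rho> by auto
      have "(\<lambda>s. \<psi> (y + s *s v)) field_differentiable at s"
        using hs_line_deriv[OF h\<psi> sU] by (metis field_differentiable_def)
      then have "((\<lambda>s. \<psi> (y + s *s v)) has_field_derivative deriv (\<lambda>s. \<psi> (y + s *s v)) s) (at s)"
        by (simp add: field_differentiable_derivI)
      also have "deriv (\<lambda>s. \<psi> (y + s *s v)) s = dirderiv v \<psi> (y + s *s v)"
        using higher_dirderiv[OF h\<psi> sU, of 1] by simp
      finally have "((\<lambda>s. \<psi> (y + s *s v)) has_field_derivative dirderiv v \<psi> (y + s *s v)) (at s)" .
      from has_field_derivative_at_within[OF DERIV_diff[OF this DERIV_cmult_Id[of c]]]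
      show "((\<lambda>s. \<psi> (y + s *s v) - c * s) has_field_derivative dirderiv v \<psi> (y + s *s v) - c) (at s within ?S)" .
      show "norm (dirderiv v \<psi> (y + s *s v) - c) \<le> norm c / 2" using s by (intro \<rho>(3)) simp
    qed (use y in auto)
    then have "norm c * norm t \<le> norm c * norm t / 2" using y by (simp add: norm_mult)
    then show "t = 0" using c by simp
  qed
  have ex2: "\<exists>t. norm t < d \<and> \<phi> (z0 + t *s v) \<noteq> 0" if "d > 0" for d
  proof (rule ccontr)
    assume *: "\<not> ?thesis"
    define s where "s = min (d/2) (\<rho> / (2 * (1 + norm v)))"
    have s: "s > 0" "s < d" using that \<rho> by (auto simp: s_def intro!: divide_pos_pos add_pos_nonneg)
    have "s * norm v \<le> \<rho> / (2 * (1 + norm v)) * norm v" by (intro mult_right_mono) (auto simp: s_def)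
    also have "\<dots> < \<rho>"
    proof -
      have "norm v < 2 * (1 + norm v)" by (smt (verit) norm_ge_zero)
      then have "norm v / (2 * (1 + norm v)) < 1" by (smt (verit) divide_less_eq_1_pos norm_ge_zero)
      then have "\<rho> * (norm v / (2 * (1 + norm v))) < \<rho> * 1" using \<rho>(1) by (rule mult_strict_left_mono)
      then show ?thesis by simp
    qed
    finally have "z0 + of_real s *s v \<in> ball z0 \<rho>" using s by (simp add: dist_norm norm_smult)
    moreover have "\<phi> (z0 + of_real s *s v) = 0" using * s by auto
    ultimately have "of_real s = (0::complex)"
      using uniq[of z0 "of_real s"] zz z0 \<rho> by auto
    then show False using s by simp
  qed
  define d where "d = \<rho> / (2 * (1 + norm v))"
  have d: "d > 0" using \<rho> by (auto simp: d_def intro!: divide_pos_pos add_pos_nonneg)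
  have dv: "d * norm v < \<rho> / 2"
  proof -
    have "norm v < 1 + norm v" by simp
    then have "norm v / (1 + norm v) < 1" by (smt (verit) divide_less_eq_1_pos norm_ge_zero)
    then have "\<rho> / 2 * (norm v / (1 + norm v)) < \<rho> / 2 * 1" using \<rho>(1) by (intro mult_strict_left_mono) auto
    then show ?thesis by (simp add: d_def)
  qed
  obtain e where e: "e > 0" "\<And>y. y \<in> ball z0 e \<Longrightarrow> \<exists>t. norm t < d \<and> y + t *s v \<in> U \<and> \<phi> (y + t *s v) = 0"
    by (rule hs_zero_persists[OF \<phi>(1) z0(1,2) ex2, of d], assumption, rule d) (rule that, assumption+)
  let ?W = "ball z0 (min e (\<rho>/2))"
  have WU: "?W \<subseteq> U" using \<rho> by auto
  show ?thesis
  proof (rule that[of \<psi> ?W z0 k])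
    show "hs \<psi> ?W" by (rule hs_subset[OF h\<psi> open_ball WU])
    show "z0 \<in> ?W" using e \<rho> by simp
    show "\<psi> z0 = 0" using zz z0 by blast
    fix y assume y: "y \<in> ?W" "\<psi> y = 0"
    then obtain t where t: "norm t < d" "y + t *s v \<in> U" "\<phi> (y + t *s v) = 0" using e(2)[of y] by auto
    have "norm (t *s v) \<le> d * norm v" using t by (simp add: norm_smult mult_right_mono)
    then have "norm (t *s v) < \<rho> / 2" using dv by linarith
    then have "y + t *s v \<in> ball z0 \<rho>"
      using y norm_triangle_ineq4[of "z0 - y" "t *s v"] by (simp add: dist_norm algebra_simps)
    then have "t = 0" using uniq[of y t] y t zz \<rho> by auto
    then show "\<phi> y = 0" using t by simp
  qed (use k WU in auto)
qed

section \<open>Charts\<close>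

lemma is_chart_simps:
  assumes "is_chart c"
  shows "open (fst c)" "open (snd c ` fst c)" "continuous_on (fst c) (snd c)"
    "continuous_on (snd c ` fst c) (chart_inv c)"
    "\<And>p. p \<in> fst c \<Longrightarrow> chart_inv c (snd c p) = p"
    "\<And>z. z \<in> snd c ` fst c \<Longrightarrow> snd c (chart_inv c z) = z"
    "\<And>z. z \<in> snd c ` fst c \<Longrightarrow> chart_inv c z \<in> fst c"
proof -
  have h: "homeomorphism (fst c) (snd c ` fst c) (snd c) (chart_inv c)" and o: "open (fst c)" "open (snd c ` fst c)"
    using assms by (simp_all add: is_chart_def)
  show "open (fst c)" "open (snd c ` fst c)" by (fact o)+
  show "continuous_on (fst c) (snd c)" "continuous_on (snd c ` fst c) (chart_inv c)"
    by (rule homeomorphism_cont1[OF h], rule homeomorphism_cont2[OF h])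
  show l: "chart_inv c (snd c p) = p" if "p \<in> fst c" for p by (rule homeomorphism_apply1[OF h that])
  show "snd c (chart_inv c z) = z" if "z \<in> snd c ` fst c" for z by (rule homeomorphism_apply2[OF h that])
  show "chart_inv c z \<in> fst c" if "z \<in> snd c ` fst c" for z using that by (auto simp: l)
qed

lemma chart_image_Int:
  assumes "is_chart c" shows "snd c ` (fst c \<inter> W) = {z \<in> snd c ` fst c. chart_inv c z \<in> W}"
  by (auto simp: is_chart_simps(5)[OF assms])

lemma open_chart_image:
  assumes c: "is_chart c" and "open W" shows "open (snd c ` (fst c \<inter> W))"
proof -
  have "open (snd c ` fst c \<inter> chart_inv c -` W)"
    by (rule continuous_open_preimage[OF is_chart_simps(4,2)[OF c] assms(2)])
  moreover have "snd c ` fst c \<inter> chart_inv c -` W = snd c ` (fst c \<inter> W)"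
    unfolding chart_image_Int[OF c] by auto
  ultimately show ?thesis by simp
qed

lemma open_chart_inv_image:
  assumes c: "is_chart c" and "open V" "V \<subseteq> snd c ` fst c" shows "open (chart_inv c ` V)"
proof -
  have "open (fst c \<inter> snd c -` V)"
    by (rule continuous_open_preimage[OF is_chart_simps(3,1)[OF c] assms(2)])
  moreover have "fst c \<inter> snd c -` V = chart_inv c ` V"
  proof (intro equalityI subsetI)
    fix p assume "p \<in> fst c \<inter> snd c -` V"
    then show "p \<in> chart_inv c ` V" using is_chart_simps(5)[OF c, of p] by (metis IntD1 IntD2 imageI vimageD)
  next
    fix p assume "p \<in> chart_inv c ` V"
    then obtain z where "z \<in> V" "p = chart_inv c z" by blast
    then show "p \<in> fst c \<inter> snd c -` V" using is_chart_simps(6,7)[OF c, of z] assms(3) by auto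
  qed
  ultimately show ?thesis by simp
qed

lemma atlas_chart: "complex_atlas A \<Longrightarrow> c \<in> A \<Longrightarrow> is_chart c"
  by (simp add: complex_atlas_def)

lemma atlas_cover: "complex_atlas A \<Longrightarrow> \<exists>c\<in>A. p \<in> fst c"
  unfolding complex_atlas_def by blast

lemma atlas_transition:
  "complex_atlas A \<Longrightarrow> c \<in> A \<Longrightarrow> c' \<in> A \<Longrightarrow> hsm (transition c c') (snd c ` (fst c \<inter> fst c'))"
  by (simp add: complex_atlas_def)

lemma transition_in:
  assumes "is_chart c" "z \<in> snd c ` (fst c \<inter> W)" "W \<subseteq> fst c'"
  shows "transition c c' z \<in> snd c' ` W"
  using assms(2,3) by (auto simp: transition_def is_chart_simps(5)[OF assms(1)])

lemma transition_at: "is_chart c \<Longrightarrow> p \<in> fst c \<Longrightarrow> transition c c' (snd c p) = snd c' p"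
  by (simp add: transition_def is_chart_simps)

lemma hsm_subset: "hsm f U \<Longrightarrow> open V \<Longrightarrow> V \<subseteq> U \<Longrightarrow> hsm f V"
  unfolding holomorphic_several_map_def using hs_subset by blast

section \<open>Holomorphic functions on a manifold\<close>

lemma holomorphic_fun_local:
  assumes A: "complex_atlas A" and W: "open W"
    and loc: "\<And>p. p \<in> W \<Longrightarrow> \<exists>c\<in>A. \<exists>V. open V \<and> p \<in> V \<and> V \<subseteq> W \<inter> fst c \<and> hs (f \<circ> chart_inv c) (snd c ` V)"
  shows "holomorphic_fun A W f"
  unfolding holomorphic_fun_def
proof (intro conjI ballI W)
  fix c' assume c': "c' \<in> A"
  have ch: "is_chart c'" by (rule atlas_chart[OF A c'])
  show "hs (f \<circ> chart_inv c') (snd c' ` (fst c' \<inter> W))"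
  proof (rule hs_local[OF _ open_chart_image[OF ch W]])
    fix z assume "z \<in> snd c' ` (fst c' \<inter> W)"
    then obtain p where p: "p \<in> fst c'" "p \<in> W" "z = snd c' p" by blast
    obtain c V where c: "c \<in> A" "open V" "p \<in> V" "V \<subseteq> W \<inter> fst c" "hs (f \<circ> chart_inv c) (snd c ` V)"
      using loc[OF p(2)] by blast
    have chc: "is_chart c" by (rule atlas_chart[OF A c(1)])
    have op: "open (snd c' ` (fst c' \<inter> V))" by (rule open_chart_image[OF ch c(2)])
    have "hs (\<lambda>z. (f \<circ> chart_inv c) (transition c' c z)) (snd c' ` (fst c' \<inter> V))"
    proof (rule hs_compose[OF c(5) hsm_subset[OF atlas_transition[OF A c' c(1)] op]])
      show "snd c' ` (fst c' \<inter> V) \<subseteq> snd c' ` (fst c' \<inter> fst c)" using c(4) by auto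
      show "transition c' c ` (snd c' ` (fst c' \<inter> V)) \<subseteq> snd c ` V"
        using transition_in[OF ch] c(4) by blast
    qed
    then have "hs (f \<circ> chart_inv c') (snd c' ` (fst c' \<inter> V))"
    proof (rule hs_cong)
      fix x assume "x \<in> snd c' ` (fst c' \<inter> V)"
      then obtain q where q: "q \<in> fst c'" "q \<in> V" "x = snd c' q" by blast
      then show "(f \<circ> chart_inv c) (transition c' c x) = (f \<circ> chart_inv c') x"
        using c(4) by (auto simp: transition_at[OF ch] is_chart_simps(5)[OF ch] is_chart_simps(5)[OF chc])
    qed
    then show "\<exists>V. z \<in> V \<and> hs (f \<circ> chart_inv c') V"
      using p c(3) by (intro exI[of _ "snd c' ` (fst c' \<inter> V)"]) auto
  qed
qed

lemma holomorphic_fun_chart: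
  assumes A: "complex_atlas A" and c: "c \<in> A" and W: "open W" "W \<subseteq> fst c" and f: "hs (f \<circ> chart_inv c) (snd c ` W)"
  shows "holomorphic_fun A W f"
  by (rule holomorphic_fun_local[OF A W(1)]) (use c W f in \<open>auto intro!: bexI[of _ c] exI[of _ W]\<close>)

lemma holomorphic_fun_hs:
  assumes A: "complex_atlas A" and f: "holomorphic_fun A W f" and c: "c \<in> A"
  shows "hs (f \<circ> chart_inv c) (snd c ` (fst c \<inter> W))"
  using f c by (auto simp: holomorphic_fun_def)

lemma holomorphic_fun_cong:
  assumes A: "complex_atlas A" and f: "holomorphic_fun A W f" and eq: "\<And>p. p \<in> W \<Longrightarrow> f p = g p"
  shows "holomorphic_fun A W g"
  unfolding holomorphic_fun_def
proof (intro conjI ballI)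
  show "open W" using f by (simp add: holomorphic_fun_def)
  fix c assume c: "c \<in> A"
  show "hs (g \<circ> chart_inv c) (snd c ` (fst c \<inter> W))"
    by (rule hs_cong[OF holomorphic_fun_hs[OF A f c]]) (use eq in \<open>auto simp: is_chart_simps(5)[OF atlas_chart[OF A c]]\<close>)
qed

lemma holomorphic_fun_glue:
  assumes A: "complex_atlas A" and W: "open W"
    and loc: "\<And>p. p \<in> W \<Longrightarrow> \<exists>N. p \<in> N \<and> N \<subseteq> W \<and> holomorphic_fun A N f"
  shows "holomorphic_fun A W f"
proof (rule holomorphic_fun_local[OF A W])
  fix p assume p: "p \<in> W"
  obtain N where N: "p \<in> N" "N \<subseteq> W" "holomorphic_fun A N f" using loc[OF p] by blast
  obtain c where c: "c \<in> A" "p \<in> fst c" using atlas_cover[OF A] by blast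
  have "open N" using N by (simp add: holomorphic_fun_def)
  then have "open (fst c \<inter> N)" using is_chart_simps(1)[OF atlas_chart[OF A c(1)]] by blast
  then show "\<exists>c\<in>A. \<exists>V. open V \<and> p \<in> V \<and> V \<subseteq> W \<inter> fst c \<and> hs (f \<circ> chart_inv c) (snd c ` V)"
    using N c holomorphic_fun_hs[OF A N(3) c(1)] by (intro bexI[of _ c] exI[of _ "fst c \<inter> N"]) auto
qed

lemma chart_continuous:
  assumes c: "is_chart c" and f: "continuous_on (snd c ` (fst c \<inter> W)) (\<lambda>z. f (chart_inv c z))"
  shows "continuous_on (fst c \<inter> W) f"
proof -
  have "continuous_on (fst c \<inter> W) (\<lambda>p. f (chart_inv c (snd c p)))"
    by (rule continuous_on_compose2[OF f continuous_on_subset[OF is_chart_simps(3)[OF c]]]) auto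
  then show ?thesis
    by (rule continuous_on_eq) (simp add: is_chart_simps(5)[OF c])
qed

lemma holomorphic_fun_continuous:
  assumes A: "complex_atlas A" and f: "holomorphic_fun A W f"
  shows "continuous_on W f"
proof (rule continuous_at_imp_continuous_on, rule ballI)
  fix p assume p: "p \<in> W"
  obtain c where c: "c \<in> A" "p \<in> fst c" using atlas_cover[OF A] by blast
  have ch: "is_chart c" by (rule atlas_chart[OF A c(1)])
  have "continuous_on (fst c \<inter> W) f"
    by (rule chart_continuous[OF ch]) (use hs_continuous_on[OF holomorphic_fun_hs[OF A f c(1)]] in \<open>simp add: o_def\<close>)
  moreover have "open (fst c \<inter> W)" using is_chart_simps(1)[OF ch] f by (auto simp: holomorphic_fun_def)
  ultimately show "isCont f p" using p c by (simp add: continuous_on_eq_continuous_at)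
qed

lemma dense_in_local:
  assumes "\<And>p. p \<in> W \<Longrightarrow> \<exists>N. open N \<and> p \<in> N \<and> dense_in P (N \<inter> W)"
  shows "dense_in P W"
  unfolding dense_in_def
proof (intro allI impI, elim conjE)
  fix V assume V: "open V" "V \<subseteq> W" "V \<noteq> {}"
  then obtain p where p: "p \<in> V" by blast
  then obtain N where N: "open N" "p \<in> N" "dense_in P (N \<inter> W)" using assms V by blast
  then show "\<exists>z\<in>V. P z" using dense_inD[OF N(3), of "V \<inter> N" p] V p by auto
qed

lemma dense_in_chart:
  assumes c: "is_chart c" and W: "W \<subseteq> fst c" and d: "dense_in (\<lambda>z. P (chart_inv c z)) (snd c ` W)"
  shows "dense_in P W"
  unfolding dense_in_def
proof (intro allI impI, elim conjE)
  fix V assume V: "open V" "V \<subseteq> W" "V \<noteq> {}"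
  then obtain p where p: "p \<in> V" by blast
  have "open (snd c ` (fst c \<inter> V))" by (rule open_chart_image[OF c V(1)])
  then obtain z where "z \<in> snd c ` (fst c \<inter> V)" "P (chart_inv c z)"
    using dense_inD[OF d, of "snd c ` (fst c \<inter> V)" "snd c p"] V W p by blast
  then show "\<exists>z\<in>V. P z" using is_chart_simps(5)[OF c] by auto
qed

section \<open>Covectors\<close>

definition jac :: "('a, 'n::finite) chart \<Rightarrow> ('a, 'n) chart \<Rightarrow> complex^'n \<Rightarrow> complex^'n^'n" where
  "jac c c' z = matrix (frechet_derivative (transition c c') (at z))"

lemma hsm_frechet:
  fixes T :: "complex^'n \<Rightarrow> complex^'n"
  assumes T: "hsm T U" "z \<in> U"
  shows "(T has_derivative frechet_derivative T (at z)) (at z)"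
    and "Vector_Spaces.linear (*s) (*s) (frechet_derivative T (at z))"
    and "frechet_derivative T (at z) h $ i = dirderiv h (\<lambda>z. T z $ i) z"
proof -
  obtain L where L: "(T has_derivative L) (at z)" "\<And>c v. L (c *s v) = c *s L v" using hsm_deriv[OF T] by blast
  have eq: "frechet_derivative T (at z) = L" using frechet_derivative_at[OF L(1)] by simp
  interpret L: bounded_linear L using L(1) by (rule has_derivative_bounded_linear)
  show "(T has_derivative frechet_derivative T (at z)) (at z)" using L eq by simp
  show "Vector_Spaces.linear (*s) (*s) (frechet_derivative T (at z))"
    unfolding eq by unfold_locales (auto simp: L.add L(2))
  have hs: "hs (\<lambda>z. T z $ i) U" using T by (simp add: holomorphic_several_map_def)
  have "z + 0 *s h \<in> U" using T by simp
  then obtain M where M: "((\<lambda>t. T (z + t *s h) $ i) has_field_derivative M h) (at 0)" "((\<lambda>z. T z $ i) has_derivative M) (at (z + 0 *s h))"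
    by (rule hs_line_deriv[OF hs]) (rule that, assumption+)
  have "((\<lambda>z. T z $ i) has_derivative (\<lambda>h. L h $ i)) (at z)"
    by (rule bounded_linear.has_derivative[OF bounded_linear_vec_nth L(1)])
  moreover have "((\<lambda>z. T z $ i) has_derivative M) (at z)" using M(2) by simp
  ultimately have "M = (\<lambda>h. L h $ i)" using has_derivative_unique by blast
  then show "frechet_derivative T (at z) h $ i = dirderiv h (\<lambda>z. T z $ i) z"
    using M(1) unfolding eq by (simp add: dirderiv_def DERIV_imp_deriv)
qed

lemma jac_entry:
  assumes A: "complex_atlas A" and c: "c \<in> A" "c' \<in> A" and z: "z \<in> snd c ` (fst c \<inter> fst c')"
  shows "jac c c' z $ i $ j = dirderiv (axis j 1) (\<lambda>z. transition c c' z $ i) z"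
  using hsm_frechet(3)[OF atlas_transition[OF A c] z] by (simp add: jac_def matrix_def)

lemma jac_refl:
  assumes A: "complex_atlas A" and c: "c \<in> A" and z: "z \<in> snd c ` fst c"
  shows "jac c c z = mat 1"
proof -
  have ch: "is_chart c" by (rule atlas_chart[OF A c])
  have "(transition c c has_derivative id) (at z)"
    by (rule has_derivative_transform_within_open[OF has_derivative_id is_chart_simps(2)[OF ch] z])
       (auto simp: transition_def is_chart_simps[OF ch])
  then have "frechet_derivative (transition c c) (at z) = id" using frechet_derivative_at by metis
  then show ?thesis by (simp add: jac_def matrix_id_mat_1)
qed

lemma jac_cocycle:
  assumes A: "complex_atlas A" and c: "c \<in> A" "c' \<in> A" "c'' \<in> A" and p: "p \<in> fst c" "p \<in> fst c'" "p \<in> fst c''"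
  shows "jac c c'' (snd c p) = jac c' c'' (snd c' p) ** jac c c' (snd c p)"
proof -
  have ch: "is_chart c" "is_chart c'" by (rule atlas_chart[OF A c(1)], rule atlas_chart[OF A c(2)])
  let ?z = "snd c p"
  let ?L1 = "frechet_derivative (transition c c') (at ?z)" and ?L2 = "frechet_derivative (transition c' c'') (at (snd c' p))"
  have z: "?z \<in> snd c ` (fst c \<inter> fst c')" "snd c' p \<in> snd c' ` (fst c' \<inter> fst c'')" using p by auto
  note h1 = hsm_frechet[OF atlas_transition[OF A c(1,2)] z(1)]
  note h2 = hsm_frechet[OF atlas_transition[OF A c(2,3)] z(2)]
  have "(transition c' c'' \<circ> transition c c' has_derivative ?L2 \<circ> ?L1) (at ?z)"
    by (rule diff_chain_at[OF h1(1)]) (use h2(1) in \<open>simp add: transition_at[OF ch(1) p(1)]\<close>)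
  then have "(transition c c'' has_derivative ?L2 \<circ> ?L1) (at ?z)"
    by (rule has_derivative_transform_within_open[where s = "snd c ` (fst c \<inter> fst c')"])
       (use open_chart_image[OF ch(1) is_chart_simps(1)[OF ch(2)]] z in \<open>auto simp: transition_def is_chart_simps[OF ch(1)] is_chart_simps[OF ch(2)]\<close>)
  then have "frechet_derivative (transition c c'') (at ?z) = ?L2 \<circ> ?L1" using frechet_derivative_at by metis
  then show ?thesis
    using matrix_compose_gen[OF h1(2) h2(2)] by (simp add: jac_def)
qed

lemma cotangentD:
  assumes "\<alpha> \<in> cotangent_space A p" "c \<in> A" "c' \<in> A" "p \<in> fst c" "p \<in> fst c'"
  shows "\<alpha> c' = \<alpha> c v* jac c' c (snd c' p)"
  using assms unfolding cotangent_space_def jac_def by blast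

lemma cotangentI:
  assumes "\<And>c. c \<notin> A \<or> p \<notin> fst c \<Longrightarrow> \<alpha> c = 0"
    and "\<And>c c'. c \<in> A \<Longrightarrow> c' \<in> A \<Longrightarrow> p \<in> fst c \<Longrightarrow> p \<in> fst c' \<Longrightarrow> \<alpha> c = \<alpha> c' v* jac c c' (snd c p)"
  shows "\<alpha> \<in> cotangent_space A p"
  using assms unfolding cotangent_space_def mem_Collect_eq jac_def by blast

lemma cotangent_outside: "\<alpha> \<in> cotangent_space A p \<Longrightarrow> c \<notin> A \<or> p \<notin> fst c \<Longrightarrow> \<alpha> c = 0"
  unfolding cotangent_space_def mem_Collect_eq by blast

definition covector_of :: "('a, 'n::finite) chart set \<Rightarrow> ('a, 'n) chart \<Rightarrow> 'a \<Rightarrow> complex^'n \<Rightarrow> ('a, 'n) covector" where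
  "covector_of A c p a = (\<lambda>c'. if c' \<in> A \<and> p \<in> fst c' then a v* jac c' c (snd c' p) else 0)"

text \<open>The cocycle rule for Jacobian matrices makes the coefficient vectors in any two charts compatible.\<close>
lemma covector_of_in:
  assumes A: "complex_atlas A" and c: "c \<in> A" "p \<in> fst c"
  shows "covector_of A c p a \<in> cotangent_space A p"
proof -
  have "a v* jac c1 c (snd c1 p) = (a v* jac c2 c (snd c2 p)) v* jac c1 c2 (snd c1 p)"
    if "c1 \<in> A" "c2 \<in> A" "p \<in> fst c1" "p \<in> fst c2" for c1 c2
    using jac_cocycle[OF A that(1,2) c(1) that(3,4) c(2)] by (simp add: vector_matrix_mul_assoc)
  note eq = this
  show ?thesis unfolding cotangent_space_def mem_Collect_eq
  proof (intro conjI allI ballI impI)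
    fix c1 c2 assume "c1 \<in> A" "c2 \<in> A" "p \<in> fst c1 \<inter> fst c2"
    then show "covector_of A c p a c1 = covector_of A c p a c2 v* matrix (frechet_derivative (transition c1 c2) (at (snd c1 p)))"
      using eq[of c1 c2] by (simp only: covector_of_def jac_def Int_iff if_True simp_thms)
  qed (auto simp: covector_of_def)
qed

lemma covector_of_same:
  assumes A: "complex_atlas A" and c: "c \<in> A" "p \<in> fst c"
  shows "covector_of A c p a c = a"
  using c jac_refl[OF A c(1)] by (simp add: covector_of_def)

lemma covector_eqI:
  assumes "\<alpha> \<in> cotangent_space A p" "\<beta> \<in> cotangent_space A p" "c \<in> A" "p \<in> fst c" "\<alpha> c = \<beta> c"
  shows "\<alpha> = \<beta>"
proof
  fix c'
  show "\<alpha> c' = \<beta> c'"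
  proof (cases "c' \<in> A \<and> p \<in> fst c'")
    case True
    then show ?thesis using cotangentD[OF assms(1,3) _ assms(4)] cotangentD[OF assms(2,3) _ assms(4)] assms(5) by metis
  next
    case False
    then show ?thesis using cotangent_outside assms by metis
  qed
qed

lemma cotangent_subspace: "covector.subspace (cotangent_space A p)"
  unfolding covector.subspace_def
proof (intro conjI ballI allI)
  show "0 \<in> cotangent_space A p" by (rule cotangentI) auto
  fix \<alpha> assume a: "\<alpha> \<in> cotangent_space A p"
  show "\<alpha> + \<beta> \<in> cotangent_space A p" if b: "\<beta> \<in> cotangent_space A p" for \<beta>
  proof (rule cotangentI)
    show "(\<alpha> + \<beta>) c = (\<alpha> + \<beta>) c' v* jac c c' (snd c p)"
      if "c \<in> A" "c' \<in> A" "p \<in> fst c" "p \<in> fst c'" for c c'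
      by (simp only: plus_fun_apply vector_matrix_left_distrib cotangentD[OF a that(2,1,4,3)] cotangentD[OF b that(2,1,4,3)])
  qed (use cotangent_outside[OF a] cotangent_outside[OF b] in auto)
  show "covector_scale k \<alpha> \<in> cotangent_space A p" for k
  proof (rule cotangentI)
    show "covector_scale k \<alpha> c = covector_scale k \<alpha> c' v* jac c c' (snd c p)"
      if "c \<in> A" "c' \<in> A" "p \<in> fst c" "p \<in> fst c'" for c c'
      by (simp only: covector_scale_def scalar_vector_matrix_assoc cotangentD[OF a that(2,1,4,3)])
  qed (use cotangent_outside[OF a] in \<open>auto simp: covector_scale_def\<close>)
qed

lemma cotangent_scale: "\<alpha> \<in> cotangent_space A p \<Longrightarrow> covector_scale k \<alpha> \<in> cotangent_space A p"
  using cotangent_subspace covector.subspace_scale by blast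

lemma cotangent_0_iff:
  assumes "\<alpha> \<in> cotangent_space A p" "c \<in> A" "p \<in> fst c"
  shows "\<alpha> = 0 \<longleftrightarrow> \<alpha> c = 0"
  using covector_eqI[OF assms(1) covector.subspace_0[OF cotangent_subspace] assms(2,3)] by auto

text \<open>Proportionality, symmetric in the two covectors; the zero covector is proportional to everything, so
the relation is transitive only through a nonzero covector.\<close>
definition par :: "('a, 'n::finite) covector \<Rightarrow> ('a, 'n) covector \<Rightarrow> bool" where
  "par \<alpha> \<beta> \<longleftrightarrow> (\<exists>u v. (u \<noteq> 0 \<or> v \<noteq> 0) \<and> covector_scale u \<alpha> = covector_scale v \<beta>)"

lemma scale_scale: "covector_scale a (covector_scale b \<alpha>) = covector_scale (a * b) \<alpha>"
  by (rule covector.scale_scale)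

lemma par_sym: "par \<alpha> \<beta> \<Longrightarrow> par \<beta> \<alpha>"
  unfolding par_def by metis

lemma par_scaleE:
  assumes "par \<alpha> \<beta>" "\<beta> \<noteq> 0"
  obtains k where "\<alpha> = covector_scale k \<beta>"
proof -
  obtain u v where uv: "u \<noteq> 0 \<or> v \<noteq> 0" "covector_scale u \<alpha> = covector_scale v \<beta>"
    using assms(1) by (auto simp: par_def)
  have "u \<noteq> 0" using uv assms(2) by auto
  then have "\<alpha> = covector_scale (v / u) \<beta>"
    using arg_cong[OF uv(2), of "covector_scale (1/u)"] by (simp add: scale_scale)
  then show ?thesis using that by blast
qed

lemma par_scale: "par (covector_scale k \<beta>) \<beta>"
  unfolding par_def by (intro exI[of _ 1] exI[of _ k]) simp

lemma par_zero: "par 0 \<beta>"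
  using par_scale[of 0 \<beta>] by simp

lemma par_trans:
  assumes "par \<alpha> \<beta>" "par \<beta> \<gamma>" "\<beta> \<noteq> 0"
  shows "par \<alpha> \<gamma>"
proof (cases "\<gamma> = 0")
  case True
  then show ?thesis using par_sym[OF par_zero] by blast
next
  case False
  obtain k l where "\<alpha> = covector_scale k \<beta>" "\<beta> = covector_scale l \<gamma>"
    using par_scaleE[OF assms(1,3)] par_scaleE[OF assms(2) False] by metis
  then show ?thesis using par_scale by (metis scale_scale)
qed

lemma par_cross: "par \<alpha> \<beta> \<Longrightarrow> \<alpha> c $ i * \<beta> c $ j = \<alpha> c $ j * \<beta> c $ i"
proof -
  assume "par \<alpha> \<beta>"
  then obtain u v where uv: "u \<noteq> 0 \<or> v \<noteq> 0" "covector_scale u \<alpha> = covector_scale v \<beta>"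
    by (auto simp: par_def)
  then have e: "u * \<alpha> c $ k = v * \<beta> c $ k" for k
    unfolding covector_scale_def by (metis vector_smult_component)
  have "u * (\<alpha> c $ i * \<beta> c $ j) = u * (\<alpha> c $ j * \<beta> c $ i)"
    by (simp only: mult.assoc[symmetric] e) (simp only: mult_ac)
  moreover have "v * (\<alpha> c $ i * \<beta> c $ j) = v * (\<alpha> c $ j * \<beta> c $ i)"
  proof -
    have "v * (\<alpha> c $ i * \<beta> c $ j) = \<alpha> c $ i * (v * \<beta> c $ j)" by (simp only: mult_ac)
    also have "\<dots> = \<alpha> c $ j * (u * \<alpha> c $ i)" by (simp only: e[symmetric] mult_ac)
    also have "\<dots> = v * (\<alpha> c $ j * \<beta> c $ i)" by (simp only: e mult_ac)
    finally show ?thesis .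
  qed
  ultimately show ?thesis using uv(1) by auto
qed

lemma cross_par:
  assumes a: "\<alpha> \<in> cotangent_space A p" "\<beta> \<in> cotangent_space A p" and c: "c \<in> A" "p \<in> fst c"
    and cr: "\<And>i j. \<alpha> c $ i * \<beta> c $ j = \<alpha> c $ j * \<beta> c $ i"
  shows "par \<alpha> \<beta>"
proof (cases "\<beta> = 0")
  case True
  then show ?thesis using par_sym[OF par_zero] by blast
next
  case False
  then have "\<beta> c \<noteq> 0" using cotangent_0_iff[OF a(2) c] by blast
  then obtain j where j: "\<beta> c $ j \<noteq> 0" by (auto simp: vec_eq_iff)
  have "\<alpha> = covector_scale (\<alpha> c $ j / \<beta> c $ j) \<beta>"
  proof (rule covector_eqI[OF a(1) cotangent_scale[OF a(2)] c])
    show "\<alpha> c = covector_scale (\<alpha> c $ j / \<beta> c $ j) \<beta> c"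
      using cr[of _ j] j by (simp add: covector_scale_def vec_eq_iff field_simps)
  qed
  then show ?thesis using par_scale by metis
qed

section \<open>Holomorphic forms\<close>

lemma form_open: "holomorphic_form A W \<omega> \<Longrightarrow> open W"
  by (simp add: holomorphic_form_def)

lemma form_cotangent: "holomorphic_form A W \<omega> \<Longrightarrow> p \<in> W \<Longrightarrow> \<omega> p \<in> cotangent_space A p"
  by (simp add: holomorphic_form_def)

lemma form_hsm:
  "holomorphic_form A W \<omega> \<Longrightarrow> c \<in> A \<Longrightarrow> hsm (\<lambda>z. \<omega> (chart_inv c z) c) (snd c ` (fst c \<inter> W))"
  by (simp add: holomorphic_form_def)

lemma form_hs:
  "holomorphic_form A W \<omega> \<Longrightarrow> c \<in> A \<Longrightarrow> hs (\<lambda>z. \<omega> (chart_inv c z) c $ i) (snd c ` (fst c \<inter> W))"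
  using form_hsm[of A W \<omega> c] by (simp add: holomorphic_several_map_def)

lemma form_subset:
  assumes A: "complex_atlas A" and \<omega>: "holomorphic_form A W \<omega>" and V: "open V" "V \<subseteq> W"
  shows "holomorphic_form A V \<omega>"
  unfolding holomorphic_form_def
proof (intro conjI ballI V)
  show "\<omega> p \<in> cotangent_space A p" if "p \<in> V" for p using form_cotangent[OF \<omega>] V that by blast
  fix c assume c: "c \<in> A"
  show "hsm (\<lambda>z. \<omega> (chart_inv c z) c) (snd c ` (fst c \<inter> V))"
    by (rule hsm_subset[OF form_hsm[OF \<omega> c] open_chart_image[OF atlas_chart[OF A c] V(1)]]) (use V in auto)
qed

lemma form_coord_continuous:
  assumes A: "complex_atlas A" and \<omega>: "holomorphic_form A W \<omega>" and c: "c \<in> A"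
  shows "continuous_on (fst c \<inter> W) (\<lambda>p. \<omega> p c $ i)"
  by (rule chart_continuous[OF atlas_chart[OF A c]]) (rule hs_continuous_on[OF form_hs[OF \<omega> c]])

text \<open>In another chart the coefficients get multiplied by the Jacobian of the transition map, whose entries
are holomorphic as derivatives of holomorphic functions.\<close>
lemma form_of_coords:
  assumes A: "complex_atlas A" and c: "c \<in> A" and W: "open W" "W \<subseteq> fst c"
    and a: "hsm a (snd c ` W)"
  shows "holomorphic_form A W (\<lambda>p. covector_of A c p (a (snd c p)))"
  unfolding holomorphic_form_def
proof (intro conjI ballI W(1))
  show "covector_of A c p (a (snd c p)) \<in> cotangent_space A p" if "p \<in> W" for p
    using covector_of_in[OF A c] W that by blast
  fix c' assume c': "c' \<in> A"
  have ch: "is_chart c'" "is_chart c" using atlas_chart[OF A] c c' by auto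
  let ?S = "snd c' ` (fst c' \<inter> W)"
  have So: "open ?S" by (rule open_chart_image[OF ch(1) W(1)])
  have sub: "?S \<subseteq> snd c' ` (fst c' \<inter> fst c)" using W by auto
  have tr: "hsm (transition c' c) ?S"
    by (rule hsm_subset[OF atlas_transition[OF A c' c] So sub])
  show "hsm (\<lambda>z. covector_of A c (chart_inv c' z) (a (snd c (chart_inv c' z))) c') ?S"
    unfolding holomorphic_several_map_def
  proof
    fix j
    have "hs (\<lambda>z. \<Sum>i\<in>UNIV. a (transition c' c z) $ i * dirderiv (axis j 1) (\<lambda>z. transition c' c z $ i) z) ?S"
    proof (intro hs_sum hs_mult So)
      fix i
      show "hs (\<lambda>z. a (transition c' c z) $ i) ?S"
      proof (rule hs_compose[OF _ tr])
        show "hs (\<lambda>z. a z $ i) (snd c ` W)" using a by (simp add: holomorphic_several_map_def)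
        show "transition c' c ` ?S \<subseteq> snd c ` W" using transition_in[OF ch(1) _ W(2)] by blast
      qed
      show "hs (dirderiv (axis j 1) (\<lambda>z. transition c' c z $ i)) ?S"
        by (rule hs_dirderiv) (use tr in \<open>simp add: holomorphic_several_map_def\<close>)
    qed
    then show "hs (\<lambda>z. covector_of A c (chart_inv c' z) (a (snd c (chart_inv c' z))) c' $ j) ?S"
    proof (rule hs_cong)
      fix z assume z: "z \<in> ?S"
      then have z': "z \<in> snd c' ` (fst c' \<inter> fst c)" "chart_inv c' z \<in> fst c'" "snd c' (chart_inv c' z) = z"
        using sub is_chart_simps[OF ch(1)] by auto
      show "(\<Sum>i\<in>UNIV. a (transition c' c z) $ i * dirderiv (axis j 1) (\<lambda>z. transition c' c z $ i) z) =
         covector_of A c (chart_inv c' z) (a (snd c (chart_inv c' z))) c' $ j"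
        using z' c' by (simp add: covector_of_def vector_matrix_mult_def jac_entry[OF A c' c z'(1)] transition_def)
    qed
  qed
qed

text \<open>Proportionality is expressed by equations between continuous functions.\<close>
lemma par_on_dense:
  assumes A: "complex_atlas A" and \<omega>: "holomorphic_form A W \<omega>" and \<eta>: "holomorphic_form A W \<eta>"
    and d: "dense_in (\<lambda>p. par (\<omega> p) (\<eta> p)) W" and p: "p \<in> W"
  shows "par (\<omega> p) (\<eta> p)"
proof -
  obtain c where c: "c \<in> A" "p \<in> fst c" using atlas_cover[OF A] by blast
  have op: "open (fst c \<inter> W)" using is_chart_simps(1)[OF atlas_chart[OF A c(1)]] form_open[OF \<omega>] by auto
  show ?thesis
  proof (rule cross_par[OF form_cotangent[OF \<omega> p] form_cotangent[OF \<eta> p] c])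
    fix i j
    show "\<omega> p c $ i * \<eta> p c $ j = \<omega> p c $ j * \<eta> p c $ i"
    proof (rule continuous_eq_on_dense[where U="fst c \<inter> W" and z=p and f="\<lambda>p. \<omega> p c $ i * \<eta> p c $ j" and g="\<lambda>p. \<omega> p c $ j * \<eta> p c $ i"])
      show "dense_in (\<lambda>p. \<omega> p c $ i * \<eta> p c $ j = \<omega> p c $ j * \<eta> p c $ i) (fst c \<inter> W)"
        by (rule dense_in_mono[OF dense_in_subset[OF d]]) (auto intro: par_cross)
    qed (use op c p in \<open>auto intro!: continuous_on_mult form_coord_continuous[OF A \<omega>] form_coord_continuous[OF A \<eta>]\<close>)
  qed
qed

section \<open>Codimension two in coordinates\<close>
lemma hsm_compose:
  assumes f: "hsm f V" and g: "hsm g U" and "g ` U \<subseteq> V"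
  shows "hsm (\<lambda>z. f (g z)) U"
  unfolding holomorphic_several_map_def
proof
  fix i
  have "hs (\<lambda>z. f z $ i) V" using f by (simp add: holomorphic_several_map_def)
  from hs_compose[OF this g assms(3)] show "hs (\<lambda>z. f (g z) $ i) U" .
qed

lemma hsm_cong:
  assumes f: "hsm f U" and eq: "\<And>z. z \<in> U \<Longrightarrow> f z = g z"
  shows "hsm g U"
  unfolding holomorphic_several_map_def
proof
  fix i
  have "hs (\<lambda>z. f z $ i) U" using f by (simp add: holomorphic_several_map_def)
  then show "hs (\<lambda>z. g z $ i) U" by (rule hs_cong) (simp add: eq)
qed

lemma hsm_id: "open U \<Longrightarrow> hsm (\<lambda>z. z) U"
  unfolding holomorphic_several_map_def by auto

lemma chart_inv_in:
  assumes "is_chart c" "z \<in> snd c ` (fst c \<inter> W)"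
  shows "chart_inv c z \<in> fst c \<inter> W" "snd c (chart_inv c z) = z"
  using assms(2) by (auto simp: is_chart_simps(5)[OF assms(1)])

text \<open>A chart followed by a biholomorphic map of a part of its image is compatible with the atlas. Compatible
charts are what submanifolds are defined by.\<close>
lemma atlas_insert:
  fixes A :: "('a::{t2_space,second_countable_topology}, 'n::finite) chart set"
  assumes A: "complex_atlas A" and c: "c \<in> A" and U: "open U" "U \<subseteq> snd c ` fst c" and V: "open V"
    and h: "homeomorphism U V \<tau> g" and \<tau>: "hsm \<tau> U" and g: "hsm g V"
  shows "complex_atlas (insert (chart_inv c ` U, \<tau> \<circ> snd c) A)"
proof -
  define c2 where "c2 = (chart_inv c ` U, \<tau> \<circ> snd c)"
  have ch: "is_chart c" by (rule atlas_chart[OF A c])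
  note cs = is_chart_simps[OF ch]
  have Uin: "chart_inv c z \<in> fst c" "snd c (chart_inv c z) = z" if "z \<in> U" for z
    using that U(2) cs(6,7) by auto
  have gU: "g y \<in> U" "\<tau> (g y) = y" if "y \<in> V" for y
    using h that by (auto simp: homeomorphism_def)
  have \<tau>V: "\<tau> z \<in> V" "g (\<tau> z) = z" if "z \<in> U" for z
    using h that by (auto simp: homeomorphism_def)
  have f2: "fst c2 = chart_inv c ` U" "fst c2 \<subseteq> fst c" using Uin by (auto simp: c2_def)
  have s2: "snd c2 p = \<tau> (snd c p)" for p by (simp add: c2_def)
  have sU: "snd c p \<in> U" if "p \<in> fst c2" for p using that Uin by (auto simp: f2)
  have o2: "open (fst c2)" unfolding f2 by (rule open_chart_inv_image[OF ch U])
  have im: "snd c2 ` fst c2 = V"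
  proof (intro equalityI subsetI)
    fix y assume "y \<in> snd c2 ` fst c2" then show "y \<in> V" using sU \<tau>V s2 by auto
  next
    fix y assume y: "y \<in> V"
    have "snd c2 (chart_inv c (g y)) = y" using gU[OF y] Uin by (simp add: s2)
    moreover have "chart_inv c (g y) \<in> fst c2" using gU[OF y] by (simp add: f2)
    ultimately show "y \<in> snd c2 ` fst c2" by (metis imageI)
  qed
  have inj: "inj_on (snd c2) (fst c2)"
  proof (rule inj_onI)
    fix p q assume *: "p \<in> fst c2" "q \<in> fst c2" "snd c2 p = snd c2 q"
    then have "snd c p = snd c q" using \<tau>V(2)[OF sU] s2 by metis
    then show "p = q" using cs(5) f2(2) * by (metis subsetD)
  qed
  have inv2: "chart_inv c2 y = chart_inv c (g y)" if y: "y \<in> V" for y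
    unfolding chart_inv_def[of c2]
  proof (rule inv_into_f_eq[OF inj])
    show "chart_inv c (g y) \<in> fst c2" using gU[OF y] by (simp add: f2)
    show "snd c2 (chart_inv c (g y)) = y" using gU[OF y] Uin by (simp add: s2)
  qed
  have "is_chart c2"
    unfolding is_chart_def im
  proof (intro conjI o2 V)
    have "continuous_on (fst c2) (snd c2)"
    proof -
      have "continuous_on (fst c2) (\<lambda>p. \<tau> (snd c p))"
        by (rule continuous_on_compose2[OF homeomorphism_cont1[OF h] continuous_on_subset[OF cs(3) f2(2)]]) (use sU in auto)
      then show ?thesis by (simp add: s2[abs_def] c2_def o_def)
    qed
    moreover have "continuous_on V (chart_inv c2)"
    proof (rule continuous_on_eq)
      show "continuous_on V (\<lambda>y. chart_inv c (g y))"
        by (rule continuous_on_compose2[OF cs(4) homeomorphism_cont2[OF h]]) (use gU U in auto)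
    qed (simp add: inv2)
    moreover have "chart_inv c2 (snd c2 p) = p" if "p \<in> fst c2" for p
      using inj that by (simp add: chart_inv_def)
    moreover have "snd c2 (chart_inv c2 y) = y" if "y \<in> V" for y
      unfolding chart_inv_def by (rule f_inv_into_f) (simp add: im that)
    moreover have "chart_inv c2 ` V = fst c2"
      unfolding chart_inv_def im[symmetric] using inj by (simp add: image_image cong: image_cong)
    ultimately show "homeomorphism (fst c2) V (snd c2) (chart_inv c2)"
      unfolding homeomorphism_def using im by auto
  qed
  note ch2 = this
  have t1: "hsm (transition c2 c') (snd c2 ` (fst c2 \<inter> fst c'))" if c': "c' \<in> A" for c'
  proof -
    let ?S = "snd c2 ` (fst c2 \<inter> fst c')"
    have S: "open ?S" "?S \<subseteq> V" using open_chart_image[OF ch2 is_chart_simps(1)[OF atlas_chart[OF A c']]] im by auto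
    have "hsm (\<lambda>y. transition c c' (g y)) ?S"
    proof (rule hsm_compose[OF atlas_transition[OF A c c'] hsm_subset[OF g S]])
      show "g ` ?S \<subseteq> snd c ` (fst c \<inter> fst c')"
      proof
        fix z assume "z \<in> g ` ?S"
        then obtain p where "p \<in> fst c2" "p \<in> fst c'" "z = g (\<tau> (snd c p))" by (auto simp: s2)
        then show "z \<in> snd c ` (fst c \<inter> fst c')" using \<tau>V(2)[OF sU] f2(2) by auto
      qed
    qed
    then show ?thesis
      by (rule hsm_cong) (use S inv2 in \<open>auto simp: transition_def\<close>)
  qed
  have t2: "hsm (transition c' c2) (snd c' ` (fst c' \<inter> fst c2))" if c': "c' \<in> A" for c'
  proof -
    let ?S = "snd c' ` (fst c' \<inter> fst c2)"
    have ch': "is_chart c'" by (rule atlas_chart[OF A c'])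
    have S: "open ?S" "?S \<subseteq> snd c' ` (fst c' \<inter> fst c)" using open_chart_image[OF ch' o2] f2 by auto
    have "hsm (\<lambda>y. \<tau> (transition c' c y)) ?S"
    proof (rule hsm_compose[OF \<tau> hsm_subset[OF atlas_transition[OF A c' c] S]])
      show "transition c' c ` ?S \<subseteq> U" using transition_at[OF ch', of _ c] sU by auto
    qed
    then show ?thesis
      by (rule hsm_cong) (auto simp: transition_def s2)
  qed
  have t3: "hsm (transition c2 c2) (snd c2 ` (fst c2 \<inter> fst c2))"
    by (rule hsm_cong[OF hsm_id]) (use V im in \<open>auto simp: transition_def is_chart_simps(5)[OF ch2]\<close>)
  have "complex_atlas (insert c2 A)"
    unfolding complex_atlas_def
  proof (intro conjI ballI)
    show "is_chart c'" if "c' \<in> insert c2 A" for c' using that ch2 atlas_chart[OF A, of c'] by blast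
    show "(\<Union>c\<in>insert c2 A. fst c) = UNIV" using A by (auto simp: complex_atlas_def)
    fix c1 c1' assume "c1 \<in> insert c2 A" "c1' \<in> insert c2 A"
    then show "hsm (transition c1 c1') (snd c1 ` (fst c1 \<inter> fst c1'))"
      using t1 t2 t3 atlas_transition[OF A] by blast
  qed
  then show ?thesis by (simp add: c2_def)
qed

text \<open>If the zero set of \<open>\<phi>\<close> is contained in the zero set of \<open>\<omega>\<close>, then so is a smooth hypersurface, by
lemma \<open>smooth_zero\<close>, or an open set if \<open>\<phi>\<close> vanishes identically near \<open>q\<close>.\<close>
lemma codim_no_hypersurface:
  fixes A :: "('a::{t2_space,second_countable_topology}, 'n::finite) chart set"
  assumes A: "complex_atlas A" and \<omega>: "defining_form A W \<omega>" and c: "c \<in> A"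
  shows "no_hypersurface {z \<in> snd c ` (fst c \<inter> W). \<omega> (chart_inv c z) c = 0}"
  unfolding no_hypersurface_def
proof (intro allI impI notI, elim conjE)
  let ?S = "snd c ` (fst c \<inter> W)"
  fix O' \<phi> q assume \<phi>: "hs \<phi> O'" "q \<in> O'" "\<phi> q = 0"
    and sub: "{z\<in>O'. \<phi> z = 0} \<subseteq> {z \<in> ?S. \<omega> (chart_inv c z) c = 0}"
  have form: "holomorphic_form A W \<omega>" and cod: "codim_at_least A 2 {p\<in>W. \<omega> p = 0}"
    using \<omega> by (auto simp: defining_form_def)
  have ch: "is_chart c" by (rule atlas_chart[OF A c])
  have "open (O' \<inter> ?S)" using open_chart_image[OF ch form_open[OF form]] hs_open[OF \<phi>(1)] by auto
  moreover have "q \<in> O' \<inter> ?S" using \<phi> sub by blast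
  ultimately obtain e where e: "e > 0" "ball q e \<subseteq> O' \<inter> ?S" using open_contains_ball by blast
  let ?B = "ball q e"
  have \<phi>B: "hs \<phi> ?B" by (rule hs_subset[OF \<phi>(1)]) (use e in auto)
  have BS: "?B \<subseteq> snd c ` fst c" using e(2) by blast
  have zero: "chart_inv c z \<in> {p\<in>W. \<omega> p = 0}" if z: "z \<in> ?B" "\<phi> z = 0" for z
  proof -
    have "z \<in> {z \<in> ?S. \<omega> (chart_inv c z) c = 0}" using z e sub by blast
    then have w: "chart_inv c z \<in> fst c" "chart_inv c z \<in> W" "\<omega> (chart_inv c z) c = 0"
      using is_chart_simps(5)[OF ch] by auto
    then show ?thesis using cotangent_0_iff[OF form_cotangent[OF form w(2)] c w(1)] by simp
  qed
  show False
  proof (cases "\<exists>z\<in>?B. \<phi> z \<noteq> 0")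
    case True
    then have dense: "dense_in (\<lambda>z. \<phi> z \<noteq> 0) ?B" using hs_dense[OF \<phi>B convex_ball] by blast
    have qB: "q \<in> ?B" using e by simp
    obtain \<psi> k W1 z0 where \<psi>: "hs \<psi> W1" "z0 \<in> W1" "W1 \<subseteq> ?B" "\<psi> z0 = 0" "dirderiv (axis k 1) \<psi> z0 \<noteq> 0"
      "\<And>z. z \<in> W1 \<Longrightarrow> \<psi> z = 0 \<Longrightarrow> \<phi> z = 0"
      by (rule smooth_zero[OF \<phi>B qB \<phi>(3) dense]) (rule that, assumption+)
    obtain U' V g where U': "open U'" "U' \<subseteq> W1" "z0 \<in> U'" "open V" "homeomorphism U' V (straighten \<psi> k) g"
      "hsm g V"
      by (rule straighten_inverse[OF \<psi>(1,2,5)]) (rule that, assumption+)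
    have U'S: "U' \<subseteq> snd c ` fst c" using U' \<psi> BS by blast
    define c2 where "c2 = (chart_inv c ` U', straighten \<psi> k \<circ> snd c)"
    have at: "complex_atlas (insert c2 A)"
      unfolding c2_def by (rule atlas_insert[OF A c U'(1) U'S U'(4,5) hsm_subset[OF hsm_straighten[OF \<psi>(1)] U'(1,2)] U'(6)])
    have s2: "snd c2 (chart_inv c z) $ k = \<psi> z" if "z \<in> U'" for z
      using is_chart_simps(6)[OF ch, of z] that U'S by (auto simp: c2_def)
    define M where "M = {p \<in> fst c2. snd c2 p $ k = 0}"
    have "submanifold_codim A 1 M"
      unfolding submanifold_codim_def
    proof
      fix p assume p: "p \<in> M"
      show "\<exists>c I. complex_atlas (insert c A) \<and> p \<in> fst c \<and> card I = 1 \<and> M \<inter> fst c = {q \<in> fst c. \<forall>i\<in>I. snd c q $ i = 0}"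
        by (rule exI[of _ c2], rule exI[of _ "{k}"]) (use at p in \<open>auto simp: M_def\<close>)
    qed
    moreover have "M \<noteq> {}"
    proof -
      have "chart_inv c z0 \<in> M" using U' \<psi> s2[of z0] by (auto simp: M_def c2_def)
      then show ?thesis by blast
    qed
    moreover have "M \<subseteq> {p\<in>W. \<omega> p = 0}"
    proof
      fix p assume "p \<in> M"
      then obtain z where z: "z \<in> U'" "p = chart_inv c z" "\<psi> z = 0" using s2 by (auto simp: M_def c2_def)
      then show "p \<in> {p\<in>W. \<omega> p = 0}" using zero[of z] \<psi>(3,6) U'(2) by blast
    qed
    ultimately have "2 \<le> (1::nat)" using cod unfolding codim_at_least_def by blast
    then show False by simp
  next
    case False
    define c2 where "c2 = (chart_inv c ` ?B, (\<lambda>z. z) \<circ> snd c)"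
    have "homeomorphism ?B ?B (\<lambda>z. z) (\<lambda>z. z)" by (simp add: homeomorphism_def)
    then have at: "complex_atlas (insert c2 A)"
      unfolding c2_def by (rule atlas_insert[OF A c open_ball BS open_ball _ hsm_id[OF open_ball] hsm_id[OF open_ball]])
    have "submanifold_codim A 0 (fst c2)"
      unfolding submanifold_codim_def
    proof
      fix p assume p: "p \<in> fst c2"
      show "\<exists>c I. complex_atlas (insert c A) \<and> p \<in> fst c \<and> card I = 0 \<and> fst c2 \<inter> fst c = {q \<in> fst c. \<forall>i\<in>I. snd c q $ i = 0}"
        by (rule exI[of _ c2], rule exI[of _ "{}"]) (use at p in auto)
    qed
    moreover have "fst c2 \<noteq> {}" using e by (simp add: c2_def)
    moreover have "fst c2 \<subseteq> {p\<in>W. \<omega> p = 0}" using zero False by (auto simp: c2_def simp del: mem_ball)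
    ultimately have "2 \<le> (0::nat)" using cod unfolding codim_at_least_def by blast
    then show False by simp
  qed
qed

text \<open>A submanifold of codimension zero or one is locally the zero set of the function \<open>0\<close> or of one coordinate
of a compatible chart.\<close>
lemma no_hypersurface_codim:
  fixes A :: "('a::{t2_space,second_countable_topology}, 'n::finite) chart set"
  assumes A: "complex_atlas A" and c: "c \<in> A" and W: "open W" "W \<subseteq> fst c"
    and \<omega>: "\<And>p. p \<in> W \<Longrightarrow> \<omega> p \<in> cotangent_space A p"
    and no: "no_hypersurface {z \<in> snd c ` W. \<omega> (chart_inv c z) c = 0}"
  shows "codim_at_least A 2 {p\<in>W. \<omega> p = 0}"
  unfolding codim_at_least_def
proof (intro allI impI, elim conjE)
  fix j M assume M: "M \<noteq> {}" "M \<subseteq> {p\<in>W. \<omega> p = 0}" "submanifold_codim A j M"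
  have ch: "is_chart c" by (rule atlas_chart[OF A c])
  obtain p where p: "p \<in> M" using M by blast
  then obtain c2 I where c2: "complex_atlas (insert c2 A)" "p \<in> fst c2" "card I = j"
     "M \<inter> fst c2 = {q \<in> fst c2. \<forall>i\<in>I. snd c2 q $ i = 0}"
    using M(3) unfolding submanifold_codim_def by blast
  show "2 \<le> j"
  proof (rule ccontr)
    assume "\<not> 2 \<le> j"
    let ?O = "snd c ` (fst c \<inter> (fst c2 \<inter> W))"
    have o2: "open (fst c2)" using is_chart_simps(1) atlas_chart[OF c2(1)] by blast
    have Oo: "open ?O" by (rule open_chart_image[OF ch open_Int[OF o2 W(1)]])
    have tr: "hsm (transition c c2) ?O"
      by (rule hsm_subset[OF atlas_transition[OF c2(1)] Oo]) (use c in auto)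
    have pO: "snd c p \<in> ?O" using p M(2) W c2(2) by auto
    have zeros: "{z\<in>?O. \<forall>i\<in>I. transition c c2 z $ i = 0} \<subseteq> {z \<in> snd c ` W. \<omega> (chart_inv c z) c = 0}"
    proof
      fix z assume "z \<in> {z\<in>?O. \<forall>i\<in>I. transition c c2 z $ i = 0}"
      then obtain q where q: "q \<in> fst c" "q \<in> fst c2" "q \<in> W" "z = snd c q" "\<forall>i\<in>I. snd c2 q $ i = 0"
        using transition_at[OF ch, of _ c2] by auto
      then have "q \<in> M" using c2(4) by blast
      then have "\<omega> q = 0" using M by blast
      then show "z \<in> {z \<in> snd c ` W. \<omega> (chart_inv c z) c = 0}" using q is_chart_simps(5)[OF ch] by auto
    qed
    have p0: "\<forall>i\<in>I. transition c c2 (snd c p) $ i = 0"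
    proof -
      have "p \<in> fst c" using p M(2) W(2) by blast
      moreover have "p \<in> M \<inter> fst c2" using p c2(2) by blast
      then have "\<forall>i\<in>I. snd c2 p $ i = 0" unfolding c2(4) by blast
      ultimately show ?thesis by (simp add: transition_at[OF ch])
    qed
    have "I = {} \<or> (\<exists>i. I = {i})"
    proof (cases "j = 0")
      case True then show ?thesis using c2(3) by simp
    next
      case False
      then have "card I = 1" using \<open>\<not> 2 \<le> j\<close> c2(3) by simp
      then show ?thesis by (metis card_1_singletonE)
    qed
    then obtain \<phi> where \<phi>: "hs \<phi> ?O" "\<And>z. \<phi> z = 0 \<longleftrightarrow> (\<forall>i\<in>I. transition c c2 z $ i = 0)"
    proof (elim disjE exE)
      assume "I = {}" then show thesis using that[OF hs_const[OF Oo, of 0]] by simp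
    next
      fix i assume I: "I = {i}"
      have "hs (\<lambda>z. transition c c2 z $ i) ?O" using tr by (simp add: holomorphic_several_map_def)
      from that[OF this] show thesis using I by simp
    qed
    then show False using no pO p0 zeros unfolding no_hypersurface_def by blast
  qed
qed

lemma defining_form_form: "defining_form A W \<omega> \<Longrightarrow> holomorphic_form A W \<omega>"
  by (simp add: defining_form_def)

lemma defining_form_dense:
  assumes A: "complex_atlas A" and \<omega>: "defining_form A W \<omega>"
  shows "dense_in (\<lambda>p. \<omega> p \<noteq> 0) W"
proof (rule dense_in_local)
  fix p assume "p \<in> W"
  obtain c where c: "c \<in> A" "p \<in> fst c" using atlas_cover[OF A] by blast
  have ch: "is_chart c" by (rule atlas_chart[OF A c(1)])
  have "dense_in (\<lambda>z. \<omega> (chart_inv c z) \<noteq> 0) (snd c ` (fst c \<inter> W))"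
    by (rule dense_in_mono[OF no_hypersurface_dense[OF codim_no_hypersurface[OF A \<omega> c(1)]]]) auto
  then have "dense_in (\<lambda>p. \<omega> p \<noteq> 0) (fst c \<inter> W)" by (rule dense_in_chart[OF ch, rotated]) auto
  then show "\<exists>N. open N \<and> p \<in> N \<and> dense_in (\<lambda>p. \<omega> p \<noteq> 0) (N \<inter> W)"
    using c is_chart_simps(1)[OF ch] by blast
qed

section \<open>Distributions given by local forms\<close>

text \<open>Let \<open>a / b\<close> be the quotient \<open>x $ i / y $ i\<close> in lowest terms, so that \<open>a *s y = b *s x\<close>. If \<open>b\<close> had a zero,
then at most zeros of \<open>b\<close> the value of \<open>a\<close> would be nonzero and hence \<open>y\<close> would be zero, so the zero set
of \<open>y\<close> would contain a hypersurface. The same holds with \<open>a\<close> and \<open>x\<close>.\<close>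
lemma proportional_unit:
  fixes x y :: "complex^'n \<Rightarrow> complex^'n"
  assumes x: "hsm x B" and y: "hsm y B" and B: "convex B" "z0 \<in> B"
    and nx: "no_hypersurface {z\<in>B. x z = 0}" and ny: "no_hypersurface {z\<in>B. y z = 0}"
    and xy: "\<And>z i j. z \<in> B \<Longrightarrow> x z $ i * y z $ j = x z $ j * y z $ i"
  shows "\<exists>N u. z0 \<in> N \<and> N \<subseteq> B \<and> hs u N \<and> (\<forall>z\<in>N. u z \<noteq> 0 \<and> x z = u z *s y z)"
proof -
  have Bo: "open B" using hsm_open[OF x] .
  have hx: "hs (\<lambda>z. x z $ i) B" and hy: "hs (\<lambda>z. y z $ i) B" for i
    using x y by (auto simp: holomorphic_several_map_def)
  obtain z1 where z1: "z1 \<in> B" "y z1 \<noteq> 0"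
    using dense_inD[OF no_hypersurface_dense[OF ny] Bo subset_refl B(2)] by blast
  then obtain i where "y z1 $ i \<noteq> 0" by (auto simp: vec_eq_iff)
  then have dense: "dense_in (\<lambda>z. y z $ i \<noteq> 0) B" using hs_dense[OF hy B(1) z1(1)] by blast
  obtain a b U where U: "z0 \<in> U" "U \<subseteq> B" "hs a U" "hs b U" "\<And>z. z \<in> U \<Longrightarrow> a z * y z $ i = b z * x z $ i"
    "no_hypersurface {z\<in>U. a z = 0 \<and> b z = 0}"
    by (rule reduced_fraction[OF hx hy B(2) dense]) (rule that, assumption+)
  have Uo: "open U" using hs_open U by blast
  have hxU: "hs (\<lambda>z. x z $ j) U" and hyU: "hs (\<lambda>z. y z $ j) U" for j
    by (rule hs_subset[OF hx Uo U(2)], rule hs_subset[OF hy Uo U(2)])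
  have ab: "a z * y z $ j = b z * x z $ j" if z: "z \<in> U" for z j
  proof (rule continuous_eq_on_dense[where U=U and z=z and f="\<lambda>z. a z * y z $ j" and g="\<lambda>z. b z * x z $ j"])
    show "dense_in (\<lambda>z. a z * y z $ j = b z * x z $ j) U"
    proof (rule dense_in_mono[OF dense_in_subset[OF dense U(2)]])
      fix z assume z: "z \<in> U" "y z $ i \<noteq> 0"
      have "(a z * y z $ j) * y z $ i = (a z * y z $ i) * y z $ j" by (simp only: mult_ac)
      also have "\<dots> = b z * (x z $ i * y z $ j)" using U(5)[OF z(1)] by (simp only: mult.assoc)
      also have "\<dots> = b z * (x z $ j * y z $ i)" using xy[of z i j] z U(2) by auto
      also have "\<dots> = (b z * x z $ j) * y z $ i" by (simp only: mult_ac)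
      finally show "a z * y z $ j = b z * x z $ j" using z(2) by simp
    qed
  qed (use Uo z in \<open>auto intro!: hs_continuous_on hs_mult U hxU hyU\<close>)
  have b0: "b z0 \<noteq> 0"
  proof
    assume "b z0 = 0"
    then obtain z where z: "z \<in> U" "b z = 0" "a z \<noteq> 0"
      using no_hypersurfaceD[OF U(6,4,1)] by blast
    let ?O = "{z\<in>U. a z \<noteq> 0}"
    have "open ?O" by (rule hs_open_nonzero[OF U(3)])
    then obtain w where "w \<in> ?O" "b w = 0" "w \<notin> {z\<in>B. y z = 0}"
      using no_hypersurfaceD[OF ny hs_subset[OF U(4)], of ?O z] z by blast
    then show False using ab[of w] U(2) by (auto simp: vec_eq_iff)
  qed
  have a0: "a z0 \<noteq> 0"
  proof
    assume "a z0 = 0"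
    then obtain z where z: "z \<in> U" "a z = 0" "b z \<noteq> 0"
      using no_hypersurfaceD[OF U(6,3,1)] by blast
    let ?O = "{z\<in>U. b z \<noteq> 0}"
    have "open ?O" by (rule hs_open_nonzero[OF U(4)])
    then obtain w where "w \<in> ?O" "a w = 0" "w \<notin> {z\<in>B. x z = 0}"
      using no_hypersurfaceD[OF nx hs_subset[OF U(3)], of ?O z] z by blast
    then show False using ab[of w] U(2) by (auto simp: vec_eq_iff)
  qed
  let ?N = "{z\<in>U. a z \<noteq> 0} \<inter> {z\<in>U. b z \<noteq> 0}"
  have No: "open ?N" by (intro open_Int hs_open_nonzero U)
  have "hs (\<lambda>z. a z / b z) ?N"
    by (intro hs_divide hs_subset[OF U(3) No] hs_subset[OF U(4) No]) auto
  moreover have "x z = (a z / b z) *s y z" if "z \<in> ?N" for z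
    using ab[of z] that by (simp add: vec_eq_iff field_simps)
  ultimately show ?thesis using U a0 b0 by (intro exI[of _ ?N] exI[of _ "\<lambda>z. a z / b z"]) auto
qed

text \<open>The local units of the preceding lemma are uniquely determined where \<open>\<omega>'\<close> is not zero, which is a dense
set, so they agree on overlaps.\<close>
lemma equal_up_to_unit_of_par:
  assumes A: "complex_atlas A" and \<omega>: "defining_form A W \<omega>" and \<omega>': "defining_form A W' \<omega>'"
    and par: "\<And>p. p \<in> W \<inter> W' \<Longrightarrow> par (\<omega> p) (\<omega>' p)"
  shows "equal_up_to_unit A (W \<inter> W') \<omega> \<omega>'"
proof -
  let ?W = "W \<inter> W'"
  have Wo: "open ?W" using form_open[OF defining_form_form[OF \<omega>]] form_open[OF defining_form_form[OF \<omega>']] by auto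
  have f: "holomorphic_form A ?W \<omega>" "holomorphic_form A ?W \<omega>'"
    by (rule form_subset[OF A defining_form_form[OF \<omega>] Wo], simp, rule form_subset[OF A defining_form_form[OF \<omega>'] Wo], simp)
  have loc: "\<exists>N u. p \<in> N \<and> N \<subseteq> ?W \<and> holomorphic_fun A N u \<and> (\<forall>q\<in>N. u q \<noteq> 0 \<and> \<omega> q = covector_scale (u q) (\<omega>' q))"
    if p: "p \<in> ?W" for p
  proof -
    obtain c where c: "c \<in> A" "p \<in> fst c" using atlas_cover[OF A] by blast
    have ch: "is_chart c" by (rule atlas_chart[OF A c(1)])
    let ?S = "snd c ` (fst c \<inter> ?W)"
    have "open ?S" "snd c p \<in> ?S" using open_chart_image[OF ch Wo] c p by auto
    then obtain e where e: "e > 0" "ball (snd c p) e \<subseteq> ?S" using open_contains_ball by blast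
    let ?B = "ball (snd c p) e"
    let ?x = "\<lambda>z. \<omega> (chart_inv c z) c" and ?y = "\<lambda>z. \<omega>' (chart_inv c z) c"
    have pB: "snd c p \<in> ?B" using e by simp
    have inW: "chart_inv c z \<in> fst c \<inter> ?W" if "z \<in> ?B" for z
      using chart_inv_in(1)[OF ch subsetD[OF e(2) that]] .
    have "\<exists>N u. snd c p \<in> N \<and> N \<subseteq> ?B \<and> hs u N \<and> (\<forall>z\<in>N. u z \<noteq> 0 \<and> ?x z = u z *s ?y z)"
    proof (rule proportional_unit[OF hsm_subset[OF form_hsm[OF f(1) c(1)] open_ball e(2)]
            hsm_subset[OF form_hsm[OF f(2) c(1)] open_ball e(2)] convex_ball pB])
      show "no_hypersurface {z \<in> ?B. ?x z = 0}"
        by (rule no_hypersurface_subset[OF codim_no_hypersurface[OF A \<omega> c(1)]]) (use e(2) in blast)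
      show "no_hypersurface {z \<in> ?B. ?y z = 0}"
        by (rule no_hypersurface_subset[OF codim_no_hypersurface[OF A \<omega>' c(1)]]) (use e(2) in blast)
      show "?x z $ i * ?y z $ j = ?x z $ j * ?y z $ i" if "z \<in> ?B" for z i j
        using inW[OF that] by (intro par_cross par) auto
    qed
    then obtain N u where N: "snd c p \<in> N" "N \<subseteq> ?B" "hs u N" "\<And>z. z \<in> N \<Longrightarrow> u z \<noteq> 0" "\<And>z. z \<in> N \<Longrightarrow> ?x z = u z *s ?y z"
      by blast
    let ?M = "chart_inv c ` N"
    have NS: "N \<subseteq> snd c ` fst c" using N(2) e(2) by blast
    have Mo: "open ?M" by (rule open_chart_inv_image[OF ch hs_open[OF N(3)] NS])
    have MW: "?M \<subseteq> fst c \<inter> ?W" using inW N(2) by blast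
    have sM: "snd c ` ?M = N" using NS is_chart_simps(6)[OF ch] by (force simp: image_image)
    have sq: "snd c q \<in> N" "chart_inv c (snd c q) = q" if "q \<in> ?M" for q
      using that sM MW is_chart_simps(5)[OF ch] by auto
    have "holomorphic_fun A ?M (\<lambda>q. u (snd c q))"
    proof (rule holomorphic_fun_chart[OF A c(1) Mo])
      show "hs ((\<lambda>q. u (snd c q)) \<circ> chart_inv c) (snd c ` ?M)"
        unfolding sM by (rule hs_cong[OF N(3)]) (use NS is_chart_simps(6)[OF ch] in auto)
    qed (use MW in auto)
    moreover have "\<omega> q = covector_scale (u (snd c q)) (\<omega>' q)" if q: "q \<in> ?M" for q
    proof (rule covector_eqI[OF form_cotangent[OF f(1)] cotangent_scale[OF form_cotangent[OF f(2)]] c(1)])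
      show "\<omega> q c = covector_scale (u (snd c q)) (\<omega>' q) c"
        using N(5)[OF sq(1)[OF q]] sq(2)[OF q] by (simp add: covector_scale_def)
    qed (use q MW in auto)
    moreover have "p \<in> ?M" using N(1) is_chart_simps(5)[OF ch c(2)] by (metis imageI)
    moreover have "u (snd c q) \<noteq> 0" if "q \<in> ?M" for q using N(4) sq(1)[OF that] by blast
    ultimately show ?thesis using MW by (intro exI[of _ ?M] exI[of _ "\<lambda>q. u (snd c q)"]) auto
  qed
  then obtain N u where N: "\<And>p. p \<in> ?W \<Longrightarrow> p \<in> N p" "\<And>p. p \<in> ?W \<Longrightarrow> N p \<subseteq> ?W" "\<And>p. p \<in> ?W \<Longrightarrow> holomorphic_fun A (N p) (u p)"
    "\<And>p q. p \<in> ?W \<Longrightarrow> q \<in> N p \<Longrightarrow> u p q \<noteq> 0 \<and> \<omega> q = covector_scale (u p q) (\<omega>' q)"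
    by metis
  have dense: "dense_in (\<lambda>p. \<omega>' p \<noteq> 0) ?W"
    by (rule dense_in_subset[OF defining_form_dense[OF A \<omega>']]) simp
  have agree: "u p q = u q q" if pq: "p \<in> ?W" "q \<in> N p" for p q
  proof -
    have q: "q \<in> ?W" using N pq by blast
    let ?V = "N p \<inter> N q"
    have "open (N p)" "open (N q)" using N(3) pq(1) q by (auto simp: holomorphic_fun_def)
    then show ?thesis
    proof (intro continuous_eq_on_dense[where U="?V" and f="u p" and g="u q" and z=q])
      show "dense_in (\<lambda>x. u p x = u q x) ?V"
      proof (rule dense_in_mono[OF dense_in_subset[OF dense]])
        fix x assume x: "x \<in> ?V" "\<omega>' x \<noteq> 0"
        then have "covector_scale (u p x) (\<omega>' x) = covector_scale (u q x) (\<omega>' x)"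
          using N(4)[OF pq(1), of x] N(4)[OF q, of x] by simp
        then show "u p x = u q x" using x(2) by simp
      qed (use N(2) pq(1) in blast)
      show "continuous_on ?V (u p)" "continuous_on ?V (u q)"
        using holomorphic_fun_continuous[OF A N(3)] pq(1) q by (auto intro: continuous_on_subset)
    qed (use pq N(1) q in auto)
  qed
  have "holomorphic_fun A ?W (\<lambda>q. u q q)"
  proof (rule holomorphic_fun_glue[OF A Wo])
    fix p assume p: "p \<in> ?W"
    have "holomorphic_fun A (N p) (\<lambda>q. u q q)"
      by (rule holomorphic_fun_cong[OF A N(3)[OF p]]) (use agree p in blast)
    then show "\<exists>N. p \<in> N \<and> N \<subseteq> ?W \<and> holomorphic_fun A N (\<lambda>q. u q q)" using N p by blast
  qed
  moreover have "u p p \<noteq> 0 \<and> \<omega> p = covector_scale (u p p) (\<omega>' p)" if "p \<in> ?W" for p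
    using N(4)[OF that N(1)[OF that]] .
  ultimately show ?thesis unfolding equal_up_to_unit_def by blast
qed

text \<open>Dividing the coefficients by their common divisor gives a form that is proportional to \<open>\<eta>\<close> and vanishes
only in codimension two.\<close>
lemma saturation:
  assumes A: "complex_atlas A" and \<eta>: "holomorphic_form A N \<eta>" and p: "p \<in> N" and dense: "dense_in (\<lambda>q. \<eta> q \<noteq> 0) N"
  shows "\<exists>W \<omega>. p \<in> W \<and> W \<subseteq> N \<and> defining_form A W \<omega> \<and> (\<forall>q\<in>W. par (\<omega> q) (\<eta> q))"
proof -
  obtain c where c: "c \<in> A" "p \<in> fst c" using atlas_cover[OF A] by blast
  have ch: "is_chart c" by (rule atlas_chart[OF A c(1)])
  let ?S = "snd c ` (fst c \<inter> N)"
  have "open ?S" "snd c p \<in> ?S" using open_chart_image[OF ch form_open[OF \<eta>]] c p by auto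
  then obtain e where e: "e > 0" "ball (snd c p) e \<subseteq> ?S" using open_contains_ball by blast
  let ?B = "ball (snd c p) e"
  have inN: "chart_inv c z \<in> fst c \<inter> N" "snd c (chart_inv c z) = z" if "z \<in> ?B" for z
    using chart_inv_in[OF ch subsetD[OF e(2) that]] by blast+
  have BS: "?B \<subseteq> snd c ` fst c" using e(2) by blast
  have hB: "hs (\<lambda>z. \<eta> (chart_inv c z) c $ i) ?B" for i by (rule hs_subset[OF form_hs[OF \<eta> c(1)] open_ball e(2)])
  have "open (chart_inv c ` ?B)" by (rule open_chart_inv_image[OF ch open_ball BS])
  moreover have "chart_inv c ` ?B \<subseteq> N" using inN by auto
  moreover have "chart_inv c (snd c p) \<in> chart_inv c ` ?B" using e by auto
  ultimately obtain q where q: "q \<in> chart_inv c ` ?B" "\<eta> q \<noteq> 0"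
    using dense_inD[OF dense] by blast
  then obtain z1 where z1: "z1 \<in> ?B" "q = chart_inv c z1" by blast
  have "\<eta> q c \<noteq> 0"
    using cotangent_0_iff[OF form_cotangent[OF \<eta>, of q] c(1)] inN(1)[OF z1(1)] z1(2) q(2) by auto
  then obtain i0 where i0: "\<eta> (chart_inv c z1) c $ i0 \<noteq> 0" using z1 by (auto simp: vec_eq_iff)
  have dB: "dense_in (\<lambda>z. \<eta> (chart_inv c z) c $ i0 \<noteq> 0) ?B"
    by (rule hs_dense[OF hB convex_ball z1(1) i0])
  have pB: "snd c p \<in> ?B" using e by simp
  have "\<exists>U a. snd c p \<in> U \<and> U \<subseteq> ?B \<and> (\<forall>i\<in>insert i0 (UNIV - {i0}). hs (a i) U) \<and>
     (\<forall>z\<in>U. \<forall>i\<in>insert i0 (UNIV - {i0}). a i z * \<eta> (chart_inv c z) c $ i0 = a i0 z * \<eta> (chart_inv c z) c $ i) \<and>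
     no_hypersurface {z\<in>U. \<forall>i\<in>insert i0 (UNIV - {i0}). a i z = 0}"
    by (rule reduced_tuple[where \<eta>="\<lambda>i z. \<eta> (chart_inv c z) c $ i", OF _ _ hB pB dB]) auto
  moreover have "insert i0 (UNIV - {i0}) = UNIV" by auto
  ultimately obtain U a where U0: "snd c p \<in> U" "U \<subseteq> ?B" "\<forall>i. hs (a i) U"
    "\<forall>z\<in>U. \<forall>i. a i z * \<eta> (chart_inv c z) c $ i0 = a i0 z * \<eta> (chart_inv c z) c $ i"
    "no_hypersurface {z\<in>U. \<forall>i. a i z = 0}" by auto
  note U = U0(1,2) U0(3)[rule_format] U0(4)[rule_format] U0(5)
  have Uo: "open U" using U(3) hs_open by blast
  define av where "av = (\<lambda>z. \<chi> i. a i z)"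
  have hav: "hsm av U" using U(3) by (simp add: holomorphic_several_map_def av_def)
  let ?W = "chart_inv c ` U"
  have Wo: "open ?W" by (rule open_chart_inv_image[OF ch Uo]) (use U(2) BS in blast)
  have WN: "?W \<subseteq> fst c" "?W \<subseteq> N" using inN U(2) by blast+
  have sW: "snd c ` ?W = U" using inN(2) U(2) by (force simp: image_image)
  define \<omega> where "\<omega> = (\<lambda>p. covector_of A c p (av (snd c p)))"
  have form: "holomorphic_form A ?W \<omega>"
    unfolding \<omega>_def by (rule form_of_coords[OF A c(1) Wo WN(1)]) (simp only: sW hav)
  have \<omega>c: "\<omega> (chart_inv c z) c = av z" if "z \<in> U" for z
  proof -
    have z: "z \<in> ?B" using that U(2) by blast
    then show ?thesis using covector_of_same[OF A c(1)] inN[OF z] by (simp add: \<omega>_def)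
  qed
  have "codim_at_least A 2 {q\<in>?W. \<omega> q = 0}"
  proof (rule no_hypersurface_codim[OF A c(1) Wo WN(1) form_cotangent[OF form]])
    show "no_hypersurface {z \<in> snd c ` ?W. \<omega> (chart_inv c z) c = 0}"
      unfolding sW by (rule no_hypersurface_subset[OF U(5)]) (auto simp: \<omega>c av_def vec_eq_iff)
  qed
  then have def: "defining_form A ?W \<omega>" using form by (simp add: defining_form_def)
  have "par (\<omega> q) (\<eta> q)" if q: "q \<in> ?W" for q
  proof (rule par_on_dense[OF A form form_subset[OF A \<eta> Wo WN(2)] _ q])
    show "dense_in (\<lambda>p. par (\<omega> p) (\<eta> p)) ?W"
    proof (rule dense_in_chart[OF ch WN(1)], unfold sW, rule dense_in_mono[OF dense_in_subset[OF dB U(2)]])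
      fix z assume z: "z \<in> U" "\<eta> (chart_inv c z) c $ i0 \<noteq> 0"
      let ?q = "chart_inv c z"
      have q: "?q \<in> ?W" using z by blast
      show "par (\<omega> ?q) (\<eta> ?q)"
      proof (rule cross_par[OF form_cotangent[OF form q] form_cotangent[OF \<eta>] c(1)])
        fix i j
        have a: "a k z = a i0 z * \<eta> ?q c $ k / \<eta> ?q c $ i0" for k using U(4)[OF z(1), of k] z(2) by (simp add: field_simps)
        have "a i z * \<eta> ?q c $ j = a j z * \<eta> ?q c $ i" using a[of i] a[of j] by simp
        then show "\<omega> ?q c $ i * \<eta> ?q c $ j = \<omega> ?q c $ j * \<eta> ?q c $ i" using \<omega>c[OF z(1)] by (simp add: av_def)
      qed (use WN q in auto)
    qed
  qed
  moreover have "p \<in> ?W" using U(1) is_chart_simps(5)[OF ch c(2)] by (metis imageI)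
  ultimately show ?thesis using def WN(2) by blast
qed

lemma par_trans_dense:
  assumes A: "complex_atlas A" and f: "holomorphic_form A W \<omega>" "holomorphic_form A W \<theta>"
    and d: "dense_in (\<lambda>p. \<eta> p \<noteq> 0) W" and par: "\<And>p. p \<in> W \<Longrightarrow> par (\<omega> p) (\<eta> p)" "\<And>p. p \<in> W \<Longrightarrow> par (\<eta> p) (\<theta> p)"
    and p: "p \<in> W"
  shows "par (\<omega> p) (\<theta> p)"
  by (rule par_on_dense[OF A f dense_in_mono[OF d] p]) (use par par_trans in blast)

text \<open>A covering by holomorphic forms that are proportional on overlaps determines a distribution, even if the
forms vanish on hypersurfaces: its defining forms are all those proportional to the given ones.\<close>
lemma distribution_of_local_forms:
  fixes H :: "('a::{t2_space,second_countable_topology} set \<times> ('a \<Rightarrow> ('a, 'n::finite) covector)) set"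
  assumes A: "complex_atlas A"
    and H: "\<And>N \<eta>. (N, \<eta>) \<in> H \<Longrightarrow> holomorphic_form A N \<eta>" "\<And>N \<eta>. (N, \<eta>) \<in> H \<Longrightarrow> dense_in (\<lambda>q. \<eta> q \<noteq> 0) N"
    and cover: "\<And>p. \<exists>N \<eta>. (N, \<eta>) \<in> H \<and> p \<in> N"
    and compat: "\<And>N \<eta> N' \<eta>' p. (N, \<eta>) \<in> H \<Longrightarrow> (N', \<eta>') \<in> H \<Longrightarrow> p \<in> N \<Longrightarrow> p \<in> N' \<Longrightarrow> par (\<eta> p) (\<eta>' p)"
  shows "is_distribution A {(W, \<omega>). defining_form A W \<omega> \<and> (\<forall>(N, \<eta>)\<in>H. \<forall>p\<in>W \<inter> N. par (\<omega> p) (\<eta> p))}"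
proof -
  define D where "D = {(W, \<omega>). defining_form A W \<omega> \<and> (\<forall>(N, \<eta>)\<in>H. \<forall>p\<in>W \<inter> N. par (\<omega> p) (\<eta> p))}"
  have D: "(W, \<omega>) \<in> D \<longleftrightarrow> defining_form A W \<omega> \<and> (\<forall>N \<eta> p. (N, \<eta>) \<in> H \<longrightarrow> p \<in> W \<longrightarrow> p \<in> N \<longrightarrow> par (\<omega> p) (\<eta> p))" for W \<omega>
    unfolding D_def by blast
  have parD: "par (\<omega> p) (\<omega>' p)" if m: "(W, \<omega>) \<in> D" "(W', \<omega>') \<in> D" and p: "p \<in> W \<inter> W'" for W \<omega> W' \<omega>' p
  proof -
    obtain N \<eta> where N: "(N, \<eta>) \<in> H" "p \<in> N" using cover by blast
    have d: "defining_form A W \<omega>" "defining_form A W' \<omega>'" using m D by auto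
    have o: "open (W \<inter> W' \<inter> N)"
      using form_open[OF defining_form_form[OF d(1)]] form_open[OF defining_form_form[OF d(2)]] form_open[OF H(1)[OF N(1)]] by auto
    show ?thesis
    proof (rule par_trans_dense[OF A form_subset[OF A defining_form_form[OF d(1)] o] form_subset[OF A defining_form_form[OF d(2)] o]
          dense_in_subset[OF H(2)[OF N(1)]]])
      show "par (\<omega> q) (\<eta> q)" "par (\<eta> q) (\<omega>' q)" if "q \<in> W \<inter> W' \<inter> N" for q
        using that m N(1) D par_sym by blast+
    qed (use p N in auto)
  qed
  have "is_distribution A D"
    unfolding is_distribution_def
  proof (intro conjI)
    show "\<forall>(W, \<omega>)\<in>D. defining_form A W \<omega>" using D by blast
    show "\<forall>(W, \<omega>)\<in>D. \<forall>(W', \<omega>')\<in>D. equal_up_to_unit A (W \<inter> W') \<omega> \<omega>'"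
    proof (intro ballI, clarify)
      fix W \<omega> W' \<omega>' assume m: "(W, \<omega>) \<in> D" "(W', \<omega>') \<in> D"
      show "equal_up_to_unit A (W \<inter> W') \<omega> \<omega>'"
        by (rule equal_up_to_unit_of_par[OF A]) (use m D parD[OF m] in auto)
    qed
    have cov: "\<exists>W \<omega>. (W, \<omega>) \<in> D \<and> p \<in> W" for p
    proof -
      obtain N \<eta> where N: "(N, \<eta>) \<in> H" "p \<in> N" using cover by blast
      obtain W \<omega> where W: "p \<in> W" "W \<subseteq> N" "defining_form A W \<omega>" "\<forall>q\<in>W. par (\<omega> q) (\<eta> q)"
        using saturation[OF A H(1)[OF N(1)] N(2) H(2)[OF N(1)]] by blast
      have "par (\<omega> q) (\<eta>' q)" if m: "(N', \<eta>') \<in> H" and q: "q \<in> W" "q \<in> N'" for N' \<eta>' q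
      proof -
        have o: "open (W \<inter> N')" using form_open[OF defining_form_form[OF W(3)]] form_open[OF H(1)[OF m]] by auto
        show ?thesis
        proof (rule par_trans_dense[OF A form_subset[OF A defining_form_form[OF W(3)] o] form_subset[OF A H(1)[OF m] o]
             dense_in_subset[OF H(2)[OF N(1)]]])
          show "par (\<omega> x) (\<eta> x)" "par (\<eta> x) (\<eta>' x)" if "x \<in> W \<inter> N'" for x
            using that W compat[OF N(1) m] by auto
        qed (use q W in auto)
      qed
      then have "(W, \<omega>) \<in> D" using D W by blast
      then show ?thesis using W by blast
    qed
    show "(\<Union>(W, \<omega>)\<in>D. W) = UNIV" using cov by fast
    show "\<forall>W \<omega>. defining_form A W \<omega> \<and> (\<forall>(W', \<omega>')\<in>D. equal_up_to_unit A (W \<inter> W') \<omega> \<omega>') \<longrightarrow> (W, \<omega>) \<in> D"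
    proof (intro allI impI, elim conjE)
      fix W \<omega> assume W: "defining_form A W \<omega>" and eq: "\<forall>(W', \<omega>')\<in>D. equal_up_to_unit A (W \<inter> W') \<omega> \<omega>'"
      have "par (\<omega> p) (\<eta> p)" if m: "(N, \<eta>) \<in> H" "p \<in> W" "p \<in> N" for N \<eta> p
      proof -
        obtain W' \<omega>' where W': "(W', \<omega>') \<in> D" "p \<in> W'" using cov by blast
        then obtain g where g: "g \<noteq> 0" "\<omega> p = covector_scale g (\<omega>' p)"
          using eq m(2) unfolding equal_up_to_unit_def by blast
        have "par (\<omega>' p) (\<eta> p)" using D W' m by blast
        then obtain u v where uv: "u \<noteq> 0 \<or> v \<noteq> 0" "covector_scale u (\<omega>' p) = covector_scale v (\<eta> p)"
          unfolding par_def by blast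
        have "covector_scale (u / g) (\<omega> p) = covector_scale v (\<eta> p)" using g uv by (simp add: scale_scale)
        moreover have "u / g \<noteq> 0 \<or> v \<noteq> 0" using uv g by simp
        ultimately show ?thesis unfolding par_def by blast
      qed
      then show "(W, \<omega>) \<in> D" using D W by blast
    qed
  qed
  then show ?thesis by (simp add: D_def)
qed

section \<open>Linear algebra\<close>

lemma (in vector_space) family_independent:
  assumes "finite E" and ind: "\<And>u. (\<Sum>i\<in>E. scale (u i) (x i)) = 0 \<Longrightarrow> \<forall>i\<in>E. u i = 0"
  shows "inj_on x E" "independent (x ` E)"
proof -
  show inj: "inj_on x E"
  proof (rule inj_onI, rule ccontr)
    fix i j assume ij: "i \<in> E" "j \<in> E" "x i = x j" "i \<noteq> j"
    define u where "u = (\<lambda>k. if k = i then 1 else if k = j then -1 else (0::'a))"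
    have "(\<Sum>k\<in>E. scale (u k) (x k)) = (\<Sum>k\<in>{i,j}. scale (u k) (x k))"
      by (rule sum.mono_neutral_right) (use assms ij in \<open>auto simp: u_def\<close>)
    also have "\<dots> = 0" using ij by (simp add: u_def)
    finally have "\<forall>k\<in>E. u k = 0" by (rule ind)
    from bspec[OF this ij(1)] show False by (simp add: u_def)
  qed
  show "independent (x ` E)"
  proof
    assume "dependent (x ` E)"
    then obtain u where u: "\<exists>v\<in>x ` E. u v \<noteq> 0" "(\<Sum>v\<in>x ` E. scale (u v) v) = 0"
      unfolding dependent_finite[OF finite_imageI[OF assms(1)]] by blast
    have "(\<Sum>i\<in>E. scale (u (x i)) (x i)) = 0" using u(2) by (simp add: sum.reindex[OF inj] o_def)
    then show False using ind[of "\<lambda>i. u (x i)"] u(1) by blast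
  qed
qed

lemma family_card_le:
  fixes x :: "'i \<Rightarrow> complex^'n"
  assumes "finite E" and ind: "\<And>u. (\<Sum>i\<in>E. u i *s x i) = 0 \<Longrightarrow> \<forall>i\<in>E. u i = 0"
  shows "card E \<le> CARD('n)"
proof -
  note f = vec.family_independent[of E x, OF assms(1) ind]
  have "card E = card (x ` E)" using f(1) by (simp add: card_image)
  also have "\<dots> = vec.dim (x ` E)" using f(2) by (simp add: vec.dim_eq_card_independent)
  also have "\<dots> \<le> CARD('n)" by (rule dim_subset_UNIV_cart_gen)
  finally show ?thesis .
qed

text \<open>A maximal minor of the vectors \<open>x k\<close> with \<open>k \<in> J\<close>, realized as a full determinant by filling
the other rows with standard basis vectors. So all minors are indexed by the functions \<open>s\<close>, and the
determinant has the fixed size \<open>CARD('n)\<close>.\<close>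
definition minor :: "'n set \<Rightarrow> ('n \<Rightarrow> complex^'n) \<Rightarrow> ('n \<Rightarrow> 'n) \<Rightarrow> complex" where
  "minor J x s = det (\<chi> k. if k \<in> J then x k else axis (s k) 1)"

lemma det_rows_independent:
  fixes x :: "'n \<Rightarrow> complex^'n"
  shows "det (\<chi> k. x k) \<noteq> 0 \<longleftrightarrow> (\<forall>u. (\<Sum>k\<in>UNIV. u k *s x k) = 0 \<longrightarrow> (\<forall>k. u k = 0))"
  using matrix_right_invertible_independent_rows[of "\<chi> k. x k"] invertible_det_nz[of "\<chi> k. x k"]
     invertible_right_inverse[of "\<chi> k. x k"]
  by (simp add: Finite_Cartesian_Product.row_def)

lemma dependent_minor_zero:
  fixes x :: "'n \<Rightarrow> complex^'n"
  assumes "(\<Sum>k\<in>J. u k *s x k) = 0" "k0 \<in> J" "u k0 \<noteq> 0"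
  shows "minor J x s = 0"
proof (rule ccontr)
  assume "minor J x s \<noteq> 0"
  then have ind: "\<And>u. (\<Sum>k\<in>UNIV. u k *s (if k \<in> J then x k else axis (s k) 1)) = 0 \<Longrightarrow> (\<forall>k. u k = 0)"
    unfolding minor_def det_rows_independent by blast
  let ?u = "\<lambda>k. if k \<in> J then u k else 0"
  have "(\<Sum>k\<in>UNIV. ?u k *s (if k \<in> J then x k else axis (s k) 1)) = (\<Sum>k\<in>J. u k *s x k)"
    by (rule sum.mono_neutral_cong_right) auto
  then have "?u k0 = 0" using ind[of ?u] assms(1) by simp
  then show False using assms by simp
qed

text \<open>An independent family can be completed to a basis by standard basis vectors.\<close>
lemma independent_minor_nonzero:
  fixes x :: "'n \<Rightarrow> complex^'n"
  assumes "\<And>u. (\<Sum>k\<in>J. u k *s x k) = 0 \<Longrightarrow> \<forall>k\<in>J. u k = 0"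
  shows "\<exists>s. minor J x s \<noteq> 0"
  using assms
proof (induction "card (- J)" arbitrary: J x)
  case 0
  then have J: "J = UNIV" by auto
  then have "det (\<chi> k. x k) \<noteq> 0" using 0(2) unfolding det_rows_independent by blast
  then show ?case using J by (simp add: minor_def)
next
  case (Suc n)
  then obtain k0 where k0: "k0 \<notin> J" by (metis Compl_UNIV_eq UNIV_eq_I card.empty nat.distinct(1))
  have fJ: "finite J" by simp
  have "\<exists>i. axis i 1 \<notin> vec.span (x ` J)"
  proof (rule ccontr)
    assume "\<not> ?thesis"
    then have "y \<in> vec.span (x ` J)" for y :: "complex^'n"
      using basis_expansion[of y] by (metis (mono_tags, lifting) vec.span_scale vec.span_sum)
    then have "vec.span (x ` J) = UNIV" by blast
    then have "vec.dim (x ` J) = CARD('n)" by (metis vec.dim_span vec_dim_card)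
    moreover have "vec.dim (x ` J) \<le> card J"
      by (meson card_image_le fJ finite_imageI le_trans vec.dim_le_card')
    moreover have "card J < CARD('n)" using k0 by (metis UNIV_I finite_code psubsetI psubset_card_mono subset_UNIV)
    ultimately show False by simp
  qed
  then obtain i where i: "axis i 1 \<notin> vec.span (x ` J)" by blast
  let ?x = "x(k0 := axis i 1)"
  have sumJ: "(\<Sum>k\<in>J. u k *s ?x k) = (\<Sum>k\<in>J. u k *s x k)" for u
    by (rule sum.cong) (use k0 in auto)
  have "\<exists>s. minor (insert k0 J) ?x s \<noteq> 0"
  proof (rule Suc.hyps(1))
    have "- insert k0 J = - J - {k0}" by auto
    then show "n = card (- insert k0 J)" using Suc.hyps(2) k0 by (simp add: card_Diff_singleton)
    fix u assume "(\<Sum>k\<in>insert k0 J. u k *s ?x k) = 0"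
    then have e: "u k0 *s axis i 1 + (\<Sum>k\<in>J. u k *s x k) = 0" using k0 sumJ[of u] by simp
    have "u k0 = 0"
    proof (rule ccontr)
      assume n: "u k0 \<noteq> 0"
      have "(\<Sum>k\<in>J. u k *s x k) \<in> vec.span (x ` J)"
        by (intro vec.span_sum vec.span_scale vec.span_base) auto
      then have "(- 1 / u k0) *s (\<Sum>k\<in>J. u k *s x k) \<in> vec.span (x ` J)" by (rule vec.span_scale)
      moreover have "(\<Sum>k\<in>J. u k *s x k) = - (u k0 *s axis i 1)" using e by (simp add: eq_neg_iff_add_eq_0 add.commute)
      then have "(- 1 / u k0) *s (\<Sum>k\<in>J. u k *s x k) = axis i 1"
        using n by (simp add: vec_eq_iff)
      ultimately show False using i by simp
    qed
    then show "\<forall>k\<in>insert k0 J. u k = 0" using e Suc.prems[of u] by simp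
  qed
  then obtain s where s: "minor (insert k0 J) ?x s \<noteq> 0" by blast
  have "minor (insert k0 J) ?x s = minor J x (s(k0 := i))"
    unfolding minor_def by (rule arg_cong[where f=det]) (use k0 in \<open>auto simp: vec_eq_iff\<close>)
  then show ?case using s by metis
qed

lemma minor_cramer:
  fixes x :: "'n \<Rightarrow> complex^'n"
  assumes "k0 \<in> J" "y = (\<Sum>k\<in>J. u k *s x k)"
  shows "minor J (x(k0 := y)) s = u k0 * minor J x s"
proof -
  let ?A = "\<chi> k. if k \<in> J then x k else axis (s k) 1"
  let ?X = "\<chi> k. if k \<in> J then u k else 0"
  have row: "Finite_Cartesian_Product.row k ?A = (if k \<in> J then x k else axis (s k) 1)" for k
    by (simp add: Finite_Cartesian_Product.row_def)
  have eq: "(\<Sum>i\<in>UNIV. ?X $ i *s Finite_Cartesian_Product.row i ?A) = y"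
    unfolding assms(2) row by (rule sum.mono_neutral_cong_right) auto
  have "det (\<chi> i. if i = k0 then y else Finite_Cartesian_Product.row i ?A) = ?X $ k0 * det ?A"
    unfolding eq[symmetric] by (rule cramer_lemma_transpose)
  then have "det (\<chi> i. if i = k0 then y else Finite_Cartesian_Product.row i ?A) = u k0 * det ?A"
    using assms(1) by simp
  moreover have "(\<chi> i. if i = k0 then y else Finite_Cartesian_Product.row i ?A) = (\<chi> k. if k \<in> J then (x(k0 := y)) k else axis (s k) 1)"
    unfolding row using assms(1) by (auto simp: vec_eq_iff)
  ultimately show ?thesis by (simp add: minor_def)
qed

lemma hs_minor:
  assumes "\<And>k i. k \<in> J \<Longrightarrow> hs (\<lambda>z. x z k $ i) U" "open U"
  shows "hs (\<lambda>z. minor J (x z) s) U"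
proof -
  have "hs (\<lambda>z. (if k \<in> J then x z k else axis (s k) 1) $ i) U" for k i
    using assms by (cases "k \<in> J") auto
  then show ?thesis unfolding minor_def Determinants.det_def
    by (auto intro!: hs_sum hs_mult hs_prod hs_const assms(2))
qed

lemma covector_sum_apply: "(\<Sum>i\<in>E. f i) c = (\<Sum>i\<in>E. f i c)"
  by (induction E rule: infinite_finite_induct) auto

section \<open>Analytic subsets\<close>

lemma analytic_complement_open:
  assumes A: "complex_atlas A" and Z: "analytic_subset A Z"
  shows "open (- Z)"
proof (subst open_subopen, intro ballI)
  fix p assume p: "p \<in> - Z"
  obtain N F where N: "open N" "p \<in> N" "\<forall>f\<in>F. holomorphic_fun A N f" "Z \<inter> N = {q\<in>N. \<forall>f\<in>F. f q = 0}"
    using Z[unfolded analytic_subset_def, rule_format, of p] by blast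
  then obtain f where f: "f \<in> F" "f p \<noteq> 0" using p by blast
  have "open {q\<in>N. f q \<noteq> 0}" by (rule open_nonzero[OF holomorphic_fun_continuous[OF A] N(1)]) (use N f in blast)
  moreover have "{q\<in>N. f q \<noteq> 0} \<subseteq> - Z" using N(4) f by blast
  ultimately show "\<exists>T. open T \<and> p \<in> T \<and> T \<subseteq> - Z" using f N by blast
qed

text \<open>The interior of an analytic set is closed, by the identity theorem in a ball of a chart.\<close>
lemma analytic_complement_dense:
  fixes A :: "('a::{t2_space,second_countable_topology}, 'n::finite) chart set"
  assumes A: "complex_atlas A" and con: "connected (UNIV :: 'a set)" and Z: "analytic_subset A Z" "Z \<noteq> UNIV"
  shows "dense_in (\<lambda>p. p \<notin> Z) UNIV"
proof -
  have "open (- interior Z)"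
  proof (subst open_subopen, intro ballI, rule ccontr)
    fix p assume p: "p \<in> - interior Z" and n: "\<not> (\<exists>T. open T \<and> p \<in> T \<and> T \<subseteq> - interior Z)"
    obtain N F where N: "open N" "p \<in> N" "\<forall>f\<in>F. holomorphic_fun A N f" "Z \<inter> N = {q\<in>N. \<forall>f\<in>F. f q = 0}"
      using Z(1)[unfolded analytic_subset_def, rule_format, of p] by blast
    obtain c where c: "c \<in> A" "p \<in> fst c" using atlas_cover[OF A] by blast
    have ch: "is_chart c" by (rule atlas_chart[OF A c(1)])
    let ?S = "snd c ` (fst c \<inter> N)"
    have "open ?S" "snd c p \<in> ?S" using open_chart_image[OF ch N(1)] c N by auto
    then obtain e where e: "e > 0" "ball (snd c p) e \<subseteq> ?S" using open_contains_ball by blast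
    let ?B = "ball (snd c p) e"
    have inN: "chart_inv c z \<in> fst c \<inter> N" "snd c (chart_inv c z) = z" if "z \<in> ?B" for z
      using chart_inv_in[OF ch subsetD[OF e(2) that]] by blast+
    let ?M = "chart_inv c ` ?B"
    have Mo: "open ?M" by (rule open_chart_inv_image[OF ch open_ball]) (use e(2) in blast)
    have pM: "p \<in> ?M" using e is_chart_simps(5)[OF ch c(2)] by (metis centre_in_ball imageI)
    have "?M \<inter> interior Z \<noteq> {}" using n Mo pM by blast
    moreover have oV: "open (?M \<inter> interior Z)" using Mo by auto
    have VB: "snd c ` (fst c \<inter> (?M \<inter> interior Z)) \<subseteq> ?B" using inN(2) by force
    have "f (chart_inv c z) = 0" if f: "f \<in> F" and z: "z \<in> ?B" for f z
    proof (rule hs_identity[where f="\<lambda>z. f (chart_inv c z)" and U="?B" and V="snd c ` (fst c \<inter> (?M \<inter> interior Z))"])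
      show "hs (\<lambda>z. f (chart_inv c z)) ?B"
        using hs_subset[OF holomorphic_fun_hs[OF A _ c(1)] open_ball e(2), of f] N(3) f by (simp add: o_def)
      show "open (snd c ` (fst c \<inter> (?M \<inter> interior Z)))" by (rule open_chart_image[OF ch oV])
      show "snd c ` (fst c \<inter> (?M \<inter> interior Z)) \<noteq> {}" using \<open>?M \<inter> interior Z \<noteq> {}\<close> inN(1) by blast
      fix w assume "w \<in> snd c ` (fst c \<inter> (?M \<inter> interior Z))"
      then obtain q where q: "q \<in> fst c" "q \<in> ?M" "q \<in> Z" "w = snd c q" using interior_subset by blast
      then have "q \<in> Z \<inter> N" using inN(1) by blast
      then have "f q = 0" using N(4) f by blast
      then show "f (chart_inv c w) = 0" using q is_chart_simps(5)[OF ch] by simp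
    qed (use z VB in auto)
    then have "?M \<subseteq> Z" using N(4) inN(1) by blast
    then have "p \<in> interior Z" using Mo pM by (meson interiorI)
    then show False using p by simp
  qed
  then have "interior Z = {} \<or> - interior Z = {}"
    using connectedD[OF con, of "interior Z" "- interior Z"] by auto
  moreover have "- interior Z \<noteq> {}" using Z(2) interior_subset by blast
  ultimately have "interior Z = {}" by blast
  then show ?thesis unfolding dense_in_def by (metis interior_maximal subsetI subset_empty)
qed

lemma form_nonzero_open:
  assumes A: "complex_atlas A" and \<omega>: "holomorphic_form A W \<omega>"
  shows "open {p\<in>W. \<omega> p \<noteq> 0}"
proof (subst open_subopen, intro ballI)
  fix p assume "p \<in> {p\<in>W. \<omega> p \<noteq> 0}"
  then have p: "p \<in> W" "\<omega> p \<noteq> 0" by auto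
  obtain c where c: "c \<in> A" "p \<in> fst c" using atlas_cover[OF A] by blast
  have "\<omega> p c \<noteq> 0" using cotangent_0_iff[OF form_cotangent[OF \<omega> p(1)] c] p by blast
  then obtain i where i: "\<omega> p c $ i \<noteq> 0" by (auto simp: vec_eq_iff)
  have "open (fst c \<inter> W)" using is_chart_simps(1)[OF atlas_chart[OF A c(1)]] form_open[OF \<omega>] by auto
  then have "open {q\<in>fst c \<inter> W. \<omega> q c $ i \<noteq> 0}"
    by (rule open_nonzero[OF form_coord_continuous[OF A \<omega> c(1)]])
  then show "\<exists>T. open T \<and> p \<in> T \<and> T \<subseteq> {p\<in>W. \<omega> p \<noteq> 0}"
    using p c i by (intro exI[of _ "{q\<in>fst c \<inter> W. \<omega> q c $ i \<noteq> 0}"]) auto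
qed

section \<open>Values of distributions\<close>

text \<open>The value at \<open>p\<close> of some defining form around \<open>p\<close>. It is determined up to a nonzero factor, which does
not affect linear dependence.\<close>
definition rep :: "('a, 'n::finite) distribution \<Rightarrow> 'a \<Rightarrow> ('a, 'n) covector" where
  "rep D p = (SOME \<alpha>. \<exists>W \<omega>. (W, \<omega>) \<in> D \<and> p \<in> W \<and> \<alpha> = \<omega> p)"

lemma
  assumes "D \<in> Distr A"
  shows Distr_cover: "\<exists>W \<omega>. (W, \<omega>) \<in> D \<and> p \<in> W"
    and Distr_defining: "(W, \<omega>) \<in> D \<Longrightarrow> defining_form A W \<omega>"
    and Distr_unit: "(W, \<omega>) \<in> D \<Longrightarrow> (W', \<omega>') \<in> D \<Longrightarrow> equal_up_to_unit A (W \<inter> W') \<omega> \<omega>'"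
    and Distr_maximal: "defining_form A W \<omega> \<Longrightarrow> (\<And>W' \<omega>'. (W', \<omega>') \<in> D \<Longrightarrow> equal_up_to_unit A (W \<inter> W') \<omega> \<omega>') \<Longrightarrow> (W, \<omega>) \<in> D"
proof -
  have D: "\<forall>x\<in>D. defining_form A (fst x) (snd x)" "(\<Union>x\<in>D. fst x) = UNIV"
    "\<forall>x\<in>D. \<forall>y\<in>D. equal_up_to_unit A (fst x \<inter> fst y) (snd x) (snd y)"
    "\<forall>W \<omega>. defining_form A W \<omega> \<and> (\<forall>y\<in>D. equal_up_to_unit A (W \<inter> fst y) \<omega> (snd y)) \<longrightarrow> (W, \<omega>) \<in> D"
    using assms by (simp_all add: Distr_def is_distribution_def split_def)
  have "p \<in> (\<Union>x\<in>D. fst x)" using D(2) by simp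
  then show "\<exists>W \<omega>. (W, \<omega>) \<in> D \<and> p \<in> W" by force
  show "(W, \<omega>) \<in> D \<Longrightarrow> defining_form A W \<omega>" using bspec[OF D(1), of "(W, \<omega>)"] by simp
  show "(W, \<omega>) \<in> D \<Longrightarrow> (W', \<omega>') \<in> D \<Longrightarrow> equal_up_to_unit A (W \<inter> W') \<omega> \<omega>'"
    using bspec[OF bspec[OF D(3), of "(W, \<omega>)"], of "(W', \<omega>')"] by simp
  show "(W, \<omega>) \<in> D" if "defining_form A W \<omega>" "\<And>W' \<omega>'. (W', \<omega>') \<in> D \<Longrightarrow> equal_up_to_unit A (W \<inter> W') \<omega> \<omega>'"
    using D(4)[rule_format, of W \<omega>] that by (metis prod.collapse)
qed

lemma rep_member: "D \<in> Distr A \<Longrightarrow> \<exists>W \<omega>. (W, \<omega>) \<in> D \<and> p \<in> W \<and> rep D p = \<omega> p"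
proof -
  assume "D \<in> Distr A"
  then have "\<exists>\<alpha>. \<exists>W \<omega>. (W, \<omega>) \<in> D \<and> p \<in> W \<and> \<alpha> = \<omega> p" using Distr_cover[of D A p] by blast
  from someI_ex[OF this] show ?thesis unfolding rep_def .
qed

lemma rep_cotangent: "D \<in> Distr A \<Longrightarrow> rep D p \<in> cotangent_space A p"
proof -
  assume D: "D \<in> Distr A"
  obtain W \<omega> where W: "(W, \<omega>) \<in> D" "p \<in> W" "rep D p = \<omega> p" using rep_member[OF D] by blast
  then show ?thesis using form_cotangent[OF defining_form_form[OF Distr_defining[OF D W(1)]] W(2)] by simp
qed

lemma rep_unit:
  assumes "D \<in> Distr A" "(W, \<omega>) \<in> D" "p \<in> W"
  shows "\<exists>k. k \<noteq> 0 \<and> \<omega> p = covector_scale k (rep D p)"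
proof -
  obtain W' \<omega>' where W': "(W', \<omega>') \<in> D" "p \<in> W'" "rep D p = \<omega>' p" using rep_member[OF assms(1)] by blast
  then show ?thesis using Distr_unit[OF assms(1,2) W'(1)] assms(3) unfolding equal_up_to_unit_def by auto
qed

definition dependent_at :: "('a, 'n::finite) distribution set \<Rightarrow> 'a \<Rightarrow> bool" where
  "dependent_at E p \<longleftrightarrow> (\<exists>u. (\<exists>D\<in>E. u D \<noteq> 0) \<and> (\<Sum>D\<in>E. covector_scale (u D) (rep D p)) = 0)"

lemma dependent_at_forms:
  assumes A: "complex_atlas A" and E: "finite E" "E \<subseteq> Distr A"
    and \<omega>: "\<And>D. D \<in> E \<Longrightarrow> (W D, \<omega> D) \<in> D" "\<And>D. D \<in> E \<Longrightarrow> p \<in> W D" and c: "c \<in> A" "p \<in> fst c"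
  shows "dependent_at E p \<longleftrightarrow> (\<exists>u. (\<exists>D\<in>E. u D \<noteq> 0) \<and> (\<Sum>D\<in>E. u D *s \<omega> D p c) = 0)"
proof -
  have "\<forall>D\<in>E. \<exists>k. k \<noteq> 0 \<and> \<omega> D p = covector_scale k (rep D p)"
    using rep_unit \<omega> E by blast
  then obtain k where k: "\<And>D. D \<in> E \<Longrightarrow> k D \<noteq> 0" "\<And>D. D \<in> E \<Longrightarrow> \<omega> D p = covector_scale (k D) (rep D p)" by metis
  have iff: "(\<Sum>D\<in>E. covector_scale (u D) (rep D p)) = 0 \<longleftrightarrow> (\<Sum>D\<in>E. u D *s rep D p c) = 0" for u
  proof -
    have "(\<Sum>D\<in>E. covector_scale (u D) (rep D p)) \<in> cotangent_space A p"
      by (rule covector.subspace_sum[OF cotangent_subspace]) (use E rep_cotangent cotangent_scale in blast)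
    from cotangent_0_iff[OF this c] show ?thesis by (simp add: covector_sum_apply covector_scale_def)
  qed
  show ?thesis
  proof
    assume "dependent_at E p"
    then obtain u where u: "\<exists>D\<in>E. u D \<noteq> 0" "(\<Sum>D\<in>E. u D *s rep D p c) = 0" unfolding dependent_at_def iff by blast
    have "(\<Sum>D\<in>E. (u D / k D) *s \<omega> D p c) = (\<Sum>D\<in>E. u D *s rep D p c)"
      by (rule sum.cong) (use k in \<open>auto simp: covector_scale_def\<close>)
    then have "(\<exists>D\<in>E. u D / k D \<noteq> 0) \<and> (\<Sum>D\<in>E. (u D / k D) *s \<omega> D p c) = 0" using u k(1) by auto
    then show "\<exists>u. (\<exists>D\<in>E. u D \<noteq> 0) \<and> (\<Sum>D\<in>E. u D *s \<omega> D p c) = 0" by (intro exI[of _ "\<lambda>D. u D / k D"]) simp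
  next
    assume "\<exists>u. (\<exists>D\<in>E. u D \<noteq> 0) \<and> (\<Sum>D\<in>E. u D *s \<omega> D p c) = 0"
    then obtain u where u: "\<exists>D\<in>E. u D \<noteq> 0" "(\<Sum>D\<in>E. u D *s \<omega> D p c) = 0" by blast
    have "(\<Sum>D\<in>E. (u D * k D) *s rep D p c) = (\<Sum>D\<in>E. u D *s \<omega> D p c)"
      by (rule sum.cong) (use k in \<open>auto simp: covector_scale_def\<close>)
    then have "(\<exists>D\<in>E. u D * k D \<noteq> 0) \<and> (\<Sum>D\<in>E. (u D * k D) *s rep D p c) = 0" using u k(1) by auto
    then show "dependent_at E p" unfolding dependent_at_def iff by (intro exI[of _ "\<lambda>D. u D * k D"]) simp
  qed
qed

lemma independent_at_card:
  fixes E :: "('a::{t2_space,second_countable_topology}, 'n::finite) distribution set"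
  assumes A: "complex_atlas A" and E: "finite E" "E \<subseteq> Distr A" and ind: "\<not> dependent_at E p"
  shows "card E \<le> CARD('n)"
proof -
  obtain c where c: "c \<in> A" "p \<in> fst c" using atlas_cover[OF A] by blast
  have "\<forall>D\<in>E. \<exists>W \<omega>. (W, \<omega>) \<in> D \<and> p \<in> W" using Distr_cover E(2) by blast
  then obtain W \<omega> where \<omega>: "\<And>D. D \<in> E \<Longrightarrow> (W D, \<omega> D) \<in> D" "\<And>D. D \<in> E \<Longrightarrow> p \<in> W D" by metis
  show ?thesis
    by (rule family_card_le[OF E(1), of "\<lambda>D. \<omega> D p c"])
       (use ind dependent_at_forms[OF A E \<omega> c] in blast)
qed

lemma dependent_minors:
  fixes E :: "'d set" and x :: "'d \<Rightarrow> complex^'n"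
  assumes \<iota>: "inj_on \<iota> E"
  shows "(\<exists>u. (\<exists>D\<in>E. u D \<noteq> 0) \<and> (\<Sum>D\<in>E. u D *s x D) = 0) \<longleftrightarrow> (\<forall>s. minor (\<iota> ` E) (\<lambda>k. x (inv_into E \<iota> k)) s = 0)"
proof
  assume "\<exists>u. (\<exists>D\<in>E. u D \<noteq> 0) \<and> (\<Sum>D\<in>E. u D *s x D) = 0"
  then obtain u D where u: "D \<in> E" "u D \<noteq> 0" "(\<Sum>D\<in>E. u D *s x D) = 0" by blast
  have "(\<Sum>k\<in>\<iota> ` E. u (inv_into E \<iota> k) *s x (inv_into E \<iota> k)) = 0"
    using u(3) \<iota> by (simp add: sum.reindex)
  then show "\<forall>s. minor (\<iota> ` E) (\<lambda>k. x (inv_into E \<iota> k)) s = 0"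
    using dependent_minor_zero[of "\<lambda>k. u (inv_into E \<iota> k)" "\<lambda>k. x (inv_into E \<iota> k)" "\<iota> ` E" "\<iota> D"] u(1,2) \<iota> by simp
next
  assume z: "\<forall>s. minor (\<iota> ` E) (\<lambda>k. x (inv_into E \<iota> k)) s = 0"
  show "\<exists>u. (\<exists>D\<in>E. u D \<noteq> 0) \<and> (\<Sum>D\<in>E. u D *s x D) = 0"
  proof (rule ccontr)
    assume n: "\<not> ?thesis"
    have "\<exists>s. minor (\<iota> ` E) (\<lambda>k. x (inv_into E \<iota> k)) s \<noteq> 0"
    proof (rule independent_minor_nonzero)
      fix u assume "(\<Sum>k\<in>\<iota> ` E. u k *s x (inv_into E \<iota> k)) = 0"
      then have e: "(\<Sum>D\<in>E. u (\<iota> D) *s x D) = 0" using \<iota> by (simp add: sum.reindex)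
      show "\<forall>k\<in>\<iota> ` E. u k = 0"
      proof (rule ccontr)
        assume "\<not> ?thesis"
        then have "(\<exists>D\<in>E. u (\<iota> D) \<noteq> 0) \<and> (\<Sum>D\<in>E. u (\<iota> D) *s x D) = 0" using e by auto
        then have "\<exists>u. (\<exists>D\<in>E. u D \<noteq> 0) \<and> (\<Sum>D\<in>E. u D *s x D) = 0" by (rule exI[of _ "\<lambda>D. u (\<iota> D)"])
        then show False using n by contradiction
      qed
    qed
    then show False using z by blast
  qed
qed

lemma dependent_at_analytic:
  fixes A :: "('a::{t2_space,second_countable_topology}, 'n::finite) chart set"
  assumes A: "complex_atlas A" and E: "finite E" "E \<subseteq> Distr A" and card: "card E \<le> CARD('n)"
  shows "analytic_subset A {p. dependent_at E p}"
  unfolding analytic_subset_def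
proof
  fix p
  obtain c where c: "c \<in> A" "p \<in> fst c" using atlas_cover[OF A] by blast
  have ch: "is_chart c" by (rule atlas_chart[OF A c(1)])
  have "\<forall>D\<in>E. \<exists>W \<omega>. (W, \<omega>) \<in> D \<and> p \<in> W" using Distr_cover E(2) by blast
  then obtain W \<omega> where \<omega>: "\<And>D. D \<in> E \<Longrightarrow> (W D, \<omega> D) \<in> D" "\<And>D. D \<in> E \<Longrightarrow> p \<in> W D" by metis
  have form: "holomorphic_form A (W D) (\<omega> D)" if "D \<in> E" for D
    using defining_form_form[OF Distr_defining] \<omega>(1) E(2) that by blast
  obtain \<iota> :: "('a, 'n) distribution \<Rightarrow> 'n" where \<iota>: "inj_on \<iota> E"
    using card_le_inj[OF E(1) finite_class.finite_UNIV card] by blast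
  define N where "N = fst c \<inter> (\<Inter>D\<in>E. W D)"
  have No: "open N" unfolding N_def
    by (intro open_Int is_chart_simps(1)[OF ch] open_INT E(1)) (use form_open[OF form] in blast)
  define f where "f = (\<lambda>s q. minor (\<iota> ` E) (\<lambda>k. \<omega> (inv_into E \<iota> k) q c) s)"
  have hf: "holomorphic_fun A N (f s)" for s
  proof (rule holomorphic_fun_chart[OF A c(1) No])
    have So: "open (snd c ` N)" using open_chart_image[OF ch No] by (simp add: N_def Int_absorb1)
    show "hs (f s \<circ> chart_inv c) (snd c ` N)"
      unfolding f_def o_def
    proof (rule hs_minor[OF _ So])
      fix k i assume k: "k \<in> \<iota> ` E"
      then have D: "inv_into E \<iota> k \<in> E" by (rule inv_into_into)
      show "hs (\<lambda>z. \<omega> (inv_into E \<iota> k) (chart_inv c z) c $ i) (snd c ` N)"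
        by (rule hs_subset[OF form_hs[OF form[OF D] c(1)] So]) (use D in \<open>auto simp: N_def\<close>)
    qed
  qed (simp add: N_def)
  have "dependent_at E q \<longleftrightarrow> (\<forall>s. f s q = 0)" if q: "q \<in> N" for q
  proof -
    have "dependent_at E q \<longleftrightarrow> (\<exists>u. (\<exists>D\<in>E. u D \<noteq> 0) \<and> (\<Sum>D\<in>E. u D *s \<omega> D q c) = 0)"
      by (rule dependent_at_forms[OF A E \<omega>(1) _ c(1)]) (use q in \<open>auto simp: N_def\<close>)
    also have "\<dots> \<longleftrightarrow> (\<forall>s. f s q = 0)"
      unfolding f_def by (rule dependent_minors[OF \<iota>])
    finally show ?thesis .
  qed
  then have "{p. dependent_at E p} \<inter> N = {q\<in>N. \<forall>g\<in>range f. g q = 0}" by auto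
  moreover have "p \<in> N" using c \<omega>(2) by (simp add: N_def)
  moreover have "finite (range f)" by simp
  ultimately show "\<exists>N F. open N \<and> p \<in> N \<and> finite F \<and> (\<forall>f\<in>F. holomorphic_fun A N f) \<and>
      {p. dependent_at E p} \<inter> N = {q\<in>N. \<forall>f\<in>F. f q = 0}"
    using No hf by (intro exI[of _ N] exI[of _ "range f"]) auto
qed

section \<open>Pencils of distributions\<close>
lemma par_scale_both:
  assumes "par \<alpha> \<beta>" "k \<noteq> 0" "l \<noteq> 0"
  shows "par (covector_scale k \<alpha>) (covector_scale l \<beta>)"
proof -
  obtain u v where uv: "u \<noteq> 0 \<or> v \<noteq> 0" "covector_scale u \<alpha> = covector_scale v \<beta>"
    using assms(1) unfolding par_def by blast
  show ?thesis unfolding par_def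
    by (rule exI[of _ "u / k"], rule exI[of _ "v / l"]) (use uv assms in \<open>auto simp: scale_scale\<close>)
qed

lemma dependent_pair_par:
  assumes "dependent_at {D, D'} p" "D \<noteq> D'"
  shows "par (rep D p) (rep D' p)"
proof -
  obtain u where u: "u D \<noteq> 0 \<or> u D' \<noteq> 0" "covector_scale (u D) (rep D p) + covector_scale (u D') (rep D' p) = 0"
    using assms unfolding dependent_at_def by auto
  have "covector_scale (u D) (rep D p) = covector_scale (- u D') (rep D' p)"
    using u(2) by (simp add: eq_neg_iff_add_eq_0)
  then show ?thesis unfolding par_def using u(1) by (metis neg_equal_0_iff_equal)
qed

lemma distribution_subset_of_dependent:
  assumes A: "complex_atlas A" and D: "D \<in> Distr A" "D' \<in> Distr A" "D \<noteq> D'" and dep: "\<And>p. dependent_at {D, D'} p"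
  shows "D \<subseteq> D'"
proof
  fix x assume x: "x \<in> D"
  obtain W \<omega> where x': "x = (W, \<omega>)" by (cases x)
  have m: "(W, \<omega>) \<in> D" using x x' by simp
  have "(W, \<omega>) \<in> D'"
  proof (rule Distr_maximal[OF D(2) Distr_defining[OF D(1) m]])
    fix W' \<omega>' assume m': "(W', \<omega>') \<in> D'"
    show "equal_up_to_unit A (W \<inter> W') \<omega> \<omega>'"
    proof (rule equal_up_to_unit_of_par[OF A Distr_defining[OF D(1) m] Distr_defining[OF D(2) m']])
      fix p assume p: "p \<in> W \<inter> W'"
      obtain k where k: "k \<noteq> 0" "\<omega> p = covector_scale k (rep D p)" using rep_unit[OF D(1) m, of p] p by auto
      obtain l where l: "l \<noteq> 0" "\<omega>' p = covector_scale l (rep D' p)" using rep_unit[OF D(2) m', of p] p by auto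
      show "par (\<omega> p) (\<omega>' p)"
        unfolding k(2) l(2) by (rule par_scale_both[OF dependent_pair_par[OF dep D(3)] k(1) l(1)])
    qed
  qed
  then show "x \<in> D'" using x' by simp
qed

text \<open>Forms that are everywhere proportional agree up to a unit, and by maximality the two distributions have the
same defining forms.\<close>
lemma distinct_generic_independent:
  assumes A: "complex_atlas A" and D: "D \<in> Distr A" "D' \<in> Distr A" "D \<noteq> D'"
  shows "\<exists>p. \<not> dependent_at {D, D'} p"
proof (rule ccontr)
  assume n: "\<not> ?thesis"
  then have "D \<subseteq> D'" by (intro distribution_subset_of_dependent[OF A D]) auto
  moreover have "D' \<subseteq> D" using n D by (intro distribution_subset_of_dependent[OF A]) (auto simp: insert_commute)
  ultimately show False using D(3) by blast
qed

lemma single_generic_independent: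
  fixes A :: "('a::{t2_space,second_countable_topology}, 'n::finite) chart set"
  assumes A: "complex_atlas A" and D: "D \<in> Distr A"
  shows "\<exists>p. \<not> dependent_at {D} p"
proof -
  obtain W \<omega> where m: "(W, \<omega>) \<in> D" "undefined \<in> W" using Distr_cover[OF D] by blast
  note def = Distr_defining[OF D m(1)]
  obtain p where p: "p \<in> W" "\<omega> p \<noteq> 0"
    using dense_inD[OF defining_form_dense[OF A def] form_open[OF defining_form_form[OF def]] subset_refl m(2)] by blast
  obtain k where "\<omega> p = covector_scale k (rep D p)" using rep_unit[OF D m(1) p(1)] by blast
  then have "rep D p \<noteq> 0" using p(2) by auto
  then have "\<not> dependent_at {D} p" unfolding dependent_at_def by simp
  then show ?thesis by blast
qed

lemma form_combination:
  assumes A: "complex_atlas A" and \<omega>: "holomorphic_form A N \<omega>" "holomorphic_form A N \<omega>'"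
    and f: "holomorphic_fun A N f" "holomorphic_fun A N g"
  shows "holomorphic_form A N (\<lambda>q. covector_scale (f q) (\<omega> q) + covector_scale (g q) (\<omega>' q))"
  unfolding holomorphic_form_def
proof (intro conjI ballI)
  show "open N" using form_open[OF \<omega>(1)] .
  show "covector_scale (f p) (\<omega> p) + covector_scale (g p) (\<omega>' p) \<in> cotangent_space A p" if "p \<in> N" for p
    by (intro covector.subspace_add[OF cotangent_subspace] cotangent_scale form_cotangent[OF \<omega>(1)] form_cotangent[OF \<omega>(2)] that)
  fix c assume c: "c \<in> A"
  show "hsm (\<lambda>z. (covector_scale (f (chart_inv c z)) (\<omega> (chart_inv c z)) + covector_scale (g (chart_inv c z)) (\<omega>' (chart_inv c z))) c) (snd c ` (fst c \<inter> N))"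
    unfolding holomorphic_several_map_def
  proof
    fix i
    have "hs (\<lambda>z. f (chart_inv c z) * \<omega> (chart_inv c z) c $ i + g (chart_inv c z) * \<omega>' (chart_inv c z) c $ i) (snd c ` (fst c \<inter> N))"
      using holomorphic_fun_hs[OF A f(1) c] holomorphic_fun_hs[OF A f(2) c] form_hs[OF \<omega>(1) c] form_hs[OF \<omega>(2) c]
      unfolding o_def by (intro hs_add hs_mult)
    then show "hs (\<lambda>z. (covector_scale (f (chart_inv c z)) (\<omega> (chart_inv c z)) + covector_scale (g (chart_inv c z)) (\<omega>' (chart_inv c z))) c $ i) (snd c ` (fst c \<inter> N))"
      by (simp add: covector_scale_def)
  qed
qed

lemma dependent_at_proper:
  fixes A :: "('a::{t2_space,second_countable_topology}, 'n::finite) chart set"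
  assumes A: "complex_atlas A" and con: "connected (UNIV :: 'a set)" and E: "finite E" "E \<subseteq> Distr A"
    and ex: "\<exists>p. \<not> dependent_at E p"
  shows "open {p. \<not> dependent_at E p}" "dense_in (\<lambda>p. \<not> dependent_at E p) UNIV"
proof -
  obtain p where p: "\<not> dependent_at E p" using ex by blast
  have an: "analytic_subset A {p. dependent_at E p}"
    by (rule dependent_at_analytic[OF A E independent_at_card[OF A E p]])
  have "- {p. dependent_at E p} = {p. \<not> dependent_at E p}" by auto
  then show "open {p. \<not> dependent_at E p}" using analytic_complement_open[OF A an] by simp
  have "{p. dependent_at E p} \<noteq> UNIV" using p by blast
  from analytic_complement_dense[OF A con an this] show "dense_in (\<lambda>p. \<not> dependent_at E p) UNIV" by simp
qed

text \<open>The heart of the proof. On the dense open set \<open>G\<close> there is a unique relation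
\<open>rep D0 q = (\<Sum>D\<in>E - {D0}. u D * rep D q)\<close>, and \<open>u D1\<close> is not zero in it. For \<open>t \<in> \<complex>\<close> the line
\<open>L t q\<close> spanned by \<open>rep D0 q + t * u D1 * rep D1 q\<close> does not depend on the choice of the representatives. These
lines are the conormal directions of a distribution \<open>T t\<close>, and they are different for different \<open>t\<close>.\<close>
lemma minimal_relation_infinite:
  fixes A :: "('a::{t2_space,second_countable_topology}, 'n::finite) chart set"
  assumes A: "complex_atlas A" and con: "connected (UNIV :: 'a set)" and E: "finite E" "E \<subseteq> Distr A"
    and dep: "\<And>p. dependent_at E p" and D01: "D0 \<in> E" "D1 \<in> E" "D0 \<noteq> D1"
    and i0: "\<exists>p. \<not> dependent_at (E - {D0}) p" and i1: "\<exists>p. \<not> dependent_at (E - {D1}) p"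
    and i2: "\<exists>p. \<not> dependent_at {D0, D1} p"
  shows "infinite (Distr A)"
proof -
  define B where "B = E - {D0}"
  have B: "finite B" "B \<subseteq> Distr A" "D1 \<in> B" "D0 \<notin> B" "E = insert D0 B" using E D01 by (auto simp: B_def)
  define P where "P = (\<lambda>p. \<not> dependent_at B p \<and> \<not> dependent_at (E - {D1}) p \<and> \<not> dependent_at {D0, D1} p)"
  define G where "G = {p. P p}"
  have E1: "finite (E - {D1})" "E - {D1} \<subseteq> Distr A" and E2: "finite {D0, D1}" "{D0, D1} \<subseteq> Distr A" using E D01 by auto
  note p0 = dependent_at_proper[OF A con B(1,2) i0[folded B_def]]
  note p1 = dependent_at_proper[OF A con E1 i1]
  note p2 = dependent_at_proper[OF A con E2 i2]
  have Go: "open G"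
  proof -
    have "G = {p. \<not> dependent_at B p} \<inter> ({p. \<not> dependent_at (E - {D1}) p} \<inter> {p. \<not> dependent_at {D0, D1} p})"
      by (auto simp: G_def P_def)
    then show ?thesis using p0(1) p1(1) p2(1) by auto
  qed
  have dense: "dense_in P UNIV"
    unfolding P_def
    by (intro dense_in_conj p0(2) p1(2) p2(2)) (simp_all add: p0(1) p1(1))
  have rc: "rep D p \<in> cotangent_space A p" if "D \<in> E" for D p using rep_cotangent E(2) that by blast
  have coeff_ex: "\<exists>u. rep D0 q = (\<Sum>D\<in>B. covector_scale (u D) (rep D q))" if "q \<in> G" for q
  proof -
    obtain v where v: "\<exists>D\<in>E. v D \<noteq> 0" "(\<Sum>D\<in>E. covector_scale (v D) (rep D q)) = 0" using dep[of q] unfolding dependent_at_def by blast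
    have s: "covector_scale (v D0) (rep D0 q) + (\<Sum>D\<in>B. covector_scale (v D) (rep D q)) = 0"
      using v(2) B by simp
    have "v D0 \<noteq> 0"
    proof
      assume z: "v D0 = 0"
      then have "dependent_at B q" using s v(1) B(5) unfolding dependent_at_def by (intro exI[of _ v]) auto
      then show False using that by (simp add: G_def P_def)
    qed
    have "rep D0 q = covector_scale (1 / v D0) (covector_scale (v D0) (rep D0 q))" using \<open>v D0 \<noteq> 0\<close> by (simp add: scale_scale)
    also have "covector_scale (v D0) (rep D0 q) = - (\<Sum>D\<in>B. covector_scale (v D) (rep D q))"
      using s by (simp add: eq_neg_iff_add_eq_0)
    also have "covector_scale (1 / v D0) (- (\<Sum>D\<in>B. covector_scale (v D) (rep D q))) = (\<Sum>D\<in>B. covector_scale (- v D / v D0) (rep D q))"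
      by (simp add: covector.scale_sum_right scale_scale sum_negf)
    finally show ?thesis by (intro exI[of _ "\<lambda>D. - v D / v D0"]) simp
  qed
  have coeff_unique: "u D = u' D"
    if q: "q \<in> G" and "rep D0 q = (\<Sum>D\<in>B. covector_scale (u D) (rep D q))" "rep D0 q = (\<Sum>D\<in>B. covector_scale (u' D) (rep D q))" and D: "D \<in> B" for q u u' D
  proof (rule ccontr)
    assume ne: "u D \<noteq> u' D"
    have "(\<Sum>D\<in>B. covector_scale (u D - u' D) (rep D q)) = 0"
      using that(2,3) by (simp add: covector.scale_left_diff_distrib sum_subtractf)
    then have "dependent_at B q" unfolding dependent_at_def using ne D by (intro exI[of _ "\<lambda>D. u D - u' D"]) auto
    then show False using q by (simp add: G_def P_def)
  qed
  have indep2: "x = 0 \<and> y = 0" if q: "q \<in> G" and s: "covector_scale x (rep D0 q) + covector_scale y (rep D1 q) = 0" for q x y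
  proof (rule ccontr)
    assume n: "\<not> ?thesis"
    let ?u = "\<lambda>D. if D = D0 then x else y"
    have "(\<Sum>D\<in>{D0, D1}. covector_scale (?u D) (rep D q)) = 0" using s D01(3) by simp
    moreover have "\<exists>D\<in>{D0, D1}. ?u D \<noteq> 0" using n D01(3) by auto
    ultimately have "dependent_at {D0, D1} q" unfolding dependent_at_def by (intro exI[of _ ?u]) simp
    then show False using q by (simp add: G_def P_def)
  qed
  \<comment> \<open>otherwise \<open>E - {D1}\<close> would be dependent at \<open>q\<close>\<close>
  have coeff_nz: "u D1 \<noteq> 0" if q: "q \<in> G" and u: "rep D0 q = (\<Sum>D\<in>B. covector_scale (u D) (rep D q))" for q u
  proof
    assume z: "u D1 = 0"
    let ?v = "\<lambda>D. if D = D0 then -1 else u D"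
    have "E - {D1} = insert D0 (B - {D1})" using B D01 by auto
    then have "(\<Sum>D\<in>E - {D1}. covector_scale (?v D) (rep D q)) = - rep D0 q + (\<Sum>D\<in>B - {D1}. covector_scale (?v D) (rep D q))"
      using B by simp
    also have "(\<Sum>D\<in>B - {D1}. covector_scale (?v D) (rep D q)) = (\<Sum>D\<in>B - {D1}. covector_scale (u D) (rep D q))"
      by (rule sum.cong) (use B in auto)
    also have "\<dots> = (\<Sum>D\<in>B. covector_scale (u D) (rep D q))"
      using sum.remove[OF B(1,3), of "\<lambda>D. covector_scale (u D) (rep D q)"] z by simp
    finally have "(\<Sum>D\<in>E - {D1}. covector_scale (?v D) (rep D q)) = 0" by (simp only: u[symmetric] left_minus)
    moreover have "\<exists>D\<in>E - {D1}. ?v D \<noteq> 0" using D01 by (intro bexI[of _ D0]) auto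
    ultimately have "dependent_at (E - {D1}) q" unfolding dependent_at_def by (intro exI[of _ ?v] conjI)
    then show False using q by (simp add: G_def P_def)
  qed
  define L where "L = (\<lambda>t q. {\<alpha>. \<exists>u k. rep D0 q = (\<Sum>D\<in>B. covector_scale (u D) (rep D q)) \<and>
      \<alpha> = covector_scale k (rep D0 q + covector_scale (t * u D1) (rep D1 q))})"
  have Lnz: "rep D0 q + covector_scale a (rep D1 q) \<noteq> 0" if "q \<in> G" for q a
  proof
    assume "rep D0 q + covector_scale a (rep D1 q) = 0"
    then have "covector_scale 1 (rep D0 q) + covector_scale a (rep D1 q) = 0" by simp
    from indep2[OF that this] show False by simp
  qed
  have Lpar: "par \<alpha> \<beta>" if q: "q \<in> G" and ab: "\<alpha> \<in> L t q" "\<beta> \<in> L t q" for q t \<alpha> \<beta>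
  proof -
    obtain u k where u: "rep D0 q = (\<Sum>D\<in>B. covector_scale (u D) (rep D q))" "\<alpha> = covector_scale k (rep D0 q + covector_scale (t * u D1) (rep D1 q))"
      using ab(1) unfolding L_def by blast
    obtain u' k' where u': "rep D0 q = (\<Sum>D\<in>B. covector_scale (u' D) (rep D q))" "\<beta> = covector_scale k' (rep D0 q + covector_scale (t * u' D1) (rep D1 q))"
      using ab(2) unfolding L_def by blast
    have e: "u' D1 = u D1" by (rule coeff_unique[OF q u'(1) u(1) B(3)])
    show ?thesis unfolding u(2) u'(2) e
      by (rule par_trans[OF par_scale par_sym[OF par_scale] Lnz[OF q]])
  qed
  have Ldiff: "t = t'" if q: "q \<in> G" and a: "\<alpha> \<in> L t q" "\<beta> \<in> L t' q" "\<alpha> \<noteq> 0" "\<beta> \<noteq> 0" "par \<alpha> \<beta>" for q t t' \<alpha> \<beta>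
  proof (rule ccontr)
    assume tt: "t \<noteq> t'"
    obtain u k where u: "rep D0 q = (\<Sum>D\<in>B. covector_scale (u D) (rep D q))" "\<alpha> = covector_scale k (rep D0 q + covector_scale (t * u D1) (rep D1 q))"
      using a(1) unfolding L_def by blast
    obtain u' k' where u': "rep D0 q = (\<Sum>D\<in>B. covector_scale (u' D) (rep D q))" "\<beta> = covector_scale k' (rep D0 q + covector_scale (t' * u' D1) (rep D1 q))"
      using a(2) unfolding L_def by blast
    have e: "u' D1 = u D1" by (rule coeff_unique[OF q u'(1) u(1) B(3)])
    have kk: "k \<noteq> 0" "k' \<noteq> 0" using a(3,4) u(2) u'(2) by auto
    obtain x y where xy: "x \<noteq> 0 \<or> y \<noteq> 0" "covector_scale x \<alpha> = covector_scale y \<beta>" using a(5) unfolding par_def by blast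
    have "covector_scale (x * k - y * k') (rep D0 q) + covector_scale ((x * k * t - y * k' * t') * u D1) (rep D1 q) =
       covector_scale x \<alpha> - covector_scale y \<beta>"
      unfolding u(2) u'(2) e
      by (simp add: covector.scale_right_distrib covector.scale_left_diff_distrib scale_scale algebra_simps)
    then have z: "x * k - y * k' = 0 \<and> (x * k * t - y * k' * t') * u D1 = 0" by (intro indep2[OF q]) (simp add: xy(2))
    then have "x * k * t - y * k' * t' = 0" "x * k = y * k'" using coeff_nz[OF q u(1)] by auto
    moreover have "x * k * (t - t') = x * k * t - x * k * t'" by (simp only: right_diff_distrib)
    ultimately have "x * k * (t - t') = 0" by simp
    then have "x = 0" using tt kk by simp
    moreover have "x * k = y * k'" using z by simp
    ultimately have "y = 0" using kk by simp
    then show False using xy(1) \<open>x = 0\<close> by simp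
  qed
  define H where "H = (\<lambda>t. {(N, \<eta>). holomorphic_form A N \<eta> \<and> dense_in (\<lambda>q. \<eta> q \<noteq> 0) N \<and> (\<forall>q\<in>N \<inter> G. \<eta> q \<in> L t q)})"
  have H: "(N, \<eta>) \<in> H t \<longleftrightarrow> holomorphic_form A N \<eta> \<and> dense_in (\<lambda>q. \<eta> q \<noteq> 0) N \<and> (\<forall>q\<in>N \<inter> G. \<eta> q \<in> L t q)" for N \<eta> t
    by (simp add: H_def)
  have cover: "\<exists>N \<eta>. (N, \<eta>) \<in> H t \<and> p \<in> N" for t p
  proof -
    obtain c where c: "c \<in> A" "p \<in> fst c" using atlas_cover[OF A] by blast
    have ch: "is_chart c" by (rule atlas_chart[OF A c(1)])
    have "\<forall>D\<in>E. \<exists>W \<omega>. (W, \<omega>) \<in> D \<and> p \<in> W" using Distr_cover E(2) by blast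
    then obtain W \<omega> where \<omega>: "\<And>D. D \<in> E \<Longrightarrow> (W D, \<omega> D) \<in> D" "\<And>D. D \<in> E \<Longrightarrow> p \<in> W D" by metis
    have form: "holomorphic_form A (W D) (\<omega> D)" if "D \<in> E" for D
      using defining_form_form[OF Distr_defining] \<omega>(1) E(2) that by blast
    obtain p' where p': "\<not> dependent_at B p'" using i0[folded B_def] by blast
    obtain \<iota> :: "('a, 'n) distribution \<Rightarrow> 'n" where \<iota>: "inj_on \<iota> B"
      using card_le_inj[OF B(1) finite_class.finite_UNIV independent_at_card[OF A B(1,2) p']] by blast
    define N0 where "N0 = fst c \<inter> (\<Inter>D\<in>E. W D)"
    have N0o: "open N0" unfolding N0_def
      by (intro open_Int is_chart_simps(1)[OF ch] open_INT E(1)) (use form_open[OF form] in blast)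
    have "open (snd c ` (fst c \<inter> N0))" "snd c p \<in> snd c ` (fst c \<inter> N0)"
      using open_chart_image[OF ch N0o] c \<omega>(2) by (auto simp: N0_def)
    then obtain e where e: "e > 0" "ball (snd c p) e \<subseteq> snd c ` (fst c \<inter> N0)" using open_contains_ball by blast
    let ?B = "ball (snd c p) e"
    define N where "N = chart_inv c ` ?B"
    have inN: "chart_inv c z \<in> fst c \<inter> N0" "snd c (chart_inv c z) = z" if "z \<in> ?B" for z
      using chart_inv_in[OF ch subsetD[OF e(2) that]] by blast+
    have No: "open N" unfolding N_def by (rule open_chart_inv_image[OF ch open_ball]) (use e(2) in blast)
    have NN0: "N \<subseteq> N0" unfolding N_def using inN(1) by blast
    have Nc: "N \<subseteq> fst c" using NN0 by (auto simp: N0_def)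
    have NW: "N \<subseteq> W D" if "D \<in> E" for D using NN0 that by (auto simp: N0_def)
    have sN: "snd c ` N = ?B" unfolding N_def using inN(2) by (force simp: image_image)
    have pN: "p \<in> N" unfolding N_def using e is_chart_simps(5)[OF ch c(2)] by (metis centre_in_ball imageI)
    have fN: "holomorphic_form A N (\<omega> D)" if "D \<in> E" for D by (rule form_subset[OF A form[OF that] No NW[OF that]])
    have hc: "hs (\<lambda>z. \<omega> D (chart_inv c z) c $ i) ?B" if "D \<in> E" for D i
      using form_hs[OF fN[OF that] c(1), of i] Nc sN by (simp add: Int_absorb1)
    define x where "x = (\<lambda>q k. \<omega> (inv_into B \<iota> k) q c)"
    \<comment> \<open>Cramer's rule: \<open>\<Delta>' / \<Delta>\<close> is the coefficient of \<open>\<omega> D1\<close> in the expansion of \<open>\<omega> D0\<close>, so \<open>\<eta>\<close> spans the pencil line\<close>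
    define \<Delta> where "\<Delta> = (\<lambda>s q. minor (\<iota> ` B) (x q) s)"
    define \<Delta>' where "\<Delta>' = (\<lambda>s q. minor (\<iota> ` B) ((x q)(\<iota> D1 := \<omega> D0 q c)) s)"
    have invB: "inv_into B \<iota> k \<in> E" if "k \<in> \<iota> ` B" for k using inv_into_into[OF that] B(5) by blast
    have h\<Delta>: "hs (\<lambda>z. \<Delta> s (chart_inv c z)) ?B" for s
      unfolding \<Delta>_def by (rule hs_minor) (auto simp: x_def intro: hc invB)
    have h\<Delta>': "hs (\<lambda>z. \<Delta>' s (chart_inv c z)) ?B" for s
      unfolding \<Delta>'_def
    proof (rule hs_minor)
      fix k i assume "k \<in> \<iota> ` B"
      then show "hs (\<lambda>z. ((x (chart_inv c z))(\<iota> D1 := \<omega> D0 (chart_inv c z) c)) k $ i) ?B"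
        by (cases "k = \<iota> D1") (auto simp: x_def intro: hc invB D01)
    qed simp
    have "p \<in> N" by (rule pN)
    then obtain q1 where q1: "q1 \<in> N" "P q1" using dense_inD[OF dense No] by blast
    have "dependent_at B q1 \<longleftrightarrow> (\<exists>u. (\<exists>D\<in>B. u D \<noteq> 0) \<and> (\<Sum>D\<in>B. u D *s \<omega> D q1 c) = 0)"
      by (rule dependent_at_forms[where W=W, OF A B(1,2) _ _ c(1)]) (use \<omega>(1) NW q1(1) Nc B(5) in auto)
    also have "\<dots> \<longleftrightarrow> (\<forall>s. \<Delta> s q1 = 0)"
      unfolding \<Delta>_def x_def by (rule dependent_minors[OF \<iota>])
    finally have "\<exists>s. \<Delta> s q1 \<noteq> 0" using q1(2) by (simp add: P_def)
    then obtain s where s: "\<Delta> s q1 \<noteq> 0" by blast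
    obtain z1 where z1: "z1 \<in> ?B" "q1 = chart_inv c z1" using q1(1) unfolding N_def by blast
    have "dense_in (\<lambda>z. \<Delta> s (chart_inv c z) \<noteq> 0) ?B"
      by (rule hs_dense[OF h\<Delta> convex_ball z1(1)]) (use s z1 in simp)
    then have \<Delta>dense: "dense_in (\<lambda>q. \<Delta> s q \<noteq> 0) N"
      by (intro dense_in_chart[OF ch Nc]) (simp only: sN)
    have f\<Delta>: "holomorphic_fun A N (\<Delta> s)"
      by (rule holomorphic_fun_chart[OF A c(1) No Nc]) (simp only: sN o_def h\<Delta>)
    have "holomorphic_fun A N (\<lambda>q. t * \<Delta>' s q)"
      by (rule holomorphic_fun_chart[OF A c(1) No Nc]) (simp only: sN o_def hs_mult[OF hs_const[OF open_ball] h\<Delta>'])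
    note form\<eta> = form_combination[OF A fN[OF D01(1)] fN[OF D01(2)] f\<Delta> this]
    define \<eta> where "\<eta> = (\<lambda>q. covector_scale (\<Delta> s q) (\<omega> D0 q) + covector_scale (t * \<Delta>' s q) (\<omega> D1 q))"
    have key: "\<exists>u k. k \<noteq> 0 \<and> rep D0 q = (\<Sum>D\<in>B. covector_scale (u D) (rep D q)) \<and>
        \<eta> q = covector_scale (\<Delta> s q * k) (rep D0 q + covector_scale (t * u D1) (rep D1 q))" if q: "q \<in> N" "q \<in> G" for q
    proof -
      obtain u where u: "rep D0 q = (\<Sum>D\<in>B. covector_scale (u D) (rep D q))" using coeff_ex[OF q(2)] by blast
      have "\<forall>D\<in>E. \<exists>k. k \<noteq> 0 \<and> \<omega> D q = covector_scale k (rep D q)"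
        using rep_unit \<omega>(1) E(2) NW q(1) by blast
      then obtain k where k: "\<And>D. D \<in> E \<Longrightarrow> k D \<noteq> 0" "\<And>D. D \<in> E \<Longrightarrow> \<omega> D q = covector_scale (k D) (rep D q)" by metis
      define v where "v = (\<lambda>\<kappa>. k D0 * u (inv_into B \<iota> \<kappa>) / k (inv_into B \<iota> \<kappa>))"
      have "\<omega> D0 q c = k D0 *s (\<Sum>D\<in>B. u D *s rep D q c)"
        using k(2)[OF D01(1)] u by (simp add: covector_scale_def covector_sum_apply)
      also have "\<dots> = (\<Sum>D\<in>B. (k D0 * u D / k D) *s \<omega> D q c)"
        unfolding vec.scale_sum_right
      proof (rule sum.cong[OF refl])
        fix D assume "D \<in> B"
        then have "k D \<noteq> 0" "\<omega> D q = covector_scale (k D) (rep D q)" using k B(5) by auto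
        then show "k D0 *s (u D *s rep D q c) = (k D0 * u D / k D) *s \<omega> D q c" by (simp add: covector_scale_def)
      qed
      also have "\<dots> = (\<Sum>\<kappa>\<in>\<iota> ` B. v \<kappa> *s x q \<kappa>)"
        using \<iota> by (simp add: sum.reindex v_def x_def)
      finally have "\<Delta>' s q = v (\<iota> D1) * \<Delta> s q"
        unfolding \<Delta>'_def \<Delta>_def by (intro minor_cramer) (use B(3) in auto)
      then have \<Delta>': "\<Delta>' s q = (k D0 * u D1 / k D1) * \<Delta> s q" using \<iota> B(3) by (simp add: v_def)
      have "\<eta> q = covector_scale (\<Delta> s q * k D0) (rep D0 q) + covector_scale (t * \<Delta>' s q * k D1) (rep D1 q)"
        unfolding \<eta>_def k(2)[OF D01(1)] k(2)[OF D01(2)] scale_scale ..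
      also have "t * \<Delta>' s q * k D1 = \<Delta> s q * k D0 * (t * u D1)" unfolding \<Delta>' using k(1)[OF D01(2)] by simp
      finally have "\<eta> q = covector_scale (\<Delta> s q * k D0) (rep D0 q + covector_scale (t * u D1) (rep D1 q))"
        by (simp only: covector.scale_right_distrib scale_scale)
      then show ?thesis using u k(1)[OF D01(1)] by blast
    qed
    have "(N, \<eta>) \<in> H t"
      unfolding H
    proof (intro conjI ballI)
      show "holomorphic_form A N \<eta>" unfolding \<eta>_def by (rule form\<eta>)
      show "dense_in (\<lambda>q. \<eta> q \<noteq> 0) N"
      proof (rule dense_in_mono)
        show "dense_in (\<lambda>q. P q \<and> \<Delta> s q \<noteq> 0) N"
        proof (rule dense_in_conj[OF dense_in_subset[OF dense] \<Delta>dense])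
          have "{z\<in>N. P z} = N \<inter> G" by (auto simp: G_def)
          then show "open {z\<in>N. P z}" using No Go by (simp add: open_Int)
        qed simp
        fix q assume q: "q \<in> N" "P q \<and> \<Delta> s q \<noteq> 0"
        then have qG: "q \<in> G" by (simp add: G_def)
        obtain u k where "k \<noteq> 0" "\<eta> q = covector_scale (\<Delta> s q * k) (rep D0 q + covector_scale (t * u D1) (rep D1 q))"
          using key[OF q(1) qG] by blast
        then show "\<eta> q \<noteq> 0" using q(2) Lnz[OF qG] by simp
      qed
      fix q assume "q \<in> N \<inter> G"
      then have qq: "q \<in> N" "q \<in> G" by auto
      obtain u k where "rep D0 q = (\<Sum>D\<in>B. covector_scale (u D) (rep D q))"
        "\<eta> q = covector_scale (\<Delta> s q * k) (rep D0 q + covector_scale (t * u D1) (rep D1 q))"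
        using key[OF qq] by blast
      then show "\<eta> q \<in> L t q" unfolding L_def by (intro CollectI exI conjI)
    qed
    then show ?thesis using pN by blast
  qed
  have compat: "par (\<eta> p) (\<eta>' p)" if m: "(N, \<eta>) \<in> H t" "(N', \<eta>') \<in> H t" and p: "p \<in> N" "p \<in> N'" for N \<eta> N' \<eta>' t p
  proof -
    have f: "holomorphic_form A N \<eta>" "holomorphic_form A N' \<eta>'" using m unfolding H by auto
    have o: "open (N \<inter> N')" using form_open[OF f(1)] form_open[OF f(2)] by auto
    show ?thesis
    proof (rule par_on_dense[OF A form_subset[OF A f(1) o] form_subset[OF A f(2) o]])
      show "dense_in (\<lambda>p. par (\<eta> p) (\<eta>' p)) (N \<inter> N')"
      proof (rule dense_in_mono[OF dense_in_subset[OF dense]])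
        fix q assume "q \<in> N \<inter> N'" "P q"
        then show "par (\<eta> q) (\<eta>' q)" using m unfolding H by (intro Lpar[of q]) (auto simp: G_def)
      qed simp
    qed (use p in auto)
  qed
  define T where "T = (\<lambda>t. {(W, \<omega>). defining_form A W \<omega> \<and> (\<forall>(N, \<eta>)\<in>H t. \<forall>p\<in>W \<inter> N. par (\<omega> p) (\<eta> p))})"
  have T: "T t \<in> Distr A" for t
    unfolding Distr_def T_def mem_Collect_eq
  proof (rule distribution_of_local_forms[OF A])
    show "holomorphic_form A N \<eta>" "dense_in (\<lambda>q. \<eta> q \<noteq> 0) N" if "(N, \<eta>) \<in> H t" for N \<eta>
      using that unfolding H by blast+
    show "\<exists>N \<eta>. (N, \<eta>) \<in> H t \<and> p \<in> N" for p by (rule cover)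
    show "par (\<eta> p) (\<eta>' p)" if "(N, \<eta>) \<in> H t" "(N', \<eta>') \<in> H t" "p \<in> N" "p \<in> N'" for N \<eta> N' \<eta>' p
      by (rule compat[OF that])
  qed
  have "inj T"
  proof (rule injI)
    fix t t' assume eq: "T t = T t'"
    obtain W \<omega> where W: "(W, \<omega>) \<in> T t" "undefined \<in> W" using Distr_cover[OF T] by blast
    obtain N \<eta> where N: "(N, \<eta>) \<in> H t" "undefined \<in> N" using cover by blast
    obtain N' \<eta>' where N': "(N', \<eta>') \<in> H t'" "undefined \<in> N'" using cover by blast
    have def: "defining_form A W \<omega>" using Distr_defining[OF T W(1)] .
    have f: "holomorphic_form A N \<eta>" "holomorphic_form A N' \<eta>'" and d: "dense_in (\<lambda>q. \<eta> q \<noteq> 0) N" "dense_in (\<lambda>q. \<eta>' q \<noteq> 0) N'"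
      using N N' unfolding H by auto
    let ?V = "W \<inter> N \<inter> N'"
    have Vo: "open ?V" using form_open[OF f(1)] form_open[OF f(2)] form_open[OF defining_form_form[OF def]] by auto
    note fV = form_subset[OF A f(1) Vo] form_subset[OF A f(2) Vo]
    have p\<omega>: "par (\<omega> q) (\<eta> q)" "par (\<omega> q) (\<eta>' q)" if "q \<in> ?V" for q
    proof -
      have "(W, \<omega>) \<in> T t'" using W eq by simp
      then show "par (\<omega> q) (\<eta> q)" "par (\<omega> q) (\<eta>' q)" using W(1) N(1) N'(1) that unfolding T_def by auto
    qed
    have p\<eta>: "par (\<eta> q) (\<eta>' q)" if q: "q \<in> ?V" for q
      by (rule par_trans_dense[OF A fV(1) fV(2) dense_in_subset[OF defining_form_dense[OF A def]]]) (use p\<omega> par_sym q in auto)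
    have "dense_in (\<lambda>q. \<eta> q \<noteq> 0 \<and> (\<eta>' q \<noteq> 0 \<and> P q)) ?V"
    proof (rule dense_in_conj)
      show "dense_in (\<lambda>q. \<eta> q \<noteq> 0) ?V" by (rule dense_in_subset[OF d(1)]) auto
      show "open {q\<in>?V. \<eta> q \<noteq> 0}" by (rule form_nonzero_open[OF A fV(1)]) auto
      show "dense_in (\<lambda>q. \<eta>' q \<noteq> 0 \<and> P q) ?V"
      proof (rule dense_in_conj)
        show "dense_in (\<lambda>q. \<eta>' q \<noteq> 0) ?V" by (rule dense_in_subset[OF d(2)]) auto
        show "open {q\<in>?V. \<eta>' q \<noteq> 0}" by (rule form_nonzero_open[OF A fV(2)]) auto
        show "dense_in P ?V" by (rule dense_in_subset[OF dense]) auto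
      qed
    qed
    then obtain q where q: "q \<in> ?V" "\<eta> q \<noteq> 0" "\<eta>' q \<noteq> 0" "P q"
      using dense_inD[OF _ Vo subset_refl, of _ undefined] W N N' by blast
    then have "q \<in> G" "\<eta> q \<in> L t q" "\<eta>' q \<in> L t' q" using N(1) N'(1) unfolding H by (auto simp: G_def)
    then show "t = t'" using Ldiff[of q] p\<eta>[OF q(1)] q by blast
  qed
  then have "infinite (range T)" using infinite_UNIV_char_0[where 'a=complex] finite_imageD by blast
  then show ?thesis using T by (meson finite_subset image_subsetI)
qed

text \<open>A dependent set of minimal cardinality has at least three members, so that the preceding lemma applies to
two of them.\<close>
lemma generic_independent:
  fixes A :: "('a::{t2_space,second_countable_topology}, 'n::finite) chart set"
  assumes A: "complex_atlas A" and con: "connected (UNIV :: 'a set)" and fin: "finite (Distr A)"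
  shows "\<exists>p. \<not> dependent_at (Distr A) p"
proof (rule ccontr)
  assume "\<not> ?thesis"
  then have "Distr A \<subseteq> Distr A \<and> (\<forall>p. dependent_at (Distr A) p)" by blast
  from ex_has_least_nat[of "\<lambda>E. E \<subseteq> Distr A \<and> (\<forall>p. dependent_at E p)" _ card, OF this]
  obtain E where E0: "E \<subseteq> Distr A \<and> (\<forall>p. dependent_at E p)"
    and min: "\<forall>E'. E' \<subseteq> Distr A \<and> (\<forall>p. dependent_at E' p) \<longrightarrow> card E \<le> card E'"
    by (elim exE, intro that) blast+
  have E: "E \<subseteq> Distr A" "\<And>p. dependent_at E p" using E0 by auto
  have fE: "finite E" using E(1) fin finite_subset by blast
  have proper: "\<exists>p. \<not> dependent_at E' p" if "E' \<subset> E" for E'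
  proof (rule ccontr)
    assume "\<not> ?thesis"
    then have "card E \<le> card E'" using min[rule_format, of E'] that E(1) by blast
    then show False using psubset_card_mono[OF fE that] by simp
  qed
  have "E \<noteq> {}" using E(2) unfolding dependent_at_def by auto
  then obtain D0 where D0: "D0 \<in> E" by blast
  have "E \<noteq> {D0}" using single_generic_independent[OF A, of D0] E D0 by auto
  then obtain D1 where D1: "D1 \<in> E" "D0 \<noteq> D1" using D0 by blast
  have "E \<noteq> {D0, D1}" using distinct_generic_independent[OF A, of D0 D1] E D0 D1 by auto
  then have "{D0, D1} \<subset> E" using D0 D1 by blast
  then have "infinite (Distr A)"
    by (intro minimal_relation_infinite[OF A con fE E D0 D1] proper) (use D0 D1 in auto)
  then show False using fin by blast
qed

text \<open>The type of covectors is infinite-dimensional, so finiteness has to come from the evaluation in one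
chart, which is injective on the cotangent space.\<close>
lemma cotangent_subspace_finite_basis:
  fixes A :: "('a::{t2_space,second_countable_topology}, 'n::finite) chart set"
  assumes A: "complex_atlas A" and B: "covector.independent B" "B \<subseteq> cotangent_space A p"
  shows "finite B"
proof (rule ccontr)
  assume "infinite B"
  then obtain S where S: "finite S" "S \<subseteq> B" "card S = Suc CARD('n)" using infinite_arbitrarily_large by blast
  obtain c where c: "c \<in> A" "p \<in> fst c" using atlas_cover[OF A] by blast
  have "card S \<le> CARD('n)"
  proof (rule family_card_le[OF S(1), of "\<lambda>\<alpha>. \<alpha> c"])
    fix u assume u: "(\<Sum>\<alpha>\<in>S. u \<alpha> *s \<alpha> c) = 0"
    have "(\<Sum>\<alpha>\<in>S. covector_scale (u \<alpha>) \<alpha>) \<in> cotangent_space A p"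
      by (rule covector.subspace_sum[OF cotangent_subspace]) (use S B cotangent_scale in blast)
    from cotangent_0_iff[OF this c] have "(\<Sum>\<alpha>\<in>S. covector_scale (u \<alpha>) \<alpha>) = 0"
      using u by (simp add: covector_sum_apply covector_scale_def)
    then show "\<forall>\<alpha>\<in>S. u \<alpha> = 0"
      using covector.independentD[OF B(1) S(1,2)] by blast
  qed
  then show False using S by simp
qed

lemma conormal_direction_eq:
  assumes D: "D \<in> Distr A" and nz: "rep D p \<noteq> 0"
  shows "conormal_direction D p = covector.span {rep D p}"
  unfolding conormal_direction_def
proof (rule the_equality)
  obtain W \<omega> where W: "(W, \<omega>) \<in> D" "p \<in> W" "rep D p = \<omega> p" using rep_member[OF D] by blast
  then show "\<exists>(W, \<omega>)\<in>D. p \<in> W \<and> \<omega> p \<noteq> 0 \<and> covector.span {rep D p} = covector.span {\<omega> p}"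
    using nz by (intro bexI[of _ "(W, \<omega>)"]) auto
  fix l assume "\<exists>(W, \<omega>)\<in>D. p \<in> W \<and> \<omega> p \<noteq> 0 \<and> l = covector.span {\<omega> p}"
  then obtain W \<omega> where W: "(W, \<omega>) \<in> D" "p \<in> W" "l = covector.span {\<omega> p}" by blast
  obtain k where k: "k \<noteq> 0" "\<omega> p = covector_scale k (rep D p)" using rep_unit[OF D W(1,2)] by blast
  have "covector.span {covector_scale k (rep D p)} = covector.span {rep D p}"
    using covector.span_image_scale[of "{rep D p}" "\<lambda>_. k"] k(1) by simp
  then show "l = covector.span {rep D p}" using W(3) k(2) by simp
qed

section \<open>General position\<close>
theorem proposition2p6:
  fixes A :: "('a::{t2_space,second_countable_topology}, 'n::finite) chart set"
  assumes "complex_atlas A"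
    and "connected (UNIV :: 'a set)"
    and "finite (Distr A)"
  shows "card (Distr A) \<le> CARD('n) \<and>
    (\<exists>Z. analytic_subset A Z \<and> Z \<noteq> UNIV \<and>
      (\<forall>p. p \<notin> Z \<longrightarrow>
        (\<forall>D\<in>Distr A. nonsingular_at D p) \<and>
        inj_on (\<lambda>D. conormal_direction D p) (Distr A) \<and>
        general_position (cotangent_space A p) ((\<lambda>D. conormal_direction D p) ` Distr A)))"
proof -
  note A = assms(1) and fin = assms(3)
  obtain p0 where p0: "\<not> dependent_at (Distr A) p0" using generic_independent[OF assms] by blast
  have card: "card (Distr A) \<le> CARD('n)" by (rule independent_at_card[OF A fin subset_refl p0])
  define Z where "Z = {p. dependent_at (Distr A) p}"
  have Z: "analytic_subset A Z" "Z \<noteq> UNIV"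
    using dependent_at_analytic[OF A fin subset_refl card] p0 by (auto simp: Z_def)
  have "(\<forall>D\<in>Distr A. nonsingular_at D p) \<and> inj_on (\<lambda>D. conormal_direction D p) (Distr A) \<and>
        general_position (cotangent_space A p) ((\<lambda>D. conormal_direction D p) ` Distr A)" if p: "p \<notin> Z" for p
  proof -
    let ?E = "cotangent_space A p"
    have ind: "\<forall>D\<in>Distr A. u D = 0" if "(\<Sum>D\<in>Distr A. covector_scale (u D) (rep D p)) = 0" for u
      using p that unfolding Z_def dependent_at_def by blast
    have fam: "inj_on (\<lambda>D. rep D p) (Distr A)" "covector.independent ((\<lambda>D. rep D p) ` Distr A)"
      by (rule covector.family_independent[OF fin], rule ind, assumption)+
    have nz: "rep D p \<noteq> 0" if "D \<in> Distr A" for D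
    proof
      assume "rep D p = 0"
      then have "0 \<in> (\<lambda>D. rep D p) ` Distr A" using that by (metis imageI)
      from covector.dependent_zero[OF this] show False using fam(2) by contradiction
    qed
    have con: "conormal_direction D p = covector.span {rep D p}" if "D \<in> Distr A" for D
      by (rule conormal_direction_eq[OF that nz[OF that]])
    have ns: "nonsingular_at D p" if D: "D \<in> Distr A" for D
    proof -
      obtain W \<omega> where "(W, \<omega>) \<in> D" "p \<in> W" "rep D p = \<omega> p" using rep_member[OF D] by blast
      then show ?thesis unfolding nonsingular_at_def using nz[OF D] by (intro bexI[of _ "(W, \<omega>)"]) auto
    qed
    have inj: "inj_on (\<lambda>D. conormal_direction D p) (Distr A)"
    proof (rule inj_onI, rule ccontr)
      fix D D' assume D: "D \<in> Distr A" "D' \<in> Distr A" "conormal_direction D p = conormal_direction D' p" "D \<noteq> D'"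
      have ne: "rep D p \<noteq> rep D' p" using fam(1) D by (auto dest: inj_onD)
      have "rep D p \<in> covector.span {rep D' p}"
        using D con[OF D(1)] con[OF D(2)] covector.span_base[of "rep D p" "{rep D p}"] by simp
      also have "covector.span {rep D' p} \<subseteq> covector.span ((\<lambda>D. rep D p) ` Distr A - {rep D p})"
        by (rule covector.span_mono) (use D ne in auto)
      finally show False using fam(2) D(1) unfolding covector.dependent_def by blast
    qed
    have "general_position ?E ((\<lambda>D. conormal_direction D p) ` Distr A)"
      unfolding general_position_def
    proof (intro conjI allI impI notI)
      show "finite ((\<lambda>D. conormal_direction D p) ` Distr A)" using fin by simp
      show "(\<lambda>D. conormal_direction D p) ` Distr A \<subseteq> projectivization ?E"
        unfolding projectivization_def using con nz rep_cotangent by blast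
      fix j T assume T: "int j \<le> projective_dim ?E \<and> T \<subseteq> (\<lambda>D. conormal_direction D p) ` Distr A \<and> card T = j + 1"
      assume "\<exists>V. covector.subspace V \<and> V \<subseteq> ?E \<and> projective_dim V < int j \<and> T \<subseteq> projectivization V"
      then obtain V where V: "covector.subspace V" "V \<subseteq> ?E" "projective_dim V < int j" "T \<subseteq> projectivization V" by blast
      obtain S where S: "S \<subseteq> Distr A" "T = (\<lambda>D. conormal_direction D p) ` S" using T by (meson subset_imageE)
      have cS: "card S = j + 1" using T S(2) card_image[OF inj_on_subset[OF inj S(1)]] by simp
      have repV: "rep D p \<in> V" if D: "D \<in> S" for D
      proof -
        have DD: "D \<in> Distr A" using S D by blast
        have "covector.span {rep D p} \<in> projectivization V" using V(4) S(2) D con[OF DD] by auto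
        then obtain \<alpha> where \<alpha>: "\<alpha> \<in> V" "covector.span {rep D p} = covector.span {\<alpha>}" unfolding projectivization_def by blast
        have "rep D p \<in> covector.span {\<alpha>}" using \<alpha>(2) covector.span_base[of "rep D p" "{rep D p}"] by simp
        also have "covector.span {\<alpha>} \<subseteq> V" by (rule covector.span_minimal) (use \<alpha> V in auto)
        finally show ?thesis .
      qed
      obtain B where B: "B \<subseteq> V" "covector.independent B" "V \<subseteq> covector.span B" "card B = covector.dim V"
        using covector.basis_exists by blast
      have fB: "finite B" by (rule cotangent_subspace_finite_basis[OF A B(2)]) (use B V in blast)
      have indS: "covector.independent ((\<lambda>D. rep D p) ` S)"
        by (rule covector.independent_mono[OF fam(2)]) (use S in blast)
      have "card ((\<lambda>D. rep D p) ` S) \<le> card B"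
        using covector.independent_span_bound[OF fB indS] repV B(3) by blast
      moreover have "card ((\<lambda>D. rep D p) ` S) = j + 1" using cS card_image[OF inj_on_subset[OF fam(1) S(1)]] by simp
      ultimately show False using V(3) B(4) by (simp add: projective_dim_def)
    qed
    then show ?thesis using ns inj by blast
  qed
  then show ?thesis using card Z by blast
qed

end
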